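(* Let $0<\theta<p<\infty$, $0<q\le\infty$ and $\sigma_1=\theta\left(\frac p\theta\right)'$. Let $t_1,t_2$ be weights with $t_1^p,t_2^p\in A_{\frac p\theta}(\mathbb{R}^n)$. Let $\dot A$ denote either $\dot B$ or $\dot F$. Then $$\dot A_{p,q}(\mathbb{R}^n,t_1)=\dot A_{p,q}(\mathbb{R}^n,t_2)$$ if and only if $$M_{Q,\sigma_1}(t_1^{-1})\approx M_{Q,\sigma_1}(t_2^{-1})\quad\text{and}\quad M_{Q,p}(t_1)\approx M_{Q,p}(t_2)$$ for any dyadic cube $Q$ of $\mathbb{R}^n$. In particular, $\dot A_{p,q}(\mathbb{R}^n)=\dot A_{p,q}(\mathbb{R}^n,t_1)$ if and only if $$M_{Q,\sigma_1}(t_1^{-1})\approx M_{Q,p}(t_1)\approx 1$$ for any dyadic cube $Q$ of $\mathbb{R}^n$.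
   Context: A weight is a nonnegative locally integrable function on $\mathbb{R}^n$ with values in $(0,\infty)$ a.e. $r'$ is the conjugate exponent of $r$. For $1<r<\infty$, $A_r(\mathbb{R}^n)$ is the Muckenhoupt class: weights $\gamma$ with $\sup_Q M_{Q,1}(\gamma)M_{Q,r'/r}(\gamma^{-1})<\infty$ over all cubes $Q$ with sides parallel to the axes, where $M_{Q,s}(f)=\big(\frac1{|Q|}\int_Q|f|^s\,dx\big)^{1/s}$ for $0<s<\infty$. Dyadic cubes are $Q_{v,m}=2^{-v}([0,1)^n+m)$, $v\in\mathbb{Z}$, $m\in\mathbb{Z}^n$. The relation $\approx$ means two-sided estimates with positive constants independent of the cube $Q$. Equality of two spaces means that they coincide as sets, with equivalent quasi-norms. Let $\mathcal{S}_\infty(\mathbb{R}^n)$ be the space of Schwartz functions all of whose moments vanish, and $\mathcal{S}_\infty'(\mathbb{R}^n)$ its topological dual. Fix $\varphi\in\mathcal{S}(\mathbb{R}^n)$ with $\operatorname{supp}\mathcal{F}\varphi\subset\{\frac12\le|\xi|\le2\}$ and $|\mathcal{F}\varphi(\xi)|\ge c>0$ for $\frac35\le|\xi|\le\frac53$; put $\varphi_k(x)=2^{kn}\varphi(2^kx)$, $k\in\mathbb{Z}$. For a weight $t$, $\dot B_{p,q}(\mathbb{R}^n,t)$ is the set of $f\in\mathcal{S}'_\infty(\mathbb{R}^n)$ with finite quasi-norm $\big(\sum_{k\in\mathbb{Z}}\|t(\varphi_k*f)\|_{L_p(\mathbb{R}^n)}^q\big)^{1/q}$, and $\dot F_{p,q}(\mathbb{R}^n,t)$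 is the set of $f\in\mathcal{S}'_\infty(\mathbb{R}^n)$ with finite quasi-norm $\big\|\big(\sum_{k\in\mathbb{Z}}t^q|\varphi_k*f|^q\big)^{1/q}\big\|_{L_p(\mathbb{R}^n)}$ (suprema over $k$ if $q=\infty$). $\dot A_{p,q}(\mathbb{R}^n)$ is the case $t\equiv1$. *)

theory Defs
  imports "HOL-Analysis.Analysis"
begin

section \<open>Schwartz functions and distributions modulo polynomials\<close>

definition partial_deriv :: "'n::finite \<Rightarrow> (real^'n \<Rightarrow> complex) \<Rightarrow> real^'n \<Rightarrow> complex" where
  "partial_deriv i f x = frechet_derivative f (at x) (axis i 1)"

text \<open>Multi-indices of derivatives are encoded as lists of directions; for smooth functions only
  the number of occurrences of each direction matters.\<close>

primrec iter_partial :: "'n::finite list \<Rightarrow> (real^'n \<Rightarrow> complex) \<Rightarrow> real^'n \<Rightarrow> complex" where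
  "iter_partial [] f = f"
| "iter_partial (i # is) f = partial_deriv i (iter_partial is f)"

definition smooth :: "(real^'n::finite \<Rightarrow> complex) \<Rightarrow> bool" where
  "smooth f \<longleftrightarrow> (\<forall>is x. iter_partial is f differentiable (at x))"

definition schwartz :: "(real^'n::finite \<Rightarrow> complex) set" where
  "schwartz = {f. smooth f \<and>
     (\<forall>N is. bounded (range (\<lambda>x. (1 + norm x) ^ N * norm (iter_partial is f x))))}"

definition schwartz_seminorm :: "nat \<Rightarrow> 'n::finite list \<Rightarrow> (real^'n \<Rightarrow> complex) \<Rightarrow> real" where
  "schwartz_seminorm N is f = (SUP x. (1 + norm x) ^ N * norm (iter_partial is f x))"

definition schwartz_infty :: "(real^'n::finite \<Rightarrow> complex) set" where
  "schwartz_infty = {f \<in> schwartz. \<forall>\<beta> :: 'n \<Rightarrow> nat.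
     (\<integral>x. of_real (\<Prod>i\<in>UNIV. (x $ i) ^ \<beta> i) * f x \<partial>lborel) = 0}"

definition schwartz_infty_topology :: "(real^'n::finite \<Rightarrow> complex) topology" where
  "schwartz_infty_topology = topology_generated_by
     {{g \<in> schwartz_infty. schwartz_seminorm N is (\<lambda>x. g x - f x) < \<epsilon>} | f N is \<epsilon>.
        f \<in> schwartz_infty \<and> 0 < \<epsilon>}"

text \<open>Functionals are \<^const>\<open>extensional\<close>, so that equality in the dual is equality of
  functions.\<close>

definition schwartz_infty_dual :: "((real^'n::finite \<Rightarrow> complex) \<Rightarrow> complex) set" where
  "schwartz_infty_dual = {f \<in> extensional schwartz_infty.
     (\<forall>\<psi>\<in>schwartz_infty. \<forall>\<eta>\<in>schwartz_infty. f (\<lambda>x. \<psi> x + \<eta> x) = f \<psi> + f \<eta>) \<and>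
     (\<forall>c. \<forall>\<psi>\<in>schwartz_infty. f (\<lambda>x. c * \<psi> x) = c * f \<psi>) \<and>
     continuous_map schwartz_infty_topology euclidean f}"

definition fourier :: "(real^'n::finite \<Rightarrow> complex) \<Rightarrow> real^'n \<Rightarrow> complex" where
  "fourier f \<xi> = of_real ((2 * pi) powr (- real CARD('n) / 2)) *
     (\<integral>x. exp (- \<i> * of_real (x \<bullet> \<xi>)) * f x \<partial>lborel)"

definition admissible :: "(real^'n::finite \<Rightarrow> complex) \<Rightarrow> bool" where
  "admissible \<phi> \<longleftrightarrow> \<phi> \<in> schwartz \<and>
     closure {\<xi>. fourier \<phi> \<xi> \<noteq> 0} \<subseteq> {\<xi>. 1/2 \<le> norm \<xi> \<and> norm \<xi> \<le> 2} \<and>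
     (\<exists>c>0. \<forall>\<xi>. 3/5 \<le> norm \<xi> \<and> norm \<xi> \<le> 5/3 \<longrightarrow> c \<le> norm (fourier \<phi> \<xi>))"

definition dilate :: "(real^'n::finite \<Rightarrow> complex) \<Rightarrow> int \<Rightarrow> real^'n \<Rightarrow> complex" where
  "dilate \<phi> k x = of_real (2 powi (k * int CARD('n))) * \<phi> ((2 powi k) *\<^sub>R x)"

definition conv :: "(real^'n::finite \<Rightarrow> complex) \<Rightarrow> ((real^'n \<Rightarrow> complex) \<Rightarrow> complex)
    \<Rightarrow> real^'n \<Rightarrow> complex" where
  "conv \<psi> f x = f (\<lambda>y. \<psi> (x - y))"

section \<open>Weights\<close>

definition ennpowr :: "ennreal \<Rightarrow> real \<Rightarrow> ennreal" where
  "ennpowr x s = (if x = \<infinity> then \<infinity> else ennreal (enn2real x powr s))"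
  \<comment> \<open>only used for \<open>s > 0\<close>\<close>

definition conj_exp :: "real \<Rightarrow> real" where
  "conj_exp r = r / (r - 1)"

definition weight :: "(real^'n::finite \<Rightarrow> real) \<Rightarrow> bool" where
  "weight t \<longleftrightarrow> (\<forall>x. 0 \<le> t x) \<and> (\<forall>K. compact K \<longrightarrow> set_integrable lebesgue K t) \<and>
     (AE x in lebesgue. 0 < t x)"

definition cubes :: "(real^'n::finite) set set" where
  "cubes = {cbox a (a + (\<chi> i. l)) | a l. 0 < l}"

definition dyadic_cubes :: "(real^'n::finite) set set" where
  "dyadic_cubes = {(\<lambda>x. (2 powi (- v)) *\<^sub>R (x + (\<chi> i. of_int (m i)))) ` {x. \<forall>i. x $ i \<in> {0..<1}}
     | (v :: int) (m :: 'n \<Rightarrow> int). True}"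

definition cube_mean :: "(real^'n::finite) set \<Rightarrow> real \<Rightarrow> (real^'n \<Rightarrow> real) \<Rightarrow> ennreal" where
  "cube_mean Q s f =
     ennpowr ((\<integral>\<^sup>+x\<in>Q. ennreal (\<bar>f x\<bar> powr s) \<partial>lebesgue) / emeasure lebesgue Q) (1 / s)"

definition muckenhoupt :: "real \<Rightarrow> (real^'n::finite \<Rightarrow> real) set" where
  "muckenhoupt r = {\<gamma>. weight \<gamma> \<and>
     (SUP Q\<in>cubes. cube_mean Q 1 \<gamma> * cube_mean Q (conj_exp r / r) (\<lambda>x. inverse (\<gamma> x))) < \<infinity>}"

definition dyadic_equiv :: "((real^'n::finite) set \<Rightarrow> ennreal) \<Rightarrow> ((real^'n) set \<Rightarrow> ennreal) \<Rightarrow> bool"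
  where "dyadic_equiv F G \<longleftrightarrow> (\<exists>c>0. \<exists>C>0. \<forall>Q\<in>dyadic_cubes.
     ennreal c * F Q \<le> G Q \<and> G Q \<le> ennreal C * F Q)"

section \<open>Homogeneous weighted Besov and Triebel--Lizorkin spaces\<close>

definition Lp_qnorm :: "real \<Rightarrow> (real^'n::finite \<Rightarrow> ennreal) \<Rightarrow> ennreal" where
  "Lp_qnorm p g = ennpowr (\<integral>\<^sup>+x. ennpowr (g x) p \<partial>lebesgue) (1 / p)"

definition lq_qnorm :: "ennreal \<Rightarrow> (int \<Rightarrow> ennreal) \<Rightarrow> ennreal" where
  "lq_qnorm q a = (if q = \<infinity> then (SUP k. a k)
     else ennpowr (\<Sum>\<^sub>\<infinity>k. ennpowr (a k) (enn2real q)) (1 / enn2real q))"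

datatype scale = Besov | Triebel_Lizorkin

primrec qnorm :: "scale \<Rightarrow> (real^'n::finite \<Rightarrow> complex) \<Rightarrow> real \<Rightarrow> ennreal \<Rightarrow> (real^'n \<Rightarrow> real)
    \<Rightarrow> ((real^'n \<Rightarrow> complex) \<Rightarrow> complex) \<Rightarrow> ennreal" where
  "qnorm Besov \<phi> p q t f =
     lq_qnorm q (\<lambda>k. Lp_qnorm p (\<lambda>x. ennreal (t x * norm (conv (dilate \<phi> k) f x))))"
| "qnorm Triebel_Lizorkin \<phi> p q t f =
     Lp_qnorm p (\<lambda>x. lq_qnorm q (\<lambda>k. ennreal (t x * norm (conv (dilate \<phi> k) f x))))"

definition space_A :: "scale \<Rightarrow> (real^'n::finite \<Rightarrow> complex) \<Rightarrow> real \<Rightarrow> ennreal \<Rightarrow> (real^'n \<Rightarrow> real)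
    \<Rightarrow> ((real^'n \<Rightarrow> complex) \<Rightarrow> complex) set" where
  "space_A A \<phi> p q t = {f \<in> schwartz_infty_dual. qnorm A \<phi> p q t f < \<infinity>}"

definition same_space :: "scale \<Rightarrow> (real^'n::finite \<Rightarrow> complex) \<Rightarrow> real \<Rightarrow> ennreal
    \<Rightarrow> (real^'n \<Rightarrow> real) \<Rightarrow> (real^'n \<Rightarrow> real) \<Rightarrow> bool" where
  "same_space A \<phi> p q t1 t2 \<longleftrightarrow> space_A A \<phi> p q t1 = space_A A \<phi> p q t2 \<and>
     (\<exists>c>0. \<exists>C>0. \<forall>f\<in>space_A A \<phi> p q t1.
        ennreal c * qnorm A \<phi> p q t1 f \<le> qnorm A \<phi> p q t2 f \<and>
        qnorm A \<phi> p q t2 f \<le> ennreal C * qnorm A \<phi> p q t1 f)"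

end

theory Submission
  imports Defs "HOL-Probability.Sinc_Integral"
begin

text \<open>
  Write \<open>r = p/\<theta>\<close>. Both sides of the equivalence amount to the same pointwise statement: \<open>t\<^sub>1\<close> and
  \<open>t\<^sub>2\<close> are comparable almost everywhere, with constants.

  \<^bold>\<open>Means.\<close> For \<open>\<gamma> = t\<^sup>p\<close> the two factors in the definition of \<open>A\<^sub>r\<close> are the \<open>p\<close>-th powers of the \<open>p\<close>-mean
  of \<open>t\<close> and of the \<open>\<sigma>\<^sub>1\<close>-mean of \<open>1/t\<close>. The \<open>A\<^sub>r\<close> condition bounds their product above, and a form of
  Hoelder's inequality bounds it below (\<open>cube_means_product\<close>). So comparability of the \<open>p\<close>-means
  implies comparability of the \<open>\<sigma>\<^sub>1\<close>-means, and only the \<open>p\<close>-means have to be related to the spaces.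

  \<^bold>\<open>From means to spaces.\<close> Comparable \<open>p\<close>-means say that the measures with densities \<open>t\<^sub>1\<^sup>p\<close> and \<open>t\<^sub>2\<^sup>p\<close>
  are comparable on dyadic cubes. An open set is an increasing union of disjoint unions of such
  cubes, and a bounded measurable set is, up to a null set, a decreasing intersection of open sets.
  Hence the densities are comparable almost everywhere (\<open>dyadic_comparison_AE\<close>), and then so are
  the quasi-norms of every distribution, for both scales.

  \<^bold>\<open>From spaces to means.\<close> Fix one function \<open>f\<close> that decays like \<open>(1 + |x|)\<^bsup>-M\<^esup>\<close> and whose Fourier
  transform lives close to the unit sphere, and move it to a dyadic cube \<open>Q\<close> of side \<open>2\<^bsup>-v\<^esup>\<close> and corner \<open>z\<close>
  by \<open>y \<mapsto> f (2\<^sup>v(y - z))\<close>. Only the three convolutions with \<open>|k - v| \<le> 1\<close> are nonzero, all of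
  them decay away from \<open>Q\<close> at scale \<open>2\<^bsup>-v\<^esup>\<close>, and the one with \<open>k = v\<close> is bounded below near \<open>z\<close>. Since \<open>A\<^sub>r\<close>
  weights are doubling, the quasi-norm of this test distribution is comparable to
  \<open>(\<integral>\<^sub>Q t\<^sup>p)\<^bsup>1/p\<^esup>\<close> with constants that do not depend on \<open>Q\<close>
  (\<open>test_functional_qnorm_upper\<close>, \<open>test_functional_qnorm_lower\<close>). Testing the equality of the
  spaces on these distributions compares the \<open>p\<close>-means.

  The function \<open>f\<close> is a plane wave times a product of factors \<open>sinc (\<epsilon> y\<^sub>i)\<close>. Each factor is an average
  of plane waves, so by Fubini's theorem the convolutions of \<open>f\<close> are averages of plane waves
  weighted with values of the Fourier transform of \<open>\<phi>\<close>, and they vanish where these values do.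
\<close>

section \<open>Quasi-norms\<close>

lemma ennpowr_ennreal: "0 \<le> a \<Longrightarrow> ennpowr (ennreal a) s = ennreal (a powr s)"
  by (simp add: ennpowr_def)

lemma ennpowr_mono:
  assumes "x \<le> y" "0 < s"
  shows "ennpowr x s \<le> ennpowr y s"
proof (cases y)
  case (real b)
  then obtain a where "x = ennreal a" "0 \<le> a"
    using assms(1) by (metis ennreal_cases ennreal_less_top infinity_ennreal_def leD)
  then show ?thesis using real assms by (auto simp: ennpowr_ennreal intro!: ennreal_leI powr_mono2)
qed (simp add: ennpowr_def)

lemma ennpowr_cmult:
  assumes "0 \<le> K" "0 < s"
  shows "ennpowr (ennreal K * x) s = ennreal (K powr s) * ennpowr x s"
proof (cases x)
  case (real a)
  then show ?thesis using assms
    by (simp add: ennpowr_ennreal powr_mult flip: ennreal_mult)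
next
  case top
  show ?thesis
    using assms by (cases "K = 0") (auto simp: ennpowr_def top ennreal_mult_top)
qed

lemma ennpowr_ennpowr: "0 < s \<Longrightarrow> ennpowr (ennpowr x s) (1 / s) = x"
  by (cases x) (auto simp: ennpowr_ennreal powr_powr, auto simp: ennpowr_def)

lemma ennpowr_zero: "ennpowr 0 s = 0"
  by (simp add: ennpowr_def)

lemma ennpowr_lt_top: "x < \<infinity> \<Longrightarrow> ennpowr x s < \<infinity>"
  by (auto simp: ennpowr_def)

text \<open>Half of the homogeneity of the upper integral, for arbitrary \<open>f\<close>. It is meant for integrands
built from \<open>x \<mapsto> F (\<lambda>y. \<phi>\<^sub>k (x - y))\<close> with an arbitrary functional \<open>F\<close>. Scaling a simple minorant of one
integrand gives one of the other.\<close>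

lemma nn_integral_cmult_le:
  assumes "0 < K"
  shows "(\<integral>\<^sup>+x. ennreal K * f x \<partial>M) \<le> ennreal K * (\<integral>\<^sup>+x. f x \<partial>M)"
  unfolding nn_integral_def[of M "\<lambda>x. ennreal K * f x"]
proof (rule SUP_least)
  fix g assume "g \<in> {g. simple_function M g \<and> g \<le> (\<lambda>x. ennreal K * f x)}"
  then have g: "simple_function M g" "\<And>x. g x \<le> ennreal K * f x" by (auto simp: le_fun_def)
  define h where "h x = ennreal (1/K) * g x" for x
  have gh: "g x = ennreal K * h x" for x
    using assms by (simp add: h_def mult.assoc[symmetric] flip: ennreal_mult)
  have "h x \<le> ennreal (1/K) * (ennreal K * f x)" for x
    unfolding h_def by (rule mult_left_mono[OF g(2)]) simp
  then have hf: "h x \<le> f x" for x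
    using assms by (simp add: mult.assoc[symmetric] flip: ennreal_mult)
  have hm: "h \<in> borel_measurable M"
    unfolding h_def using g(1) by (intro borel_measurable_times borel_measurable_simple_function) auto
  have "integral\<^sup>S M g = (\<integral>\<^sup>+x. ennreal K * h x \<partial>M)"
    using nn_integral_eq_simple_integral[OF g(1)] by (simp flip: gh)
  also have "\<dots> = ennreal K * (\<integral>\<^sup>+x. h x \<partial>M)" using hm by (rule nn_integral_cmult)
  also have "\<dots> \<le> ennreal K * (\<integral>\<^sup>+x. f x \<partial>M)"
    by (intro mult_left_mono nn_integral_mono hf) simp
  finally show "integral\<^sup>S M g \<le> ennreal K * (\<integral>\<^sup>+x. f x \<partial>M)" .
qed

lemma Lp_qnorm_mono_AE:
  assumes "0 < p" "AE x in lebesgue. f x \<le> g x"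
  shows "Lp_qnorm p f \<le> Lp_qnorm p g"
  unfolding Lp_qnorm_def
  using assms by (intro ennpowr_mono nn_integral_mono_AE) (auto intro: ennpowr_mono)

lemma Lp_qnorm_cmult_le:
  assumes "0 < p" "0 < K"
  shows "Lp_qnorm p (\<lambda>x. ennreal K * f x) \<le> ennreal K * Lp_qnorm p f"
proof -
  have "Lp_qnorm p (\<lambda>x. ennreal K * f x)
      = ennpowr (\<integral>\<^sup>+x. ennreal (K powr p) * ennpowr (f x) p \<partial>lebesgue) (1/p)"
    using assms by (simp add: Lp_qnorm_def ennpowr_cmult)
  also have "\<dots> \<le> ennpowr (ennreal (K powr p) * (\<integral>\<^sup>+x. ennpowr (f x) p \<partial>lebesgue)) (1/p)"
    using assms by (intro ennpowr_mono nn_integral_cmult_le) auto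
  also have "\<dots> = ennreal K * Lp_qnorm p f"
    using assms by (simp add: Lp_qnorm_def ennpowr_cmult powr_powr)
  finally show ?thesis .
qed

lemma lq_qnorm_mono:
  assumes "0 < q" "\<And>k. a k \<le> b k"
  shows "lq_qnorm q a \<le> lq_qnorm q b"
proof (cases "q = \<infinity>")
  case True
  then show ?thesis using assms by (auto simp: lq_qnorm_def intro!: SUP_mono)
next
  case False
  then have "0 < enn2real q" using assms(1) by (simp add: enn2real_positive_iff less_top)
  then show ?thesis using False assms
    by (auto simp: lq_qnorm_def intro!: ennpowr_mono infsum_mono nonneg_summable_on_complete)
qed

lemma infsum_cmult_ennreal: "(\<Sum>\<^sub>\<infinity>k\<in>A. c * f k) = (c::ennreal) * (\<Sum>\<^sub>\<infinity>k\<in>A. f k)"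
  by (simp add: nonneg_infsum_complete SUP_mult_left_ennreal flip: sum_distrib_left)

lemma lq_qnorm_cmult:
  assumes "0 < q" "0 < K"
  shows "lq_qnorm q (\<lambda>k. ennreal K * a k) = ennreal K * lq_qnorm q a"
proof (cases "q = \<infinity>")
  case True
  then show ?thesis by (auto simp: lq_qnorm_def SUP_mult_left_ennreal)
next
  case False
  then have q: "0 < enn2real q" using assms(1) by (simp add: enn2real_positive_iff less_top)
  show ?thesis using False q assms(2)
    by (simp add: lq_qnorm_def ennpowr_cmult infsum_cmult_ennreal powr_powr)
qed

lemma lq_qnorm_ge:
  assumes "0 < q"
  shows "a k \<le> lq_qnorm q a"
proof (cases "q = \<infinity>")
  case True
  then show ?thesis by (auto simp: lq_qnorm_def intro: SUP_upper)
next
  case False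
  then have q: "0 < enn2real q" using assms(1) by (simp add: enn2real_positive_iff less_top)
  have "infsum (\<lambda>k. ennpowr (a k) (enn2real q)) {k} \<le> (\<Sum>\<^sub>\<infinity>k. ennpowr (a k) (enn2real q))"
    by (rule infsum_mono_neutral) (auto intro: nonneg_summable_on_complete)
  then have "ennpowr (ennpowr (a k) (enn2real q)) (1 / enn2real q) \<le> lq_qnorm q a"
    using False q by (auto simp: lq_qnorm_def intro!: ennpowr_mono)
  then show ?thesis using q by (simp add: ennpowr_ennpowr)
qed

text \<open>The \<open>l\<^sub>q\<close> quasi-norm of a sequence with three entries 1 and zeros elsewhere.\<close>

definition lq3 :: "ennreal \<Rightarrow> real" where
  "lq3 q = (if q = \<infinity> then 1 else 3 powr (1 / enn2real q))"

lemma lq3_pos: "0 < lq3 q" by (simp add: lq3_def)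

lemma lq_qnorm_three_terms:
  assumes "0 < q" "\<And>k. \<bar>k - v\<bar> \<le> 1 \<Longrightarrow> a k \<le> B" "\<And>k. 2 \<le> \<bar>k - v\<bar> \<Longrightarrow> a k = 0"
  shows "lq_qnorm q a \<le> ennreal (lq3 q) * B"
proof (cases "q = \<infinity>")
  case True
  have "a k \<le> B" for k using assms(2)[of k] assms(3)[of k] by (cases "\<bar>k - v\<bar> \<le> 1") auto
  then show ?thesis using True by (auto simp: lq_qnorm_def lq3_def intro: SUP_least)
next
  case False
  then have q: "0 < enn2real q" using assms(1) by (simp add: enn2real_positive_iff less_top)
  have "(\<Sum>\<^sub>\<infinity>k. ennpowr (a k) (enn2real q)) = (\<Sum>\<^sub>\<infinity>k\<in>{v-1..v+1}. ennpowr (a k) (enn2real q))"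
    using assms(3) by (intro infsum_cong_neutral) (auto simp: ennpowr_zero)
  also have "\<dots> = (\<Sum>k\<in>{v-1..v+1}. ennpowr (a k) (enn2real q))" by simp
  also have "\<dots> \<le> (\<Sum>k\<in>{v-1..v+1}. ennpowr B (enn2real q))"
    using q assms(2) by (intro sum_mono ennpowr_mono) auto
  also have "\<dots> = ennreal 3 * ennpowr B (enn2real q)" by simp
  finally have "lq_qnorm q a \<le> ennpowr (ennreal 3 * ennpowr B (enn2real q)) (1 / enn2real q)"
    using False q by (auto simp: lq_qnorm_def intro!: ennpowr_mono)
  also have "\<dots> = ennreal (lq3 q) * B"
    using False q by (simp add: ennpowr_cmult ennpowr_ennpowr lq3_def del: ennreal_numeral)
  finally show ?thesis .
qed

text \<open>Both scales are monotone and homogeneous in the weight, whatever the distribution is. This settles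
the passage from comparable weights to equal spaces.\<close>

lemma qnorm_mono_weight:
  assumes "0 < p" "0 < q" "0 < K" "AE x in lebesgue. t' x \<le> K * t x"
  shows "qnorm A \<phi> p q t' f \<le> ennreal K * qnorm A \<phi> p q t f"
proof -
  have AE: "AE x in lebesgue. ennreal (t' x * norm (u x)) \<le> ennreal K * ennreal (t x * norm (u x))"
    for u :: "real^'a \<Rightarrow> complex"
    using assms(4)
  proof eventually_elim
    case (elim x)
    then have "t' x * norm (u x) \<le> K * (t x * norm (u x))"
      using mult_right_mono[OF elim norm_ge_zero[of "u x"]] by (simp add: mult.assoc)
    then show ?case using assms(3) by (metis ennreal_leI ennreal_mult' less_imp_le)
  qed
  show ?thesis
  proof (cases A)
    case Besov
    have "Lp_qnorm p (\<lambda>x. ennreal (t' x * norm (u x))) \<le> ennreal K * Lp_qnorm p (\<lambda>x. ennreal (t x * norm (u x)))"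
      for u :: "real^'a \<Rightarrow> complex"
      by (rule order_trans[OF Lp_qnorm_mono_AE[OF assms(1) AE] Lp_qnorm_cmult_le[OF assms(1,3)]])
    then show ?thesis using Besov assms(2,3)
      by (simp flip: lq_qnorm_cmult) (intro lq_qnorm_mono, auto)
  next
    case Triebel_Lizorkin
    have "AE x in lebesgue. lq_qnorm q (\<lambda>k. ennreal (t' x * norm (u k x)))
        \<le> ennreal K * lq_qnorm q (\<lambda>k. ennreal (t x * norm (u k x)))"
      for u :: "int \<Rightarrow> real^'a \<Rightarrow> complex"
      using assms(4)
    proof eventually_elim
      case (elim x)
      have "ennreal (t' x * norm (u k x)) \<le> ennreal K * ennreal (t x * norm (u k x))" for k
      proof -
        have "t' x * norm (u k x) \<le> K * (t x * norm (u k x))"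
          using mult_right_mono[OF elim norm_ge_zero[of "u k x"]] by (simp add: mult.assoc)
        then show ?thesis using assms(3) by (metis ennreal_leI ennreal_mult' less_imp_le)
      qed
      then show ?case using assms(2,3) by (simp flip: lq_qnorm_cmult) (intro lq_qnorm_mono, auto)
    qed
    then show ?thesis using Triebel_Lizorkin
      by (auto intro: order_trans[OF Lp_qnorm_mono_AE[OF assms(1)] Lp_qnorm_cmult_le[OF assms(1,3)]])
  qed
qed

lemma same_space_of_comparable_weights:
  assumes "0 < p" "0 < q" "0 < K" "0 < L"
    and "AE x in lebesgue. t2 x \<le> K * t1 x" "AE x in lebesgue. t1 x \<le> L * t2 x"
  shows "same_space A \<phi> p q t1 t2"
proof -
  have 1: "qnorm A \<phi> p q t2 f \<le> ennreal K * qnorm A \<phi> p q t1 f" for f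
    by (rule qnorm_mono_weight[OF assms(1,2,3,5)])
  have 2: "qnorm A \<phi> p q t1 f \<le> ennreal L * qnorm A \<phi> p q t2 f" for f
    by (rule qnorm_mono_weight[OF assms(1,2,4,6)])
  have sp: "space_A A \<phi> p q t1 = space_A A \<phi> p q t2"
  proof -
    have "qnorm A \<phi> p q t1 f < \<infinity> \<longleftrightarrow> qnorm A \<phi> p q t2 f < \<infinity>" for f
      using le_less_trans[OF 1[of f]] le_less_trans[OF 2[of f]] by (auto simp: ennreal_mult_less_top)
    then show ?thesis unfolding space_A_def by blast
  qed
  have "ennreal (1/L) * qnorm A \<phi> p q t1 f \<le> qnorm A \<phi> p q t2 f" for f
  proof -
    have "ennreal (1/L) * qnorm A \<phi> p q t1 f \<le> ennreal (1/L) * (ennreal L * qnorm A \<phi> p q t2 f)"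
      by (intro mult_left_mono 2) simp
    then show ?thesis using assms(4) by (simp add: mult.assoc[symmetric] flip: ennreal_mult)
  qed
  then show ?thesis unfolding same_space_def using sp 1 assms(3,4)
    by (intro conjI exI[of _ "1/L"] exI[of _ K]) auto
qed

section \<open>Muckenhoupt weights on cubes\<close>

definition cube :: "real^'n::finite \<Rightarrow> real \<Rightarrow> (real^'n) set" where
  "cube a l = cbox a (a + (\<chi> i. l))"

lemma mem_cube: "x \<in> cube a l \<longleftrightarrow> (\<forall>i. a $ i \<le> x $ i \<and> x $ i \<le> a $ i + l)"
  by (simp add: cube_def mem_box_cart)

lemma cube_lebesgue [measurable]: "cube a l \<in> sets lebesgue"
  by (simp add: cube_def)

lemma emeasure_cube:
  fixes a :: "real^'n::finite"
  assumes "0 < l"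
  shows "emeasure lebesgue (cube a l) = ennreal (l ^ CARD('n))"
proof -
  have e: "(\<chi> i. l) \<bullet> b = l" if "b \<in> Basis" for b :: "real^'n"
    using that by (auto simp: Basis_vec_def inner_axis)
  have "emeasure lborel (cube a l) = (\<Prod>b\<in>Basis. ennreal (((a + (\<chi> i. l)) - a) \<bullet> b))"
    unfolding cube_def using assms e by (subst emeasure_lborel_cbox) (auto simp: inner_add_left prod_ennreal ennreal_power)
  also have "\<dots> = ennreal (l ^ CARD('n))"
    using assms by (simp add: e) (simp add: ennreal_power less_imp_le)
  finally show ?thesis by (simp add: cube_def)
qed

text \<open>Hoelder's inequality \<open>|E|\<^bsup>1 + 1/s\<^esup> \<le> (\<integral>\<^sub>E w) (\<integral>\<^sub>E w\<^bsup>-s\<^esup>)\<^bsup>1/s\<^esup>\<close> up to a constant. For every \<open>l > 0\<close> one of the two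
terms in \<open>1 \<le> l w + (l w)\<^bsup>-s\<^esup>\<close> is at least 1; integrating this over \<open>E\<close> and optimising in \<open>l\<close> gives the claim.\<close>

lemma weak_holder:
  assumes [measurable]: "w \<in> borel_measurable M" "E \<in> sets M"
    and pos: "AE x in M. 0 < w x" and s: "0 < s"
    and e: "emeasure M E = ennreal e" "0 < e"
    and a: "(\<integral>\<^sup>+x\<in>E. ennreal (w x) \<partial>M) = ennreal a" "0 \<le> a"
    and b: "(\<integral>\<^sup>+x\<in>E. ennreal (inverse (w x) powr s) \<partial>M) = ennreal b" "0 \<le> b"
  shows "e powr (1 + 1/s) \<le> 2 powr (1 + 1/s) * a * b powr (1/s)"
proof -
  have main: "e \<le> l * a + l powr (-s) * b" if l: "0 < l" for l
  proof -
    have "AE x in M. (indicator E x::ennreal) \<le> ennreal l * (ennreal (w x) * indicator E x)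
        + ennreal (l powr (-s)) * (ennreal (inverse (w x) powr s) * indicator E x)"
      using pos
    proof eventually_elim
      case (elim x)
      have "1 \<le> l * w x + l powr (-s) * inverse (w x) powr s"
      proof (cases "1 \<le> l * w x")
        case True
        then show ?thesis by (simp add: add_increasing2)
      next
        case False
        have "l powr (-s) * inverse (w x) powr s = (inverse (l * w x)) powr s"
          using l elim by (simp add: powr_minus powr_mult flip: inverse_powr)
        moreover have "1 \<le> (inverse (l * w x)) powr s"
          using False l elim s by (intro ge_one_powr_ge_zero one_le_inverse) auto
        ultimately show ?thesis using l elim by (simp add: add_increasing)
      qed
      then show ?case using l elim
        by (auto simp: indicator_def simp flip: ennreal_mult ennreal_plus)
    qed
    then have "(\<integral>\<^sup>+x. indicator E x \<partial>M) \<le> (\<integral>\<^sup>+x. ennreal l * (ennreal (w x) * indicator E x)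
        + ennreal (l powr (-s)) * (ennreal (inverse (w x) powr s) * indicator E x) \<partial>M)"
      by (rule nn_integral_mono_AE)
    then have "ennreal e \<le> ennreal l * ennreal a + ennreal (l powr (-s)) * ennreal b"
      using e a b by (subst (asm) nn_integral_add) (auto simp: nn_integral_cmult)
    then show ?thesis using l a b by (simp flip: ennreal_mult ennreal_plus)
  qed
  have bpos: "0 < b"
  proof (rule ccontr)
    assume "\<not> 0 < b"
    \<comment> \<open>If \<open>b\<close> vanishes, a small \<open>l\<close> contradicts \<open>main\<close>.\<close>
    then have "b = 0" using b by simp
    then have "e \<le> (e / (2 * (a + 1))) * a" using main[of "e / (2 * (a + 1))"] e a by simp
    moreover have "(e / (2 * (a + 1))) * a < e"
      using e a by (simp add: field_simps) (simp add: add_nonneg_pos)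
    ultimately show False by simp
  qed
  \<comment> \<open>This choice makes the second term on the right of \<open>main\<close> equal to \<open>e / 2\<close>.\<close>
  define l where "l = (2 * b / e) powr (1/s)"
  have l: "0 < l" using bpos e by (simp add: l_def)
  have "l powr (-s) = inverse (2 * b / e)"
    using bpos e s by (simp add: l_def powr_powr powr_minus)
  then have "e / 2 \<le> l * a" using main[OF l] bpos e by (simp add: field_simps)
  then have "e * e powr (1/s) \<le> (2 * (l * a)) * e powr (1/s)"
    by (intro mult_right_mono) auto
  also have "\<dots> = 2 * 2 powr (1/s) * a * b powr (1/s)"
    using bpos e by (simp add: l_def powr_mult powr_divide)
  finally show ?thesis using e by (simp add: powr_add)
qed

lemma weight_measurable:
  assumes "weight t"
  shows "t \<in> borel_measurable lebesgue"
proof -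
  have "(\<lambda>x. t x * indicator (cball 0 (real k)) x) \<in> borel_measurable lebesgue" for k :: nat
    using assms unfolding weight_def set_integrable_def
    by (auto dest!: spec[of _ "cball 0 (real k)"] borel_measurable_integrable simp: mult.commute)
  moreover have "(\<lambda>k. t x * indicator (cball 0 (real k)) x) \<longlonglongrightarrow> t x" for x
  proof (rule tendsto_eventually)
    obtain k0 :: nat where "norm x \<le> real k0" using real_arch_simple by blast
    then show "\<forall>\<^sub>F k in sequentially. t x * indicator (cball 0 (real k)) x = t x"
      by (intro eventually_sequentiallyI[of k0]) (auto simp: indicator_def)
  qed
  ultimately show ?thesis by (rule borel_measurable_LIMSEQ_real[rotated])
qed

lemma weight_nn_integral_finite:
  assumes "weight t" "compact K"
  shows "(\<integral>\<^sup>+x\<in>K. ennreal (t x) \<partial>lebesgue) < \<infinity>"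
proof -
  have "integrable lebesgue (\<lambda>x. indicator K x *\<^sub>R t x)"
    using assms by (auto simp: weight_def set_integrable_def)
  then have "(\<integral>\<^sup>+x. ennreal (norm (indicator K x *\<^sub>R t x)) \<partial>lebesgue) < \<infinity>"
    by (simp add: integrable_iff_bounded)
  moreover have "(\<integral>\<^sup>+x\<in>K. ennreal (t x) \<partial>lebesgue) = (\<integral>\<^sup>+x. ennreal (norm (indicator K x *\<^sub>R t x)) \<partial>lebesgue)"
    using assms by (intro nn_integral_cong) (auto simp: weight_def indicator_def)
  ultimately show ?thesis by simp
qed

lemma nn_integral_cube_pos:
  assumes [measurable]: "w \<in> borel_measurable lebesgue" and "AE x in lebesgue. 0 < w x" "0 < l"
  shows "0 < (\<integral>\<^sup>+x\<in>cube a l. ennreal (w x) \<partial>lebesgue)"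
proof (rule ccontr)
  assume "\<not> ?thesis"
  then have "(\<integral>\<^sup>+x\<in>cube a l. ennreal (w x) \<partial>lebesgue) = 0" by simp
  then have "AE x in lebesgue. ennreal (w x) * indicator (cube a l) x = 0"
    by (subst (asm) nn_integral_0_iff_AE) auto
  then have "AE x in lebesgue. x \<notin> cube a l"
    using assms(2) by eventually_elim (auto simp: indicator_def ennreal_eq_0_iff split: if_splits)
  then have "emeasure lebesgue (cube a l) = 0"
    by (subst (asm) AE_iff_measurable[where N="cube a l"]) auto
  then show False using emeasure_cube[OF assms(3), of a] zero_less_power[OF assms(3), of "CARD('a)"]
    by (simp add: ennreal_eq_0_iff del: zero_less_power)
qed

text \<open>The \<open>A\<^sub>r\<close> condition in terms of real numbers. In extended arithmetic a product \<open>0 * \<infinity>\<close> would satisfy the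
bound, so finiteness of the second integral rests on positivity of the first.\<close>

lemma muckenhoupt_cube_bounds:
  fixes \<gamma> :: "real^'n::finite \<Rightarrow> real"
  assumes "\<gamma> \<in> muckenhoupt r" and r: "1 < r"
  shows "\<exists>K>0. \<forall>a l. 0 < l \<longrightarrow> (\<exists>W V. 0 < W \<and> 0 < V \<and>
      (\<integral>\<^sup>+x\<in>cube a l. ennreal (\<gamma> x) \<partial>lebesgue) = ennreal W \<and>
      (\<integral>\<^sup>+x\<in>cube a l. ennreal (inverse (\<gamma> x) powr (1 / (r - 1))) \<partial>lebesgue) = ennreal V \<and>
      W * V powr (r - 1) \<le> K * (l ^ CARD('n)) powr r)"
proof -
  define s where "s = 1 / (r - 1)"
  have s: "0 < s" "1 / s = r - 1" "conj_exp r / r = s"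
    using r by (auto simp: s_def conj_exp_def)
  have w: "weight \<gamma>" and "(SUP Q\<in>cubes. cube_mean Q 1 \<gamma> * cube_mean Q s (\<lambda>x. inverse (\<gamma> x))) < \<infinity>"
    using assms(1) by (auto simp: muckenhoupt_def s(3))
  then obtain K0 where K0: "(SUP Q\<in>cubes. cube_mean Q 1 \<gamma> * cube_mean Q s (\<lambda>x. inverse (\<gamma> x))) = ennreal K0" "0 \<le> K0"
    by (auto simp: less_top_ennreal)
  have [measurable]: "\<gamma> \<in> borel_measurable lebesgue" using weight_measurable[OF w] .
  have pos: "AE x in lebesgue. 0 < \<gamma> x" and nn: "\<And>x. 0 \<le> \<gamma> x" using w by (auto simp: weight_def)
  have "\<exists>W V. 0 < W \<and> 0 < V \<and>
      (\<integral>\<^sup>+x\<in>cube a l. ennreal (\<gamma> x) \<partial>lebesgue) = ennreal W \<and>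
      (\<integral>\<^sup>+x\<in>cube a l. ennreal (inverse (\<gamma> x) powr s) \<partial>lebesgue) = ennreal V \<and>
      W * V powr (r - 1) \<le> (K0 + 1) * (l ^ CARD('n)) powr r" if l: "0 < l" for a l
  proof -
    define L where "L = l ^ CARD('n)"
    have L: "0 < L" using l by (simp add: L_def)
    define W' where "W' = (\<integral>\<^sup>+x\<in>cube a l. ennreal (\<gamma> x) \<partial>lebesgue)"
    define V' where "V' = (\<integral>\<^sup>+x\<in>cube a l. ennreal (inverse (\<gamma> x) powr s) \<partial>lebesgue)"
    have "W' < \<infinity>" unfolding W'_def using w by (rule weight_nn_integral_finite) (simp add: cube_def)
    moreover have "0 < W'" unfolding W'_def by (rule nn_integral_cube_pos) (use pos l in auto)
    ultimately obtain W where W: "W' = ennreal W" "0 < W"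
      by (auto simp: less_top_ennreal)
    have V'pos: "0 < V'" unfolding V'_def
      using pos by (intro nn_integral_cube_pos) (use l in auto)
    have "cube a l \<in> cubes" using l by (auto simp: cubes_def cube_def)
    then have "cube_mean (cube a l) 1 \<gamma> * cube_mean (cube a l) s (\<lambda>x. inverse (\<gamma> x)) \<le> ennreal K0"
      unfolding K0(1)[symmetric] by (rule SUP_upper)
    moreover have "cube_mean (cube a l) 1 \<gamma> = ennreal (W / L)"
      using W L nn by (simp add: cube_mean_def emeasure_cube[OF l] W'_def[symmetric] L_def[symmetric] divide_ennreal ennpowr_ennreal)
    moreover have "cube_mean (cube a l) s (\<lambda>x. inverse (\<gamma> x)) = ennpowr (V' / ennreal L) (r - 1)"
      using nn by (simp add: cube_mean_def emeasure_cube[OF l] V'_def[symmetric] L_def[symmetric] s(2))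
    ultimately have le: "ennreal (W / L) * ennpowr (V' / ennreal L) (r - 1) \<le> ennreal K0" by simp
    have "V' < \<infinity>"
    proof (rule ccontr)
      assume "\<not> V' < \<infinity>"
      then have "ennpowr (V' / ennreal L) (r - 1) = \<infinity>"
        by (simp add: ennpowr_def ennreal_top_divide less_top[symmetric])
      then show False using le W L by (simp add: ennreal_mult_top top_unique)
    qed
    then obtain V where V: "V' = ennreal V" "0 < V" using V'pos
      by (auto simp: less_top_ennreal)
    have "W / L * (V / L) powr (r - 1) \<le> K0"
      using le V W L K0(2) by (simp add: divide_ennreal ennpowr_ennreal flip: ennreal_mult)
    then have "W * V powr (r - 1) \<le> K0 * (L * L powr (r - 1))"
      using L V by (simp add: powr_divide field_simps)
    also have "L * L powr (r - 1) = L powr r"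
      using L powr_add[of L 1 "r - 1"] by simp
    also have "K0 * L powr r \<le> (K0 + 1) * L powr r" by (simp add: mult_right_mono)
    finally show ?thesis using W V by (auto simp: L_def W'_def V'_def)
  qed
  then have "\<forall>a l. 0 < l \<longrightarrow> (\<exists>W V. 0 < W \<and> 0 < V \<and>
      (\<integral>\<^sup>+x\<in>cube a l. ennreal (\<gamma> x) \<partial>lebesgue) = ennreal W \<and>
      (\<integral>\<^sup>+x\<in>cube a l. ennreal (inverse (\<gamma> x) powr s) \<partial>lebesgue) = ennreal V \<and>
      W * V powr (r - 1) \<le> (K0 + 1) * (l ^ CARD('n)) powr r)" by blast
  moreover have "0 < K0 + 1" using K0(2) by simp
  ultimately show ?thesis unfolding s_def[symmetric] by blast
qed

lemma muckenhoupt_reverse_bound: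
  fixes \<gamma> :: "real^'n::finite \<Rightarrow> real"
  assumes "\<gamma> \<in> muckenhoupt r" and r: "1 < r" and l: "0 < l"
    and "(\<integral>\<^sup>+x\<in>cube a l. ennreal (\<gamma> x) \<partial>lebesgue) = ennreal W" "0 < W"
    and "(\<integral>\<^sup>+x\<in>cube a l. ennreal (inverse (\<gamma> x) powr (1 / (r - 1))) \<partial>lebesgue) = ennreal V" "0 < V"
  shows "(l ^ CARD('n)) powr r \<le> 2 powr r * W * V powr (r - 1)"
proof -
  have w: "weight \<gamma>" using assms(1) by (auto simp: muckenhoupt_def)
  have "(l ^ CARD('n)) powr (1 + 1 / (1 / (r - 1)))
      \<le> 2 powr (1 + 1 / (1 / (r - 1))) * W * V powr (1 / (1 / (r - 1)))"
    by (rule weak_holder[OF weight_measurable[OF w] cube_lebesgue[of a l] _ _ emeasure_cube[OF l] _ assms(4) _ assms(6)])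
      (use assms(2,3,5,7) w in \<open>auto simp: weight_def\<close>)
  then show ?thesis by simp
qed

text \<open>On the small cube, \<open>weak_holder\<close> bounds its volume by its \<open>\<gamma>\<close>-mass times the dual mass; the dual mass is at most
that of the large cube, which the \<open>A\<^sub>r\<close> condition bounds by the \<open>\<gamma>\<close>-mass of the large cube.\<close>

lemma muckenhoupt_doubling:
  fixes \<gamma> :: "real^'n::finite \<Rightarrow> real" and r :: real
  assumes "\<gamma> \<in> muckenhoupt r" and r: "1 < r"
  shows "\<exists>K>0. \<forall>a b l1 l2. 0 < l1 \<longrightarrow> 0 < l2 \<longrightarrow> cube b l1 \<subseteq> cube a l2 \<longrightarrow>
      (\<integral>\<^sup>+x\<in>cube a l2. ennreal (\<gamma> x) \<partial>lebesgue)
        \<le> ennreal (K * (l2 / l1) powr (CARD('n) * r)) * (\<integral>\<^sup>+x\<in>cube b l1. ennreal (\<gamma> x) \<partial>lebesgue)"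
proof -
  obtain K where K: "K > 0" and bd: "\<And>a l. 0 < l \<Longrightarrow> (\<exists>W V. 0 < W \<and> 0 < V \<and>
      (\<integral>\<^sup>+x\<in>cube a l. ennreal (\<gamma> x) \<partial>lebesgue) = ennreal W \<and>
      (\<integral>\<^sup>+x\<in>cube a l. ennreal (inverse (\<gamma> x) powr (1 / (r - 1))) \<partial>lebesgue) = ennreal V \<and>
      W * V powr (r - 1) \<le> K * (l ^ CARD('n)) powr r)"
    using muckenhoupt_cube_bounds[OF assms] by blast
  have "(\<integral>\<^sup>+x\<in>cube a l2. ennreal (\<gamma> x) \<partial>lebesgue)
        \<le> ennreal (2 powr r * K * (l2 / l1) powr (CARD('n) * r)) * (\<integral>\<^sup>+x\<in>cube b l1. ennreal (\<gamma> x) \<partial>lebesgue)"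
    if l: "0 < l1" "0 < l2" and sub: "cube b l1 \<subseteq> cube a l2" for a b l1 l2
  proof -
    obtain W1 V1 where 1: "0 < W1" "0 < V1"
      "(\<integral>\<^sup>+x\<in>cube b l1. ennreal (\<gamma> x) \<partial>lebesgue) = ennreal W1"
      "(\<integral>\<^sup>+x\<in>cube b l1. ennreal (inverse (\<gamma> x) powr (1 / (r - 1))) \<partial>lebesgue) = ennreal V1"
      using bd[OF l(1), of b] by blast
    obtain W2 V2 where 2: "0 < W2" "0 < V2"
      "(\<integral>\<^sup>+x\<in>cube a l2. ennreal (\<gamma> x) \<partial>lebesgue) = ennreal W2"
      "(\<integral>\<^sup>+x\<in>cube a l2. ennreal (inverse (\<gamma> x) powr (1 / (r - 1))) \<partial>lebesgue) = ennreal V2"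
      "W2 * V2 powr (r - 1) \<le> K * (l2 ^ CARD('n)) powr r"
      using bd[OF l(2), of a] by blast
    have "ennreal V1 \<le> ennreal V2"
      unfolding 1(4)[symmetric] 2(4)[symmetric] using sub
      by (intro nn_integral_mono mult_left_mono) (auto simp: indicator_def)
    then have V: "V1 powr (r - 1) \<le> V2 powr (r - 1)" using 1 2 r by (intro powr_mono2) auto
    define N1 N2 where "N1 = (l1 ^ CARD('n)) powr r" and "N2 = (l2 ^ CARD('n)) powr r"
    have N: "0 < N1" "0 < N2" using l by (auto simp: N1_def N2_def)
    have "N1 \<le> 2 powr r * W1 * V1 powr (r - 1)"
      unfolding N1_def by (rule muckenhoupt_reverse_bound[OF assms l(1) 1(3,1,4,2)])
    also have "\<dots> \<le> 2 powr r * W1 * V2 powr (r - 1)" using V 1 by (intro mult_left_mono) auto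
    finally have "W2 * N1 \<le> W2 * (2 powr r * W1 * V2 powr (r - 1))" using 2 by (intro mult_left_mono) auto
    also have "\<dots> = 2 powr r * W1 * (W2 * V2 powr (r - 1))" by simp
    also have "\<dots> \<le> 2 powr r * W1 * (K * N2)"
      unfolding N2_def using 2 1 by (intro mult_left_mono) auto
    finally have "W2 \<le> 2 powr r * K * (N2 / N1) * W1" using N by (simp add: field_simps)
    also have "N2 / N1 = (l2 / l1) powr (CARD('n) * r)"
    proof -
      have "(l ^ CARD('n)) powr r = l powr (CARD('n) * r)" if "0 < l" for l :: real
        unfolding powr_powr[symmetric] using that by (simp add: powr_realpow)
      then show ?thesis using l by (simp add: N1_def N2_def powr_divide)
    qed
    finally show ?thesis using 1 2 K l by (simp flip: ennreal_mult)
  qed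
  moreover have "0 < 2 powr r * K" using K by simp
  ultimately show ?thesis by blast
qed

section \<open>Dyadic cubes\<close>

text \<open>Index of the cube of side \<open>2\<^bsup>-v\<^esup>\<close> that contains \<open>x\<close>. The cubes of one generation are the level sets of this map,
which makes them visibly disjoint; sides at most 1 suffice to exhaust open sets.\<close>

definition dyadic_index :: "nat \<Rightarrow> real^'n::finite \<Rightarrow> 'n \<Rightarrow> int" where
  "dyadic_index v x = (\<lambda>i. \<lfloor>2 ^ v * x $ i\<rfloor>)"

definition half_open_cube :: "real^'n::finite \<Rightarrow> real \<Rightarrow> (real^'n) set" where
  "half_open_cube a l = {x. \<forall>i. a $ i \<le> x $ i \<and> x $ i < a $ i + l}"

lemma dyadic_cubeE:
  assumes "Q \<in> dyadic_cubes"
  obtains a v where "Q = half_open_cube a (2 powi (- v))"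
proof -
  obtain v m where Q: "Q = (\<lambda>x. (2 powi (- v)) *\<^sub>R (x + (\<chi> i. of_int (m i)))) ` {x::real^'a. \<forall>i. x $ i \<in> {0..<1}}"
    using assms by (auto simp: dyadic_cubes_def)
  define l where "l = (2::real) powi (- v)"
  have l: "0 < l" by (simp add: l_def)
  define a :: "real^'a" where "a = (\<chi> i. l * of_int (m i))"
  have "Q = half_open_cube a l"
  proof (intro set_eqI iffI)
    fix y assume "y \<in> Q"
    then obtain x where x: "\<And>i. 0 \<le> x $ i" "\<And>i. x $ i < 1" "y = l *\<^sub>R (x + (\<chi> i. of_int (m i)))"
      by (auto simp: Q l_def)
    then show "y \<in> half_open_cube a l" using l
      by (auto simp: half_open_cube_def a_def algebra_simps)
  next
    fix y assume "y \<in> half_open_cube a l"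
    then have y: "\<And>i. l * of_int (m i) \<le> y $ i" "\<And>i. y $ i < l * of_int (m i) + l"
      by (auto simp: half_open_cube_def a_def)
    define x :: "real^'a" where "x = (\<chi> i. y $ i / l - of_int (m i))"
    have "y = l *\<^sub>R (x + (\<chi> i. of_int (m i)))" using l by (simp add: x_def vec_eq_iff)
    moreover have "0 \<le> x $ i" "x $ i < 1" for i using y[of i] l by (auto simp: x_def field_simps)
    ultimately show "y \<in> Q" unfolding Q l_def[symmetric] by auto
  qed
  then show thesis using that by (simp add: l_def)
qed

lemma dyadic_index_cube: "{x. dyadic_index v x = m} \<in> dyadic_cubes"
proof -
  define l where "l = (2::real) powi (- int v)"
  have l: "l * 2 ^ v = 1" by (simp add: l_def power_int_minus)
  have "{x. dyadic_index v x = m} = (\<lambda>x. l *\<^sub>R (x + (\<chi> i. of_int (m i)))) ` {x::real^'a. \<forall>i. x $ i \<in> {0..<1}}"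
  proof (intro set_eqI iffI)
    fix y :: "real^'a" assume "y \<in> {x. dyadic_index v x = m}"
    then have y: "\<And>i. of_int (m i) \<le> 2 ^ v * y $ i" "\<And>i. 2 ^ v * y $ i < of_int (m i) + 1"
      by (auto simp: dyadic_index_def)
    define x :: "real^'a" where "x = (\<chi> i. 2 ^ v * y $ i - of_int (m i))"
    have "y = l *\<^sub>R (x + (\<chi> i. of_int (m i)))" using l by (simp add: x_def vec_eq_iff mult.assoc[symmetric])
    moreover have "0 \<le> x $ i" "x $ i < 1" for i using y(1,2)[of i] by (auto simp: x_def)
    ultimately show "y \<in> (\<lambda>x. l *\<^sub>R (x + (\<chi> i. of_int (m i)))) ` {x::real^'a. \<forall>i. x $ i \<in> {0..<1}}" by auto
  next
    fix y assume "y \<in> (\<lambda>x. l *\<^sub>R (x + (\<chi> i. of_int (m i)))) ` {x::real^'a. \<forall>i. x $ i \<in> {0..<1}}"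
    then obtain x where x: "\<And>i. 0 \<le> x $ i" "\<And>i. x $ i < 1" "y = l *\<^sub>R (x + (\<chi> i. of_int (m i)))"
      by auto
    have "2 ^ v * y $ i = x $ i + of_int (m i)" for i
      using l by (simp add: x(3) mult.assoc[symmetric] mult.commute[of _ l])
    then show "y \<in> {x. dyadic_index v x = m}"
      using x(1,2) by (auto simp: dyadic_index_def fun_eq_iff floor_eq_iff)
  qed
  then show ?thesis unfolding dyadic_cubes_def l_def by blast
qed

lemma half_open_cube_AE: "AE x in lebesgue. x \<in> half_open_cube a l \<longleftrightarrow> x \<in> cube a l"
proof -
  have "negligible (cbox a (a + (\<chi> i. l)) - box a (a + (\<chi> i. l)))" by (rule negligible_frontier_interval)
  then have "AE x in lebesgue. x \<notin> cbox a (a + (\<chi> i. l)) - box a (a + (\<chi> i. l))"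
    by (intro AE_not_in) (simp only: negligible_iff_null_sets)
  then show ?thesis
  proof eventually_elim
    case (elim x)
    then show ?case
      by (auto simp: half_open_cube_def cube_def mem_box_cart) (meson less_imp_le not_le)+
  qed
qed

lemma half_open_cube_lebesgue [measurable]: "half_open_cube a l \<in> sets lebesgue"
proof -
  have "half_open_cube a l = cube a l - (cube a l - half_open_cube a l)"
    by (auto simp: half_open_cube_def mem_cube less_imp_le)
  moreover have "cube a l - half_open_cube a l \<in> sets lebesgue"
  proof (rule negligible_imp_sets, rule negligible_subset)
    show "cube a l - half_open_cube a l \<subseteq> cbox a (a + (\<chi> i. l)) - box a (a + (\<chi> i. l))"
      by (auto simp: half_open_cube_def cube_def mem_box_cart less_imp_le)
  qed (rule negligible_frontier_interval)
  ultimately show ?thesis by (metis cube_lebesgue sets.Diff)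
qed

lemma dyadic_lebesgue: "Q \<in> dyadic_cubes \<Longrightarrow> Q \<in> sets lebesgue"
  by (metis dyadic_cubeE half_open_cube_lebesgue)

lemma nn_integral_half_open_cube:
  "(\<integral>\<^sup>+x\<in>half_open_cube a l. f x \<partial>lebesgue) = (\<integral>\<^sup>+x\<in>cube a l. f x \<partial>lebesgue)"
  by (rule nn_integral_cong_AE) (use half_open_cube_AE in eventually_elim, auto simp: indicator_def)

lemma emeasure_half_open_cube: "emeasure lebesgue (half_open_cube a l) = emeasure lebesgue (cube a l)"
  by (rule emeasure_eq_AE[OF half_open_cube_AE]) auto

section \<open>Comparing densities on dyadic cubes\<close>

text \<open>Let \<open>V v\<close> be the union of all cubes of generation \<open>v\<close> that lie in \<open>U\<close>. The sets \<open>V v\<close> increase to \<open>U\<close>, and on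
each of them the comparison holds by countable additivity.\<close>

lemma dyadic_comparison_open:
  fixes w1 w2 :: "real^'n::finite \<Rightarrow> ennreal"
  assumes [measurable]: "w1 \<in> borel_measurable lebesgue" "w2 \<in> borel_measurable lebesgue"
    and le: "\<And>Q. Q \<in> dyadic_cubes \<Longrightarrow> (\<integral>\<^sup>+x\<in>Q. w1 x \<partial>lebesgue) \<le> C * (\<integral>\<^sup>+x\<in>Q. w2 x \<partial>lebesgue)"
    and "open U"
  shows "(\<integral>\<^sup>+x\<in>U. w1 x \<partial>lebesgue) \<le> C * (\<integral>\<^sup>+x\<in>U. w2 x \<partial>lebesgue)"
proof -
  define Q where "Q v m = {x::real^'n. dyadic_index v x = m}" for v m
  have Qs: "Q v m \<in> sets lebesgue" for v m
    unfolding Q_def by (rule dyadic_lebesgue[OF dyadic_index_cube])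
  define S where "S v = {m. Q v m \<subseteq> U}" for v
  define V where "V v = (\<Union>m\<in>S v. Q v m)" for v
  have Vs: "V v \<in> sets lebesgue" for v
    unfolding V_def using Qs by (intro sets.countable_UN'' ) auto
  have dens: "emeasure (density lebesgue w) (V v) = (\<integral>\<^sup>+m. emeasure (density lebesgue w) (Q v m) \<partial>count_space (S v))"
    for v w
    unfolding V_def
    by (rule emeasure_UN_countable) (use Qs in \<open>auto simp: disjoint_family_on_def Q_def\<close>)
  have Vle: "emeasure (density lebesgue w1) (V v) \<le> C * emeasure (density lebesgue w2) (V v)" for v
  proof -
    have "emeasure (density lebesgue w1) (V v) \<le> (\<integral>\<^sup>+m. C * emeasure (density lebesgue w2) (Q v m) \<partial>count_space (S v))"
      unfolding dens
    proof (rule nn_integral_mono)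
      fix m
      have "(\<integral>\<^sup>+x\<in>Q v m. w1 x \<partial>lebesgue) \<le> C * (\<integral>\<^sup>+x\<in>Q v m. w2 x \<partial>lebesgue)"
        using le[OF dyadic_index_cube] by (simp add: Q_def)
      then show "emeasure (density lebesgue w1) (Q v m) \<le> C * emeasure (density lebesgue w2) (Q v m)"
        using Qs by (simp add: emeasure_density)
    qed
    then show ?thesis unfolding dens by (simp add: nn_integral_cmult)
  qed
  have inc: "incseq V"
  proof (rule incseq_SucI)
    fix v
    \<comment> \<open>Every cube of generation \<open>v + 1\<close> lies in one of generation \<open>v\<close>, so the \<open>V v\<close> increase.\<close>
    have nest: "dyadic_index v x = (\<lambda>i. dyadic_index (Suc v) x i div 2)" for x :: "real^'n"
      using floor_divide_real_eq_div[of 2 "2 ^ Suc v * x $ i" for i]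
      by (auto simp: dyadic_index_def fun_eq_iff)
    show "V v \<subseteq> V (Suc v)"
    proof
      fix x assume "x \<in> V v"
      then have "Q v (dyadic_index v x) \<subseteq> U" by (auto simp: V_def S_def Q_def)
      moreover have "Q (Suc v) (dyadic_index (Suc v) x) \<subseteq> Q v (dyadic_index v x)"
        by (auto simp: Q_def nest)
      ultimately show "x \<in> V (Suc v)" by (auto simp: V_def S_def Q_def)
    qed
  qed
  have UV: "(\<Union>v. V v) = U"
  proof (intro set_eqI iffI)
    fix x assume "x \<in> U"
    then obtain e where e: "0 < e" "ball x e \<subseteq> U" using \<open>open U\<close> open_contains_ball by blast
    obtain v :: nat where v: "CARD('n) / e < 2 ^ v" using real_arch_pow[of 2] by auto
    have "Q v (dyadic_index v x) \<subseteq> U"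
    proof
      fix y assume "y \<in> Q v (dyadic_index v x)"
      then have fl: "\<lfloor>2 ^ v * y $ i\<rfloor> = \<lfloor>2 ^ v * x $ i\<rfloor>" for i by (auto simp: Q_def dyadic_index_def fun_eq_iff)
      have "\<bar>2 ^ v * y $ i - 2 ^ v * x $ i\<bar> < 1" for i
        using fl[of i] floor_correct[of "2 ^ v * y $ i"] floor_correct[of "2 ^ v * x $ i"]
        by (simp add: abs_less_iff) linarith
      then have "\<bar>2 ^ v * (y $ i - x $ i)\<bar> < 1" for i unfolding right_diff_distrib by blast
      then have "\<bar>y $ i - x $ i\<bar> < 1 / 2 ^ v" for i
        by (simp only: abs_mult) (simp add: pos_less_divide_eq mult.commute)
      then have "(\<Sum>i\<in>UNIV. \<bar>(y - x) $ i\<bar>) \<le> (\<Sum>i\<in>(UNIV::'n set). 1 / 2 ^ v)"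
        by (intro sum_mono) (simp add: less_imp_le)
      then have "norm (y - x) \<le> CARD('n) / 2 ^ v" using norm_le_l1_cart[of "y - x"] by simp
      also have "\<dots> < e" using v e(1) by (simp add: field_simps)
      finally show "y \<in> U" using e(2) by (auto simp: dist_norm norm_minus_commute)
    qed
    then show "x \<in> (\<Union>v. V v)" by (auto simp: V_def S_def Q_def)
  qed (auto simp: V_def S_def)
  have "emeasure (density lebesgue w) U = (SUP v. emeasure (density lebesgue w) (V v))" for w
    unfolding UV[symmetric] using Vs inc by (intro SUP_emeasure_incseq[symmetric]) auto
  then have "emeasure (density lebesgue w1) U \<le> C * emeasure (density lebesgue w2) U"
    using Vle by (simp add: SUP_mult_left_ennreal) (intro SUP_mono, auto)
  then show ?thesis using \<open>open U\<close> by (simp add: emeasure_density)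
qed

text \<open>Outer regularity carries the comparison from open sets to bounded measurable sets \<open>S\<close>: integrals over decreasing
open neighbourhoods converge, as they are finite. Applied to the part of a ball where \<open>C w2 < w1\<close>, it shows
that this part is null.\<close>

lemma dyadic_comparison_AE:
  fixes w1 w2 :: "real^'n::finite \<Rightarrow> ennreal"
  assumes [measurable]: "w1 \<in> borel_measurable lebesgue" "w2 \<in> borel_measurable lebesgue"
    and le: "\<And>Q. Q \<in> dyadic_cubes \<Longrightarrow> (\<integral>\<^sup>+x\<in>Q. w1 x \<partial>lebesgue) \<le> C * (\<integral>\<^sup>+x\<in>Q. w2 x \<partial>lebesgue)"
    and C: "C < \<infinity>"
    and fin: "\<And>R. (\<integral>\<^sup>+x\<in>ball 0 R. w1 x \<partial>lebesgue) < \<infinity>" "\<And>R. (\<integral>\<^sup>+x\<in>ball 0 R. w2 x \<partial>lebesgue) < \<infinity>"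
  shows "AE x in lebesgue. w1 x \<le> C * w2 x"
proof -
  have bounded: "(\<integral>\<^sup>+x\<in>S. w1 x \<partial>lebesgue) \<le> C * (\<integral>\<^sup>+x\<in>S. w2 x \<partial>lebesgue)"
    if S: "S \<in> sets lebesgue" "S \<subseteq> ball 0 R" for S R
  proof -
    have "\<exists>T. open T \<and> S \<subseteq> T \<and> emeasure lebesgue (T - S) < ennreal (1 / Suc k)" for k
      using sets_lebesgue_outer_open[OF S(1), of "1 / Suc k"] by (metis divide_pos_pos of_nat_0_less_iff zero_less_Suc zero_less_one)
    then obtain T where T: "\<And>k. open (T k)" "\<And>k. S \<subseteq> T k"
      "\<And>k. emeasure lebesgue (T k - S) < ennreal (1 / Suc k)" by metis
    define G where "G k = (\<Inter>j\<le>k. T j) \<inter> ball 0 R" for k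
    have Go: "open (G k)" for k unfolding G_def using T(1) by auto
    then have Gs: "G k \<in> sets lebesgue" for k by auto
    have GS: "S \<subseteq> G k" for k using T(2) S(2) by (auto simp: G_def)
    have dec: "decseq G" unfolding G_def decseq_def by fastforce
    have null: "(\<Inter>k. G k) - S \<in> null_sets lebesgue"
    proof -
      have ms: "(\<Inter>k. G k) - S \<in> sets lebesgue" using Gs S(1) by blast
      have "emeasure lebesgue ((\<Inter>k. G k) - S) \<le> ennreal (1 / Suc k)" for k
      proof -
        have "emeasure lebesgue ((\<Inter>k. G k) - S) \<le> emeasure lebesgue (T k - S)"
          using T(1) S(1) by (intro emeasure_mono) (auto simp: G_def)
        then show ?thesis using T(3)[of k] by simp
      qed
      then have "emeasure lebesgue ((\<Inter>k. G k) - S) \<le> ennreal 0"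
        by (intro LIMSEQ_le_const[OF tendsto_ennrealI[OF lim_inverse_n'[THEN LIMSEQ_Suc]]]) (auto simp: inverse_eq_divide)
      then show ?thesis using ms by (simp add: null_sets_def)
    qed
    have eqS: "emeasure (density lebesgue w2) (\<Inter>k. G k) = emeasure (density lebesgue w2) S"
    proof -
      have "AE x in lebesgue. x \<notin> (\<Inter>k. G k) - S" using null by (rule AE_not_in)
      then have "(\<integral>\<^sup>+x\<in>(\<Inter>k. G k). w2 x \<partial>lebesgue) = (\<integral>\<^sup>+x\<in>S. w2 x \<partial>lebesgue)"
      proof (intro nn_integral_cong_AE, eventually_elim)
        case (elim x)
        then show ?case using GS by (auto simp: indicator_def)
      qed
      then show ?thesis using Gs S(1) by (simp add: emeasure_density)
    qed
    have "emeasure (density lebesgue w2) (G 0) \<noteq> \<infinity>"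
    proof -
      have "emeasure (density lebesgue w2) (G 0) \<le> emeasure (density lebesgue w2) (ball 0 R)"
        by (intro emeasure_mono) (auto simp: G_def)
      also have "\<dots> < \<infinity>" using fin(2) by (simp add: emeasure_density)
      finally show ?thesis by simp
    qed
    then have INF: "(INF k. emeasure (density lebesgue w2) (G k)) = emeasure (density lebesgue w2) S"
      unfolding eqS[symmetric] using Gs dec
      by (intro INF_emeasure_decseq') (simp, assumption, blast)
    have "emeasure (density lebesgue w1) S \<le> C * emeasure (density lebesgue w2) (G k)" for k
    proof -
      have "emeasure (density lebesgue w1) S \<le> emeasure (density lebesgue w1) (G k)"
        using GS Gs by (intro emeasure_mono) auto
      also have "\<dots> \<le> C * emeasure (density lebesgue w2) (G k)"
        using dyadic_comparison_open[OF assms(1,2) le Go] Gs by (simp add: emeasure_density)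
      finally show ?thesis .
    qed
    moreover
    have "(\<lambda>k. emeasure (density lebesgue w2) (G k)) \<longlonglongrightarrow> emeasure (density lebesgue w2) S"
    proof -
      have "decseq (\<lambda>k. emeasure (density lebesgue w2) (G k))"
        using dec Gs by (auto simp: decseq_def intro!: emeasure_mono)
      then show ?thesis using LIMSEQ_INF INF by metis
    qed
    then have "(\<lambda>k. C * emeasure (density lebesgue w2) (G k)) \<longlonglongrightarrow> C * emeasure (density lebesgue w2) S"
      using C by (intro ennreal_tendsto_cmult) auto
    ultimately have "emeasure (density lebesgue w1) S \<le> C * emeasure (density lebesgue w2) S"
      by (intro LIMSEQ_le_const) blast+
    then show ?thesis using S(1) by (simp add: emeasure_density)
  qed
  have "AE x in lebesgue. x \<in> ball 0 (real R) \<longrightarrow> w1 x \<le> C * w2 x" for R :: nat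
  proof -
    define S where "S = {x \<in> space lebesgue. C * w2 x < w1 x} \<inter> ball 0 (real R)"
    have S[measurable]: "S \<in> sets lebesgue" unfolding S_def by (intro sets.Int) (measurable, auto)
    have "(\<integral>\<^sup>+x. (w1 x - C * w2 x) * indicator S x \<partial>lebesgue)
        = (\<integral>\<^sup>+x. w1 x * indicator S x - C * w2 x * indicator S x \<partial>lebesgue)"
      by (intro nn_integral_cong) (auto simp: indicator_def)
    also have "\<dots> = (\<integral>\<^sup>+x\<in>S. w1 x \<partial>lebesgue) - (\<integral>\<^sup>+x. C * w2 x * indicator S x \<partial>lebesgue)"
    proof (rule nn_integral_diff)
      have "(\<integral>\<^sup>+x. C * w2 x * indicator S x \<partial>lebesgue) \<le> (\<integral>\<^sup>+x\<in>ball 0 (real R). w1 x \<partial>lebesgue)"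
        by (intro nn_integral_mono) (auto simp: S_def indicator_def)
      then show "(\<integral>\<^sup>+x. C * w2 x * indicator S x \<partial>lebesgue) \<noteq> \<infinity>" using fin(1)[of "real R"] by auto
      show "AE x in lebesgue. C * w2 x * indicator S x \<le> w1 x * indicator S x"
        by (auto simp: S_def indicator_def)
    qed (measurable)
    also have "(\<integral>\<^sup>+x. C * w2 x * indicator S x \<partial>lebesgue) = C * (\<integral>\<^sup>+x\<in>S. w2 x \<partial>lebesgue)"
      unfolding mult.assoc by (rule nn_integral_cmult) measurable
    also have "(\<integral>\<^sup>+x\<in>S. w1 x \<partial>lebesgue) - \<dots> = 0"
    proof (rule diff_eq_0_ennreal)
      have "(\<integral>\<^sup>+x\<in>S. w1 x \<partial>lebesgue) \<le> (\<integral>\<^sup>+x\<in>ball 0 (real R). w1 x \<partial>lebesgue)"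
        by (intro nn_integral_mono) (auto simp: S_def indicator_def)
      then show "(\<integral>\<^sup>+x\<in>S. w1 x \<partial>lebesgue) < top" using fin(1)[of "real R"] by simp
      show "(\<integral>\<^sup>+x\<in>S. w1 x \<partial>lebesgue) \<le> C * (\<integral>\<^sup>+x\<in>S. w2 x \<partial>lebesgue)"
        by (rule bounded[OF S, of "real R"]) (auto simp: S_def)
    qed
    finally have "AE x in lebesgue. (w1 x - C * w2 x) * indicator S x = 0"
      by (subst (asm) nn_integral_0_iff_AE) auto
    then show ?thesis
      by eventually_elim (auto simp: S_def indicator_def diff_eq_0_iff_ennreal split: if_splits)
  qed
  then have "AE x in lebesgue. \<forall>R::nat. x \<in> ball 0 (real R) \<longrightarrow> w1 x \<le> C * w2 x"
    unfolding AE_all_countable by blast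
  then show ?thesis
  proof eventually_elim
    case (elim x)
    obtain R :: nat where "norm x < real R" using reals_Archimedean2 by blast
    then show ?case using elim by auto
  qed
qed

section \<open>Tails against doubling densities\<close>

text \<open>If the mass of the concentric cubes of side \<open>2\<^bsup>k+1\<^esup> l\<close> grows at most like \<open>2\<^bsup>d k\<^esup>\<close>, a decay of order
\<open>s \<ge> d + 1\<close> leaves a geometric series with ratio at most \<open>1/2\<close>. With the constant density it yields the
integrability of \<open>(1 + |x|)\<^bsup>-n-1\<^esup>\<close>, and with an \<open>A\<^sub>r\<close> weight the upper bound for test functionals.\<close>

lemma nn_integral_tail_le:
  fixes w :: "real^'n::finite \<Rightarrow> ennreal" and d s l K :: real
  assumes [measurable]: "w \<in> borel_measurable lebesgue" and l: "0 < l" and K: "0 \<le> K" and s: "0 \<le> d" "d + 1 \<le> s"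
    and db: "\<And>k::nat. (\<integral>\<^sup>+x\<in>cube (z - (\<chi> i. l * 2 ^ k)) (2 * (l * 2 ^ k)). w x \<partial>lebesgue)
      \<le> ennreal (K * 2 powr (d * k)) * W0"
  shows "(\<integral>\<^sup>+x. w x * ennreal ((1 + norm (x - z) / l) powr (-s)) \<partial>lebesgue) \<le> ennreal (2 powr (s + 1) * K) * W0"
proof -
  define Q where "Q k = cube (z - (\<chi> i. l * 2 ^ k)) (2 * (l * 2 ^ k))" for k :: nat
  have [measurable]: "Q k \<in> sets lebesgue" for k by (simp add: Q_def)
  define c where "c k = 2 powr s * 2 powr (- s * real k)" for k :: nat
  have pt: "ennreal ((1 + norm (x - z) / l) powr (-s)) \<le> (\<Sum>k. ennreal (c k) * indicator (Q k) x)" for x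
  proof -
    define y where "y = norm (x - z) / l"
    have y: "0 \<le> y" using l by (simp add: y_def)
    obtain k0 :: nat where "y < 2 ^ k0" using real_arch_pow[of 2] by auto
    \<comment> \<open>For this \<open>k\<close> the single term \<open>c k\<close> of the series already dominates the function at \<open>x\<close>.\<close>
    define k where "k = (LEAST k::nat. y \<le> 2 ^ k)"
    have k: "y \<le> 2 ^ k" unfolding k_def by (rule LeastI[of _ k0]) (use \<open>y < 2 ^ k0\<close> in simp)
    have "(1 + y) powr (-s) \<le> c k"
    proof (cases "k = 0")
      case True
      have "(1 + y) powr (-s) \<le> 2 powr s"
      proof -
        have "(1 + y) powr (-s) \<le> 1" "1 \<le> 2 powr s" using y s
          by (auto simp: powr_minus inverse_le_1_iff ge_one_powr_ge_zero)
        then show ?thesis by linarith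
      qed
      then show ?thesis using True by (simp add: c_def)
    next
      case False
      then have "\<not> y \<le> 2 ^ (k - 1)" unfolding k_def using not_less_Least by (metis diff_less less_one neq0_conv)
      then have "2 ^ (k - 1) \<le> 1 + y" by simp
      have "(1 + y) powr (-s) \<le> (2 ^ (k - 1)) powr (-s)"
        using \<open>2 ^ (k - 1) \<le> 1 + y\<close> s by (intro powr_mono2') auto
      also have "\<dots> = c k"
      proof -
        have "(2 ^ (k - 1)) powr (-s) = (2::real) powr ((real k - 1) * (-s))"
          using False by (simp add: powr_powr of_nat_diff flip: powr_realpow)
        also have "(real k - 1) * (-s) = s + (- s * real k)" by (simp add: algebra_simps)
        finally show ?thesis by (simp only: c_def powr_add)
      qed
      finally show ?thesis .
    qed
    moreover have "x \<in> Q k"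
    proof -
      have "\<bar>(x - z) $ i\<bar> \<le> l * 2 ^ k" for i
        using component_le_norm_cart[of "x - z" i] k l by (simp add: y_def field_simps)
      then show ?thesis by (auto simp: Q_def mem_cube abs_le_iff algebra_simps)
    qed
    ultimately have "ennreal ((1 + y) powr (-s)) \<le> (\<Sum>j\<in>{k}. ennreal (c j) * indicator (Q j) x)"
      by (simp add: ennreal_leI)
    also have "\<dots> \<le> (\<Sum>k. ennreal (c k) * indicator (Q k) x)" by (rule sum_le_suminf) auto
    finally show ?thesis by (simp add: y_def)
  qed
  have "(\<integral>\<^sup>+x. w x * ennreal ((1 + norm (x - z) / l) powr (-s)) \<partial>lebesgue)
      \<le> (\<integral>\<^sup>+x. (\<Sum>k. ennreal (c k) * (w x * indicator (Q k) x)) \<partial>lebesgue)"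
  proof (rule nn_integral_mono)
    fix x
    have "w x * ennreal ((1 + norm (x - z) / l) powr (-s)) \<le> w x * (\<Sum>k. ennreal (c k) * indicator (Q k) x)"
      by (rule mult_left_mono[OF pt]) simp
    then show "w x * ennreal ((1 + norm (x - z) / l) powr (-s)) \<le> (\<Sum>k. ennreal (c k) * (w x * indicator (Q k) x))"
      unfolding ennreal_suminf_cmult[symmetric] by (simp only: mult.left_commute)
  qed
  also have "\<dots> = (\<Sum>k. ennreal (c k) * (\<integral>\<^sup>+x\<in>Q k. w x \<partial>lebesgue))"
    by (subst nn_integral_suminf) (auto simp: nn_integral_cmult)
  also have "\<dots> \<le> (\<Sum>k. ennreal (2 powr s * K * (1/2) ^ k) * W0)"
  proof (intro suminf_le summableI)
    fix k
    have "ennreal (c k) * (\<integral>\<^sup>+x\<in>Q k. w x \<partial>lebesgue) \<le> ennreal (c k) * (ennreal (K * 2 powr (d * k)) * W0)"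
      using db[of k] by (intro mult_left_mono) (auto simp: Q_def)
    also have "\<dots> = ennreal (c k * (K * 2 powr (d * k))) * W0"
      using K by (simp add: c_def ennreal_mult mult.assoc)
    also have "\<dots> \<le> ennreal (2 powr s * K * (1/2) ^ k) * W0"
    proof (intro mult_right_mono ennreal_leI)
      have "2 powr (- s * real k) * 2 powr (d * k) \<le> 2 powr (- real k)"
        using mult_right_mono[OF s(2), of "real k"] by (simp add: powr_add[symmetric] algebra_simps)
      also have "\<dots> = (1/2) ^ k" by (simp add: powr_minus powr_realpow power_one_over inverse_eq_divide)
      finally have "2 powr s * K * (2 powr (- s * real k) * 2 powr (d * k)) \<le> 2 powr s * K * (1/2) ^ k"
        using K by (intro mult_left_mono) auto
      then show "c k * (K * 2 powr (d * k)) \<le> 2 powr s * K * (1/2) ^ k" by (simp add: c_def algebra_simps)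
    qed simp
    finally show "ennreal (c k) * (\<integral>\<^sup>+x\<in>Q k. w x \<partial>lebesgue) \<le> ennreal (2 powr s * K * (1/2) ^ k) * W0" .
  qed
  also have "\<dots> = (\<Sum>k. ennreal (2 powr s * K * (1/2) ^ k)) * W0" by simp
  also have "(\<Sum>k. ennreal (2 powr s * K * (1/2) ^ k)) = ennreal (2 powr s * K * 2)"
    using K geometric_sums[of "1/2::real"] by (intro suminf_ennreal_eq sums_mult) auto
  also have "2 powr s * K * 2 = 2 powr (s + 1) * K" by (simp add: powr_add)
  finally show ?thesis .
qed

section \<open>Means of a weight and of its inverse\<close>

lemma cube_mean_half_open_cube:
  fixes a :: "real^'n::finite"
  assumes l: "0 < l" and s: "0 < s"
    and I: "(\<integral>\<^sup>+x\<in>cube a l. ennreal (\<bar>f x\<bar> powr s) \<partial>lebesgue) = ennreal I" "0 \<le> I"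
  shows "cube_mean (half_open_cube a l) s f = ennreal ((I / l ^ CARD('n)) powr (1 / s))"
  unfolding cube_mean_def nn_integral_half_open_cube emeasure_half_open_cube emeasure_cube[OF l] I(1)
  using I l by (simp add: divide_ennreal ennpowr_ennreal)

text \<open>The \<open>p\<close>-th power of the product is the quantity in the definition of \<open>A\<^sub>r\<close> for \<open>r = p/\<theta>\<close>, because \<open>\<sigma> = p/(r - 1)\<close>
and hence \<open>(t\<^sup>p)\<^bsup>-1/(r-1)\<^esup> = t\<^bsup>-\<sigma>\<^esup>\<close>.\<close>

lemma cube_means_product:
  fixes t :: "real^'n::finite \<Rightarrow> real"
  assumes \<theta>: "0 < \<theta>" "\<theta> < p" and \<sigma>: "\<sigma> = \<theta> * conj_exp (p / \<theta>)"
    and t: "weight t" and A: "(\<lambda>x. t x powr p) \<in> muckenhoupt (p / \<theta>)"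
  shows "\<exists>c>0. \<exists>C>0. \<forall>Q\<in>dyadic_cubes. \<exists>m>0. \<exists>u>0.
      cube_mean Q p t = ennreal m \<and> cube_mean Q \<sigma> (\<lambda>x. inverse (t x)) = ennreal u \<and> c \<le> m * u \<and> m * u \<le> C"
proof -
  define r where "r = p / \<theta>"
  have r: "1 < r" using \<theta> by (simp add: r_def)
  have p: "0 < p" using \<theta> by simp
  have \<sigma>r: "\<sigma> = p / (r - 1)" "0 < \<sigma>" using \<theta> r p
    by (auto simp: \<sigma> conj_exp_def r_def[symmetric]) (simp_all add: r_def)
  have nn: "0 \<le> t x" for x using t by (auto simp: weight_def)
  have inv: "inverse (t x powr p) powr (1 / (r - 1)) = inverse (t x) powr \<sigma>" for x
    by (simp add: \<sigma>r(1) inverse_powr[symmetric] nn powr_powr)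
  obtain K where K: "K > 0" and bd: "\<And>a l. 0 < l \<Longrightarrow> (\<exists>W V. 0 < W \<and> 0 < V \<and>
      (\<integral>\<^sup>+x\<in>cube a l. ennreal (t x powr p) \<partial>lebesgue) = ennreal W \<and>
      (\<integral>\<^sup>+x\<in>cube a l. ennreal (inverse (t x powr p) powr (1 / (r - 1))) \<partial>lebesgue) = ennreal V \<and>
      W * V powr (r - 1) \<le> K * (l ^ CARD('n)) powr r)"
    using muckenhoupt_cube_bounds[OF A r[unfolded r_def]] unfolding r_def by blast
  have "\<exists>m>0. \<exists>u>0. cube_mean Q p t = ennreal m \<and> cube_mean Q \<sigma> (\<lambda>x. inverse (t x)) = ennreal u \<and>
      (2 powr (- r)) powr (1 / p) \<le> m * u \<and> m * u \<le> K powr (1 / p)" if Q: "Q \<in> dyadic_cubes" for Q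
  proof -
    obtain a v where Qa: "Q = half_open_cube a (2 powi (- v))" using Q by (rule dyadic_cubeE)
    define l where "l = (2::real) powi (- v)"
    have l: "0 < l" by (simp add: l_def)
    define L where "L = l ^ CARD('n)"
    have L: "0 < L" using l by (simp add: L_def)
    obtain W V where W: "0 < W" "0 < V"
      "(\<integral>\<^sup>+x\<in>cube a l. ennreal (t x powr p) \<partial>lebesgue) = ennreal W"
      "(\<integral>\<^sup>+x\<in>cube a l. ennreal (inverse (t x powr p) powr (1 / (r - 1))) \<partial>lebesgue) = ennreal V"
      "W * V powr (r - 1) \<le> K * L powr r"
      using bd[OF l, of a] unfolding L_def by blast
    have low: "L powr r \<le> 2 powr r * W * V powr (r - 1)"
      unfolding L_def using muckenhoupt_reverse_bound[OF A r[unfolded r_def] l W(3,1) _ W(2)] W(4) unfolding r_def by blast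
    define m where "m = (W / L) powr (1 / p)"
    define u where "u = (V / L) powr (1 / \<sigma>)"
    have m: "cube_mean Q p t = ennreal m"
      unfolding m_def L_def Qa l_def[symmetric] using W nn by (intro cube_mean_half_open_cube l p) auto
    have u: "cube_mean Q \<sigma> (\<lambda>x. inverse (t x)) = ennreal u"
      unfolding u_def L_def Qa l_def[symmetric] using W nn by (intro cube_mean_half_open_cube l \<sigma>r) (auto simp: inv)
    have pos: "0 < m" "0 < u" using W L by (auto simp: m_def u_def)
    have LL: "L * L powr (r - 1) = L powr r" using L powr_add[of L 1 "r - 1"] by simp
    have mu: "m * u = (W * V powr (r - 1) / L powr r) powr (1 / p)"
    proof -
      have "u = ((V / L) powr (r - 1)) powr (1 / p)"
        using r p by (simp add: u_def powr_powr \<sigma>r(1))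
      then have "m * u = ((W / L) * (V / L) powr (r - 1)) powr (1 / p)"
        using W L by (simp only: m_def) (simp add: powr_mult[symmetric])
      also have "(W / L) * (V / L) powr (r - 1) = W * V powr (r - 1) / L powr r"
        using W L by (simp add: powr_divide LL[symmetric])
      finally show ?thesis .
    qed
    have Lr: "0 < L powr r" using L by simp
    have "2 powr (- r) \<le> W * V powr (r - 1) / L powr r"
      using low Lr by (simp add: powr_minus field_simps)
    then have 1: "(2 powr (- r)) powr (1 / p) \<le> m * u"
      unfolding mu using p by (intro powr_mono2) auto
    have "W * V powr (r - 1) / L powr r \<le> K" using W(5) Lr by (simp add: field_simps)
    then have 2: "m * u \<le> K powr (1 / p)"
      unfolding mu using p W Lr by (intro powr_mono2) auto
    show ?thesis using m u pos 1 2 by blast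
  qed
  moreover have "0 < (2 powr (- r)) powr (1 / p)" "0 < K powr (1 / p)" using K by auto
  ultimately show ?thesis by blast
qed

text \<open>By \<open>cube_means_product\<close> the \<open>\<sigma>\<close>-mean of \<open>1/t\<close> is comparable to the reciprocal of the \<open>p\<close>-mean of \<open>t\<close>.\<close>

lemma dyadic_equiv_sigma_of_dyadic_equiv_p:
  fixes t\<^sub>1 t\<^sub>2 :: "real^'n::finite \<Rightarrow> real"
  assumes \<theta>: "0 < \<theta>" "\<theta> < p" and \<sigma>: "\<sigma> = \<theta> * conj_exp (p / \<theta>)"
    and t: "weight t\<^sub>1" "weight t\<^sub>2"
    and A: "(\<lambda>x. t\<^sub>1 x powr p) \<in> muckenhoupt (p / \<theta>)" "(\<lambda>x. t\<^sub>2 x powr p) \<in> muckenhoupt (p / \<theta>)"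
    and eq: "dyadic_equiv (\<lambda>Q. cube_mean Q p t\<^sub>1) (\<lambda>Q. cube_mean Q p t\<^sub>2)"
  shows "dyadic_equiv (\<lambda>Q. cube_mean Q \<sigma> (\<lambda>x. inverse (t\<^sub>1 x))) (\<lambda>Q. cube_mean Q \<sigma> (\<lambda>x. inverse (t\<^sub>2 x)))"
proof -
  obtain c1 C1 where 1: "0 < c1" "0 < C1" "\<And>Q. Q \<in> dyadic_cubes \<Longrightarrow> \<exists>m>0. \<exists>u>0.
      cube_mean Q p t\<^sub>1 = ennreal m \<and> cube_mean Q \<sigma> (\<lambda>x. inverse (t\<^sub>1 x)) = ennreal u \<and> c1 \<le> m * u \<and> m * u \<le> C1"
    using cube_means_product[OF \<theta> \<sigma> t(1) A(1)] by blast
  obtain c2 C2 where 2: "0 < c2" "0 < C2" "\<And>Q. Q \<in> dyadic_cubes \<Longrightarrow> \<exists>m>0. \<exists>u>0.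
      cube_mean Q p t\<^sub>2 = ennreal m \<and> cube_mean Q \<sigma> (\<lambda>x. inverse (t\<^sub>2 x)) = ennreal u \<and> c2 \<le> m * u \<and> m * u \<le> C2"
    using cube_means_product[OF \<theta> \<sigma> t(2) A(2)] by blast
  obtain c C where 3: "0 < c" "0 < C" "\<And>Q. Q \<in> dyadic_cubes \<Longrightarrow>
      ennreal c * cube_mean Q p t\<^sub>1 \<le> cube_mean Q p t\<^sub>2 \<and> cube_mean Q p t\<^sub>2 \<le> ennreal C * cube_mean Q p t\<^sub>1"
    using eq unfolding dyadic_equiv_def by blast
  have "ennreal (c2 / (C * C1)) * cube_mean Q \<sigma> (\<lambda>x. inverse (t\<^sub>1 x)) \<le> cube_mean Q \<sigma> (\<lambda>x. inverse (t\<^sub>2 x)) \<and>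
      cube_mean Q \<sigma> (\<lambda>x. inverse (t\<^sub>2 x)) \<le> ennreal (C2 / (c * c1)) * cube_mean Q \<sigma> (\<lambda>x. inverse (t\<^sub>1 x))"
    if Q: "Q \<in> dyadic_cubes" for Q
  proof -
    obtain m1 u1 where a: "0 < m1" "0 < u1" "cube_mean Q p t\<^sub>1 = ennreal m1"
      "cube_mean Q \<sigma> (\<lambda>x. inverse (t\<^sub>1 x)) = ennreal u1" "c1 \<le> m1 * u1" "m1 * u1 \<le> C1" using 1(3)[OF Q] by blast
    obtain m2 u2 where b: "0 < m2" "0 < u2" "cube_mean Q p t\<^sub>2 = ennreal m2"
      "cube_mean Q \<sigma> (\<lambda>x. inverse (t\<^sub>2 x)) = ennreal u2" "c2 \<le> m2 * u2" "m2 * u2 \<le> C2" using 2(3)[OF Q] by blast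
    have m: "c * m1 \<le> m2" "m2 \<le> C * m1"
      using 3(3)[OF Q] a(1,3) b(1,3) 3(1,2) by (auto simp flip: ennreal_mult)
    have "c2 * u1 \<le> (C * C1) * u2"
    proof -
      have "c2 * u1 \<le> (m2 * u2) * u1" using a b by (intro mult_right_mono) auto
      also have "\<dots> \<le> (C * m1 * u2) * u1" using a b m by (intro mult_right_mono) auto
      also have "\<dots> = C * u2 * (m1 * u1)" by simp
      also have "\<dots> \<le> C * u2 * C1" using a b 3 by (intro mult_left_mono) auto
      finally show ?thesis by (simp add: algebra_simps)
    qed
    then have "c2 / (C * C1) * u1 \<le> u2" using 1 3(1,2) by (simp add: field_simps)
    moreover have "(c * c1) * u2 \<le> C2 * u1"
    proof -
      have "(c * c1) * u2 \<le> (c * (m1 * u1)) * u2" using a b 3 by (intro mult_right_mono mult_left_mono) auto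
      also have "\<dots> = (c * m1) * (u1 * u2)" by simp
      also have "\<dots> \<le> m2 * (u1 * u2)" using a b m by (intro mult_right_mono) auto
      also have "\<dots> = (m2 * u2) * u1" by simp
      also have "\<dots> \<le> C2 * u1" using a b by (intro mult_right_mono) auto
      finally show ?thesis .
    qed
    then have "u2 \<le> C2 / (c * c1) * u1" using 1 3(1,2) by (simp add: field_simps)
    ultimately show ?thesis using a b 1 2 3(1,2) by (simp flip: ennreal_mult)
  qed
  moreover have "0 < c2 / (C * C1)" "0 < C2 / (c * c1)" using 1(1,2) 2(1,2) 3(1,2) by auto
  ultimately show ?thesis unfolding dyadic_equiv_def by blast
qed

lemma AE_le_of_cube_mean_le:
  fixes t1 t2 :: "real^'n::finite \<Rightarrow> real"
  assumes p: "0 < p" and t: "weight t1" "weight t2" "weight (\<lambda>x. t1 x powr p)" "weight (\<lambda>x. t2 x powr p)"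
    and C: "0 < C" and le: "\<And>Q. Q \<in> dyadic_cubes \<Longrightarrow> cube_mean Q p t1 \<le> ennreal C * cube_mean Q p t2"
  shows "AE x in lebesgue. t1 x \<le> C * t2 x"
proof -
  have nn: "0 \<le> t1 x" "0 \<le> t2 x" for x using t by (auto simp: weight_def)
  have int: "(\<integral>\<^sup>+x\<in>Q. ennreal (t1 x powr p) \<partial>lebesgue) \<le> ennreal (C powr p) * (\<integral>\<^sup>+x\<in>Q. ennreal (t2 x powr p) \<partial>lebesgue)"
    if Q: "Q \<in> dyadic_cubes" for Q
  proof -
    obtain a v where Qa: "Q = half_open_cube a (2 powi (- v))" using Q by (rule dyadic_cubeE)
    define L where "L = ((2::real) powi (- v)) ^ CARD('n)"
    have L: "0 < L" by (simp add: L_def)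
    have LQ: "emeasure lebesgue Q = ennreal L"
      unfolding Qa emeasure_half_open_cube L_def by (rule emeasure_cube) simp
    define I1 I2 where "I1 = (\<integral>\<^sup>+x\<in>Q. ennreal (t1 x powr p) \<partial>lebesgue)" and "I2 = (\<integral>\<^sup>+x\<in>Q. ennreal (t2 x powr p) \<partial>lebesgue)"
    have "ennpowr (I1 / ennreal L) (1 / p) \<le> ennreal C * ennpowr (I2 / ennreal L) (1 / p)"
      using le[OF Q] nn by (simp add: cube_mean_def LQ I1_def I2_def)
    then have "ennpowr (ennpowr (I1 / ennreal L) (1 / p)) p \<le> ennpowr (ennreal C * ennpowr (I2 / ennreal L) (1 / p)) p"
      using p by (intro ennpowr_mono)
    then have "I1 / ennreal L \<le> ennreal (C powr p) * (I2 / ennreal L)"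
      using ennpowr_ennpowr[of "1/p"] p C by (simp add: ennpowr_cmult)
    then have "ennreal L * (I1 / ennreal L) \<le> ennreal L * (ennreal (C powr p) * (I2 / ennreal L))"
      by (intro mult_left_mono) auto
    moreover have "ennreal L * (I / ennreal L) = I" for I
      using L by (simp add: ennreal_times_divide ennreal_mult_divide_eq mult.commute)
    ultimately show ?thesis unfolding I1_def[symmetric] I2_def[symmetric]
      by (metis mult.left_commute)
  qed
  have [measurable]: "(\<lambda>x. t1 x powr p) \<in> borel_measurable lebesgue" "(\<lambda>x. t2 x powr p) \<in> borel_measurable lebesgue"
    using t by (auto intro: weight_measurable)
  have fin: "(\<integral>\<^sup>+x\<in>ball 0 R. ennreal (t x) \<partial>lebesgue) < \<infinity>" if "weight t" for t :: "real^'n \<Rightarrow> real" and R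
  proof -
    have "(\<integral>\<^sup>+x\<in>ball 0 R. ennreal (t x) \<partial>lebesgue) \<le> (\<integral>\<^sup>+x\<in>cball 0 R. ennreal (t x) \<partial>lebesgue)"
      by (intro nn_integral_mono) (auto simp: indicator_def)
    also have "\<dots> < \<infinity>" using that by (rule weight_nn_integral_finite) simp
    finally show ?thesis .
  qed
  have "AE x in lebesgue. ennreal (t1 x powr p) \<le> ennreal (C powr p) * ennreal (t2 x powr p)"
    by (rule dyadic_comparison_AE[OF _ _ int]) (use fin t in auto)
  then show ?thesis
  proof eventually_elim
    case (elim x)
    then have "t1 x powr p \<le> (C * t2 x) powr p"
      using C nn by (simp add: powr_mult flip: ennreal_mult)
    then show ?case using p C nn[of x] by (metis less_imp_le mult_nonneg_nonneg not_le powr_less_mono2)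
  qed
qed

lemma same_space_of_dyadic_equiv:
  fixes t1 t2 :: "real^'n::finite \<Rightarrow> real"
  assumes p: "0 < p" and q: "0 < q" and t: "weight t1" "weight t2" "weight (\<lambda>x. t1 x powr p)" "weight (\<lambda>x. t2 x powr p)"
    and eq: "dyadic_equiv (\<lambda>Q. cube_mean Q p t1) (\<lambda>Q. cube_mean Q p t2)"
  shows "same_space A \<phi> p q t1 t2"
proof -
  obtain c C where 3: "0 < c" "0 < C" "\<And>Q. Q \<in> dyadic_cubes \<Longrightarrow>
      ennreal c * cube_mean Q p t1 \<le> cube_mean Q p t2 \<and> cube_mean Q p t2 \<le> ennreal C * cube_mean Q p t1"
    using eq unfolding dyadic_equiv_def by blast
  have "AE x in lebesgue. t2 x \<le> C * t1 x"
    by (rule AE_le_of_cube_mean_le[OF p t(2,1,4,3) 3(2)]) (use 3(3) in blast)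
  moreover have "AE x in lebesgue. t1 x \<le> (1 / c) * t2 x"
  proof (rule AE_le_of_cube_mean_le[OF p t])
    fix Q :: "(real^'n) set" assume "Q \<in> dyadic_cubes"
    then have "ennreal (1/c) * (ennreal c * cube_mean Q p t1) \<le> ennreal (1/c) * cube_mean Q p t2"
      by (intro mult_left_mono) (use 3(3) in auto)
    then show "cube_mean Q p t1 \<le> ennreal (1/c) * cube_mean Q p t2"
      using 3(1) by (simp add: mult.assoc[symmetric] flip: ennreal_mult)
  qed (use 3(1) in simp)
  ultimately show ?thesis
    using 3(1,2) by (intro same_space_of_comparable_weights[OF p q, of C "1/c"]) auto
qed

section \<open>Schwartz functions and rapid decay\<close>

lemma schwartz_iter_differentiable: "f \<in> schwartz \<Longrightarrow> iter_partial is f differentiable (at x)"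
  by (auto simp: schwartz_def smooth_def)

lemma schwartz_continuous: "f \<in> schwartz \<Longrightarrow> continuous_on UNIV f"
  using schwartz_iter_differentiable[of f "[]"]
  by (auto simp: continuous_on_eq_continuous_at differentiable_imp_continuous_within)

lemma schwartz_measurable: "f \<in> schwartz \<Longrightarrow> f \<in> borel_measurable borel"
  by (simp add: borel_measurable_continuous_onI schwartz_continuous)

text \<open>Decay of the function alone, without its derivatives. This class is closed under multiplication by coordinates
and by bounded functions, and it is all that the Fourier arguments below use.\<close>

definition rapidly_decaying :: "(real^'n::finite \<Rightarrow> complex) \<Rightarrow> bool" where
  "rapidly_decaying f \<longleftrightarrow> f \<in> borel_measurable borel \<and> (\<forall>N. \<exists>C\<ge>0. \<forall>x. (1 + norm x) ^ N * norm (f x) \<le> C)"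

lemma rapidly_decayingE:
  assumes "rapidly_decaying f"
  obtains C where "0 \<le> C" "\<And>x. (1 + norm x) ^ N * norm (f x) \<le> C"
  using assms unfolding rapidly_decaying_def by blast

lemma schwartz_rapidly_decaying:
  assumes "f \<in> schwartz" shows "rapidly_decaying f"
  unfolding rapidly_decaying_def
proof (intro conjI allI)
  fix N
  have "bounded (range (\<lambda>x. (1 + norm x) ^ N * norm (iter_partial [] f x)))"
    using assms unfolding schwartz_def by blast
  then obtain B where B: "\<And>x. \<bar>(1 + norm x) ^ N * norm (f x)\<bar> \<le> B" by (auto simp: bounded_iff)
  then have "0 \<le> B" using abs_ge_zero order_trans by blast
  then show "\<exists>C\<ge>0. \<forall>x. (1 + norm x) ^ N * norm (f x) \<le> C"
    using B by (meson abs_le_iff)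
qed (rule schwartz_measurable[OF assms])

lemma integrable_decay:
  "integrable lborel (\<lambda>x::real^'n::finite. inverse ((1 + norm x) ^ (CARD('n) + 1)))"
proof (rule integrableI_nonneg)
  let ?n = "real CARD('n)"
  have eq: "inverse ((1 + norm x) ^ (CARD('n) + 1)) = (1 + norm (x - 0) / 1) powr (- (?n + 1))" for x :: "real^'n"
  proof -
    have "(1 + norm x) powr (- real (CARD('n) + 1)) = inverse ((1 + norm x) ^ (CARD('n) + 1))"
      by (subst powr_minus, subst powr_realpow) (auto simp: add_pos_nonneg)
    then show ?thesis by (simp add: minus_diff_commute)
  qed
  have "(\<integral>\<^sup>+(x::real^'n). 1 * ennreal ((1 + norm (x - 0) / 1) powr (- (?n + 1))) \<partial>lebesgue)
      \<le> ennreal (2 powr ((?n + 1) + 1) * 2 ^ CARD('n)) * 1"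
  proof (rule nn_integral_tail_le[where d = ?n])
    fix k :: nat
    have "(2 * (1 * 2 ^ k)) ^ CARD('n) = 2 ^ CARD('n) * (2::real) powr (?n * k)"
      by (simp add: power_mult_distrib powr_realpow[symmetric] powr_powr mult.commute)
    then show "(\<integral>\<^sup>+x\<in>cube (0 - (\<chi> i::'n. 1 * 2 ^ k)) (2 * (1 * 2 ^ k)). 1 \<partial>lebesgue) \<le> ennreal (2 ^ CARD('n) * 2 powr (?n * k)) * (1::ennreal)"
      using emeasure_cube[of "2 * (1 * 2 ^ k)" "0 - (\<chi> i::'n. 1 * 2 ^ k)"]
      by (simp del: emeasure_completion add: order_eq_refl)
  qed auto
  also have "\<dots> < \<infinity>" by (simp add: ennreal_mult_less_top)
  finally show "(\<integral>\<^sup>+(x::real^'n). ennreal (inverse ((1 + norm x) ^ (CARD('n) + 1))) \<partial>lborel) < \<infinity>"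
    unfolding eq nn_integral_completion by simp
qed (auto simp: add_nonneg_pos)

lemma integrable_of_decay:
  fixes f :: "real^'n::finite \<Rightarrow> complex"
  assumes "f \<in> borel_measurable borel" "\<And>x. (1 + norm x) ^ (CARD('n) + 1) * norm (f x) \<le> C"
  shows "integrable lborel f"
proof (rule Bochner_Integration.integrable_bound)
  show "integrable lborel (\<lambda>x::real^'n. C * inverse ((1 + norm x) ^ (CARD('n) + 1)))"
    using integrable_decay by (rule integrable_mult_right)
  show "AE x in lborel. norm (f x) \<le> norm (C * inverse ((1 + norm x) ^ (CARD('n) + 1)))"
  proof (rule AE_I2)
    fix x :: "real^'n"
    have p: "0 < (1 + norm x) ^ (CARD('n) + 1)" by (intro zero_less_power) (simp add: add_pos_nonneg)
    have "norm (f x) \<le> C * inverse ((1 + norm x) ^ (CARD('n) + 1))"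
      using assms(2)[of x] p by (simp add: divide_inverse[symmetric] pos_le_divide_eq mult.commute del: power_Suc)
    then show "norm (f x) \<le> norm (C * inverse ((1 + norm x) ^ (CARD('n) + 1)))"
      by (metis abs_ge_self order_trans real_norm_def)
  qed
qed (use assms in simp)

lemma rapidly_decaying_integrable: "rapidly_decaying f \<Longrightarrow> integrable lborel f"
  by (metis rapidly_decaying_def integrable_of_decay)

lemma rapidly_decaying_mult_bounded:
  assumes "rapidly_decaying f" "g \<in> borel_measurable borel" "\<And>x. norm (g x) \<le> B"
  shows "rapidly_decaying (\<lambda>x. g x * f x)"
  unfolding rapidly_decaying_def
proof (intro conjI allI)
  have [measurable]: "f \<in> borel_measurable borel" using assms by (simp add: rapidly_decaying_def)
  show "(\<lambda>x. g x * f x) \<in> borel_measurable borel" using assms(2) by measurable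
  fix N
  obtain C where C: "0 \<le> C" "\<And>x. (1 + norm x) ^ N * norm (f x) \<le> C"
    using rapidly_decayingE[OF assms(1), of N] by blast
  have B: "0 \<le> B" using assms(3) norm_ge_zero order_trans by blast
  have "(1 + norm x) ^ N * norm (g x * f x) \<le> B * C" for x
  proof -
    have "(1 + norm x) ^ N * norm (g x * f x) = norm (g x) * ((1 + norm x) ^ N * norm (f x))"
      by (simp add: norm_mult)
    also have "\<dots> \<le> B * C" using assms(3) C B by (intro mult_mono) auto
    finally show ?thesis .
  qed
  then show "\<exists>C\<ge>0. \<forall>x. (1 + norm x) ^ N * norm (g x * f x) \<le> C"
    using B C by (intro exI[of _ "B * C"]) auto
qed

lemma rapidly_decaying_mult_coordinate:
  fixes f :: "real^'n::finite \<Rightarrow> complex"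
  assumes "rapidly_decaying f"
  shows "rapidly_decaying (\<lambda>x. of_real (x $ i) * f x)"
  unfolding rapidly_decaying_def
proof (intro conjI allI)
  have [measurable]: "f \<in> borel_measurable borel" using assms by (simp add: rapidly_decaying_def)
  show "(\<lambda>x. of_real (x $ i) * f x) \<in> borel_measurable borel" by measurable
  fix N
  obtain C where C: "0 \<le> C" "\<And>x. (1 + norm x) ^ Suc N * norm (f x) \<le> C"
    using rapidly_decayingE[OF assms, of "Suc N"] by blast
  have "(1 + norm x) ^ N * norm (of_real (x $ i) * f x) \<le> C" for x
  proof -
    have "(1 + norm x) ^ N * norm (of_real (x $ i) * f x) = \<bar>x $ i\<bar> * ((1 + norm x) ^ N * norm (f x))"
      by (simp add: norm_mult)
    also have "\<dots> \<le> (1 + norm x) * ((1 + norm x) ^ N * norm (f x))"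
      using component_le_norm_cart[of x i] by (intro mult_right_mono) auto
    also have "\<dots> \<le> C" using C(2)[of x] by (simp add: mult.assoc)
    finally show ?thesis .
  qed
  then show "\<exists>C\<ge>0. \<forall>x. (1 + norm x) ^ N * norm (of_real (x $ i) * f x) \<le> C" using C by blast
qed

lemma partial_deriv_eq:
  assumes "(f has_derivative f') (at x)"
  shows "partial_deriv i f x = f' (axis i 1)"
  unfolding partial_deriv_def using frechet_derivative_at[OF assms] by simp

lemma iter_partial_add:
  assumes "smooth f" "smooth g"
  shows "iter_partial is (\<lambda>x. f x + g x) = (\<lambda>x. iter_partial is f x + iter_partial is g x)"
proof (induction "is")
  case (Cons i "is")
  show ?case
  proof
    fix x
    have "(iter_partial is f has_derivative frechet_derivative (iter_partial is f) (at x)) (at x)"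
      "(iter_partial is g has_derivative frechet_derivative (iter_partial is g) (at x)) (at x)"
      using assms by (auto simp: smooth_def frechet_derivative_works[symmetric])
    from has_derivative_add[OF this]
    show "iter_partial (i # is) (\<lambda>x. f x + g x) x = iter_partial (i # is) f x + iter_partial (i # is) g x"
      by (simp add: Cons.IH partial_deriv_eq) (simp add: partial_deriv_def)
  qed
qed simp

lemma iter_partial_affine:
  fixes f :: "real^'n::finite \<Rightarrow> complex"
  assumes "smooth f"
  shows "iter_partial is (\<lambda>y. c * f (b + a *\<^sub>R y))
    = (\<lambda>y. c * of_real (a ^ length is) * iter_partial is f (b + a *\<^sub>R y))"
proof (induction "is")
  case (Cons i "is")
  show ?case
  proof
    fix y
    let ?F = "frechet_derivative (iter_partial is f) (at (b + a *\<^sub>R y))"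
    have F: "(iter_partial is f has_derivative ?F) (at (b + a *\<^sub>R y))"
      using assms by (auto simp: smooth_def frechet_derivative_works[symmetric])
    have lin: "?F (a *\<^sub>R v) = of_real a * ?F v" for v
      unfolding scaleR_conv_of_real[of a "?F v", symmetric]
      using F has_derivative_bounded_linear bounded_linear.linear linear_scale by blast
    have "((\<lambda>y. b + a *\<^sub>R y) has_derivative (\<lambda>v. a *\<^sub>R v)) (at y)"
      by (auto intro!: derivative_eq_intros)
    then have "((\<lambda>y. iter_partial is f (b + a *\<^sub>R y)) has_derivative (\<lambda>v. ?F (a *\<^sub>R v))) (at y)"
      using F by (rule has_derivative_compose)
    then have "((\<lambda>y. c * of_real (a ^ length is) * iter_partial is f (b + a *\<^sub>R y)) has_derivative
        (\<lambda>v. c * of_real (a ^ length is) * ?F (a *\<^sub>R v))) (at y)"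
      by (rule has_derivative_mult_right)
    then show "iter_partial (i # is) (\<lambda>y. c * f (b + a *\<^sub>R y)) y
        = c * of_real (a ^ length (i # is)) * iter_partial (i # is) f (b + a *\<^sub>R y)"
      by (simp add: Cons.IH partial_deriv_eq) (simp add: lin partial_deriv_def)
  qed
qed simp

text \<open>Polynomial weights are comparable under affine changes of variable; this keeps Schwartz functions Schwartz.\<close>

lemma one_add_norm_affine_le:
  fixes b y :: "'a::real_normed_vector"
  assumes "a \<noteq> 0"
  shows "1 + norm y \<le> (1 + (1 + norm b) / \<bar>a\<bar>) * (1 + norm (b + a *\<^sub>R y))"
proof -
  have "\<bar>a\<bar> * norm y = norm ((b + a *\<^sub>R y) - b)" by simp
  also have "\<dots> \<le> norm (b + a *\<^sub>R y) + norm b" by (rule norm_triangle_ineq4)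
  also have "\<dots> \<le> (1 + norm b) * (1 + norm (b + a *\<^sub>R y))" by (simp add: algebra_simps)
  finally have n1: "norm y \<le> (1 + norm b) / \<bar>a\<bar> * (1 + norm (b + a *\<^sub>R y))"
    using assms by (simp add: field_simps)
  have n2: "1 \<le> 1 + norm (b + a *\<^sub>R y)" by simp
  show ?thesis using add_mono[OF n2 n1] by (simp only: distrib_right mult_1_left)
qed

lemma schwartz_affine:
  fixes f :: "real^'n::finite \<Rightarrow> complex"
  assumes "f \<in> schwartz" "a \<noteq> 0"
  shows "(\<lambda>y. c * f (b + a *\<^sub>R y)) \<in> schwartz"
  unfolding schwartz_def
proof (intro CollectI conjI allI)
  have sm: "smooth f" using assms by (simp add: schwartz_def)
  show "smooth (\<lambda>y. c * f (b + a *\<^sub>R y))"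
    unfolding smooth_def
  proof (intro allI)
    fix "is" x
    have "(iter_partial is f has_derivative frechet_derivative (iter_partial is f) (at (b + a *\<^sub>R x))) (at (b + a *\<^sub>R x))"
      using sm by (auto simp: smooth_def frechet_derivative_works[symmetric])
    moreover have "((\<lambda>y. b + a *\<^sub>R y) has_derivative (\<lambda>v. a *\<^sub>R v)) (at x)"
      by (auto intro!: derivative_eq_intros)
    ultimately have "((\<lambda>y. iter_partial is f (b + a *\<^sub>R y)) has_derivative
        (\<lambda>v. frechet_derivative (iter_partial is f) (at (b + a *\<^sub>R x)) (a *\<^sub>R v))) (at x)"
      by (rule has_derivative_compose[rotated])
    then show "iter_partial is (\<lambda>y. c * f (b + a *\<^sub>R y)) differentiable at x"
      unfolding iter_partial_affine[OF sm] by (auto intro!: has_derivative_mult_right simp: differentiable_def)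
  qed
  fix N "is"
  have "bounded (range (\<lambda>x. (1 + norm x) ^ N * norm (iter_partial is f x)))"
    using assms by (simp add: schwartz_def)
  then obtain B where B: "\<And>x. \<bar>(1 + norm x) ^ N * norm (iter_partial is f x)\<bar> \<le> B"
    by (auto simp: bounded_iff)
  define K where "K = 1 + (1 + norm b) / \<bar>a\<bar>"
  have K: "0 \<le> K" by (simp add: K_def)
  define D where "D = norm (c * of_real (a ^ length is))"
  have "norm ((1 + norm y) ^ N * norm (iter_partial is (\<lambda>y. c * f (b + a *\<^sub>R y)) y)) \<le> K ^ N * (D * B)" for y
  proof -
    have "norm ((1 + norm y) ^ N * norm (iter_partial is (\<lambda>y. c * f (b + a *\<^sub>R y)) y))
        = (1 + norm y) ^ N * (D * norm (iter_partial is f (b + a *\<^sub>R y)))"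
      by (simp add: iter_partial_affine[OF sm] norm_mult D_def abs_mult)
    also have "\<dots> \<le> (K * (1 + norm (b + a *\<^sub>R y))) ^ N * (D * norm (iter_partial is f (b + a *\<^sub>R y)))"
      unfolding K_def by (intro mult_right_mono power_mono one_add_norm_affine_le[OF assms(2)]) (auto simp: D_def)
    also have "\<dots> = K ^ N * (D * ((1 + norm (b + a *\<^sub>R y)) ^ N * norm (iter_partial is f (b + a *\<^sub>R y))))"
      by (simp add: power_mult_distrib)
    also have "\<dots> \<le> K ^ N * (D * B)"
      using B[of "b + a *\<^sub>R y"] K by (intro mult_left_mono) (auto simp: D_def)
    finally show ?thesis .
  qed
  then show "bounded (range (\<lambda>y. (1 + norm y) ^ N * norm (iter_partial is (\<lambda>y. c * f (b + a *\<^sub>R y)) y)))"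
    unfolding bounded_iff by blast
qed

lemma schwartz_cmult: "f \<in> schwartz \<Longrightarrow> (\<lambda>y. c * f y) \<in> schwartz"
  using schwartz_affine[of f 1 c 0] by simp

lemma schwartz_add:
  assumes "f \<in> schwartz" "g \<in> schwartz"
  shows "(\<lambda>x. f x + g x) \<in> schwartz"
  unfolding schwartz_def
proof (intro CollectI conjI allI)
  have sm: "smooth f" "smooth g" using assms by (auto simp: schwartz_def)
  show "smooth (\<lambda>x. f x + g x)"
    using sm unfolding smooth_def iter_partial_add[OF sm] by (auto intro: differentiable_add)
  fix N "is"
  have "bounded (range (\<lambda>x. (1 + norm x) ^ N * norm (iter_partial is f x)))"
    "bounded (range (\<lambda>x. (1 + norm x) ^ N * norm (iter_partial is g x)))"
    using assms by (auto simp: schwartz_def)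
  then obtain A B where AB: "\<And>x. \<bar>(1 + norm x) ^ N * norm (iter_partial is f x)\<bar> \<le> A"
      "\<And>x. \<bar>(1 + norm x) ^ N * norm (iter_partial is g x)\<bar> \<le> B"
    by (auto simp: bounded_iff)
  have "norm ((1 + norm x) ^ N * norm (iter_partial is (\<lambda>x. f x + g x) x)) \<le> A + B" for x
  proof -
    have "norm ((1 + norm x) ^ N * norm (iter_partial is (\<lambda>x. f x + g x) x))
        = (1 + norm x) ^ N * norm (iter_partial is f x + iter_partial is g x)"
      by (simp add: iter_partial_add[OF sm] abs_mult)
    also have "\<dots> \<le> (1 + norm x) ^ N * (norm (iter_partial is f x) + norm (iter_partial is g x))"
      by (intro mult_left_mono norm_triangle_ineq) auto
    also have "\<dots> \<le> A + B" using AB[of x] by (simp add: distrib_left abs_le_iff)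
    finally show ?thesis .
  qed
  then show "bounded (range (\<lambda>x. (1 + norm x) ^ N * norm (iter_partial is (\<lambda>x. f x + g x) x)))"
    unfolding bounded_iff by blast
qed

lemma rapidly_decaying_monomial:
  fixes f :: "real^'n::finite \<Rightarrow> complex"
  assumes "rapidly_decaying f" "finite S"
  shows "rapidly_decaying (\<lambda>x. of_real (\<Prod>i\<in>S. (x $ i) ^ \<beta> i) * f x)"
  using assms(2)
proof induction
  case empty
  then show ?case using assms by simp
next
  case (insert i S)
  have "rapidly_decaying (\<lambda>x. of_real ((x $ i) ^ k) * (of_real (\<Prod>i\<in>S. (x $ i) ^ \<beta> i) * f x))" for k
  proof (induction k)
    case (Suc k)
    from rapidly_decaying_mult_coordinate[OF this, of i] show ?case by (simp add: mult.assoc)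
  qed (use insert.IH in simp)
  from this[of "\<beta> i"] show ?case using insert by (simp add: mult.assoc)
qed

lemma schwartz_infty_add:
  assumes "f \<in> schwartz_infty" "g \<in> schwartz_infty"
  shows "(\<lambda>x. f x + g x) \<in> schwartz_infty"
proof -
  have s: "f \<in> schwartz" "g \<in> schwartz" using assms by (auto simp: schwartz_infty_def)
  have "(\<integral>x. of_real (\<Prod>i\<in>UNIV. (x $ i) ^ \<beta> i) * (f x + g x) \<partial>lborel) = 0" for \<beta>
    using assms s by (simp add: distrib_left schwartz_infty_def
        rapidly_decaying_integrable rapidly_decaying_monomial schwartz_rapidly_decaying del: of_real_prod)
  then show ?thesis using schwartz_add[OF s] by (simp add: schwartz_infty_def)
qed

lemma schwartz_infty_cmult:
  assumes "f \<in> schwartz_infty"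
  shows "(\<lambda>x. c * f x) \<in> schwartz_infty"
proof -
  have "(\<integral>x. of_real (\<Prod>i\<in>UNIV. (x $ i) ^ \<beta> i) * (c * f x) \<partial>lborel) = 0" for \<beta>
    using assms by (simp add: mult.left_commute[of _ c] schwartz_infty_def del: of_real_prod)
  then show ?thesis using assms schwartz_cmult[of f c] by (simp add: schwartz_infty_def)
qed

section \<open>Fourier support and vanishing moments\<close>

lemma integral_affine:
  fixes f :: "real^'n::finite \<Rightarrow> complex"
  assumes [measurable]: "f \<in> borel_measurable borel" and a: "a \<noteq> 0"
  shows "(\<integral>y. f y \<partial>lborel) = of_real (\<bar>a\<bar> ^ CARD('n)) * (\<integral>u. f (b + a *\<^sub>R u) \<partial>lborel)"
proof -
  have "(\<integral>y. f y \<partial>lborel) = integral\<^sup>L (density (distr lborel borel (\<lambda>u. b + a *\<^sub>R u)) (\<lambda>_. ennreal (\<bar>a\<bar> ^ CARD('n)))) f"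
    using lborel_affine[OF a, of b] by (simp add: ennreal_power)
  also have "\<dots> = (\<integral>y. (\<bar>a\<bar> ^ CARD('n)) *\<^sub>R f y \<partial>distr lborel borel (\<lambda>u. b + a *\<^sub>R u))"
    by (rule integral_density) auto
  also have "\<dots> = (\<integral>u. (\<bar>a\<bar> ^ CARD('n)) *\<^sub>R f (b + a *\<^sub>R u) \<partial>lborel)"
    by (rule integral_distr) auto
  finally show ?thesis by (simp add: scaleR_conv_of_real)
qed

definition plane_wave :: "real^'n::finite \<Rightarrow> real^'n \<Rightarrow> complex" where
  "plane_wave \<xi> x = exp (- \<i> * of_real (x \<bullet> \<xi>))"

lemma norm_plane_wave [simp]: "norm (plane_wave \<xi> x) = 1"
  by (simp add: plane_wave_def norm_exp_eq_Re)

lemma plane_wave_measurable [measurable]: "plane_wave \<xi> \<in> borel_measurable borel"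
  unfolding plane_wave_def by measurable

lemma plane_wave_add: "plane_wave (\<xi> + \<eta>) x = plane_wave \<xi> x * plane_wave \<eta> x"
  by (simp add: plane_wave_def inner_add_right exp_add[symmetric] distrib_left)

lemma plane_wave_add_arg: "plane_wave \<xi> (x + y) = plane_wave \<xi> x * plane_wave \<xi> y"
  by (simp add: plane_wave_def inner_add_left exp_add[symmetric] distrib_left)

lemma plane_wave_axis: "plane_wave (s *\<^sub>R axis i 1) x = exp (- \<i> * of_real (s * x $ i))"
  by (simp add: plane_wave_def inner_axis)

lemma fourier_plane_wave:
  fixes f :: "real^'n::finite \<Rightarrow> complex"
  shows "fourier f \<xi> = of_real ((2 * pi) powr (- real CARD('n) / 2)) * (\<integral>x. plane_wave \<xi> x * f x \<partial>lborel)"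
  by (simp add: fourier_def plane_wave_def)

lemma fourier_zero_iff:
  "fourier f \<xi> = 0 \<longleftrightarrow> (\<integral>x. plane_wave \<xi> x * f x \<partial>lborel) = 0"
  by (simp add: fourier_plane_wave)

text \<open>The Fourier transform of \<open>h\<close>, up to its normalising factor, vanishes on the ball of radius \<open>r\<close> around \<open>\<xi>\<^sub>0\<close>. The
predicate fits the two operations used below: multiplication by a coordinate keeps the ball, and
multiplication by \<open>sinc (\<epsilon> y\<^sub>i)\<close> shrinks it by \<open>\<epsilon>\<close>.\<close>

definition spectrum_avoids :: "(real^'n::finite \<Rightarrow> complex) \<Rightarrow> real^'n \<Rightarrow> real \<Rightarrow> bool" where
  "spectrum_avoids h \<xi>\<^sub>0 r \<longleftrightarrow> (\<forall>\<xi>. norm (\<xi> - \<xi>\<^sub>0) < r \<longrightarrow> (\<integral>x. plane_wave \<xi> x * h x \<partial>lborel) = 0)"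

lemma norm_exp_minus_one_le: "norm (exp (- \<i> * of_real t) - 1) \<le> \<bar>t\<bar>"
proof -
  have "norm (exp (\<i> * of_real (- t)) - 1) = 2 * \<bar>sin (- t / 2)\<bar>" by (rule dist_exp_i_1)
  also have "\<dots> \<le> \<bar>t\<bar>" using abs_sin_x_le_abs_x[of "- t / 2"] by simp
  finally show ?thesis by simp
qed

text \<open>Multiplication by \<open>x\<^sub>i\<close> is differentiation on the Fourier side, and difference quotients of a function that vanishes
on an open ball vanish there. The quotients of the plane waves are bounded by \<open>|x\<^sub>i|\<close>, so the limit may be taken
under the integral.\<close>

lemma spectrum_avoids_mult_coordinate:
  fixes h :: "real^'n::finite \<Rightarrow> complex"
  assumes h: "rapidly_decaying h" and sp: "spectrum_avoids h \<xi>\<^sub>0 r"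
  shows "spectrum_avoids (\<lambda>x. of_real (x $ i) * h x) \<xi>\<^sub>0 r"
  unfolding spectrum_avoids_def
proof (intro allI impI)
  fix \<xi> assume \<xi>: "norm (\<xi> - \<xi>\<^sub>0) < r"
  define \<delta> where "\<delta> = r - norm (\<xi> - \<xi>\<^sub>0)"
  have \<delta>: "0 < \<delta>" using \<xi> by (simp add: \<delta>_def)
  define s where "s k = \<delta> * inverse (real (Suc (Suc k)))" for k :: nat
  have s: "0 < s k" "s k < \<delta>" for k
  proof -
    have "inverse (real (Suc (Suc k))) < 1" by (simp add: inverse_less_1_iff)
    then show "s k < \<delta>" using \<delta> mult_strict_left_mono[of "inverse (real (Suc (Suc k)))" 1 \<delta>] by (simp only: s_def mult_1_right)
  qed (use \<delta> in \<open>simp add: s_def\<close>)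
  have s0: "s \<longlonglongrightarrow> 0"
    unfolding s_def by (intro tendsto_mult_right_zero LIMSEQ_Suc[OF LIMSEQ_inverse_real_of_nat])
  have [measurable]: "h \<in> borel_measurable borel" using h by (simp add: rapidly_decaying_def)
  define q where "q k x = plane_wave \<xi> x * h x * ((exp (- \<i> * of_real (s k * x $ i)) - 1) / of_real (s k))" for k x
  have int0: "integrable lborel (\<lambda>x. plane_wave \<eta> x * h x)" for \<eta>
    by (rule rapidly_decaying_integrable[OF rapidly_decaying_mult_bounded[OF h, of _ 1]]) auto
  have "(\<integral>x. q k x \<partial>lborel) = 0" for k
  proof -
    have "q k x = (1 / of_real (s k)) * (plane_wave (\<xi> + s k *\<^sub>R axis i 1) x * h x - plane_wave \<xi> x * h x)" for x
      by (simp add: q_def plane_wave_add plane_wave_axis algebra_simps diff_divide_distrib)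
    then have "(\<integral>x. q k x \<partial>lborel) = (1 / of_real (s k)) *
        ((\<integral>x. plane_wave (\<xi> + s k *\<^sub>R axis i 1) x * h x \<partial>lborel) - (\<integral>x. plane_wave \<xi> x * h x \<partial>lborel))"
      by (simp add: Bochner_Integration.integral_diff[OF int0 int0])
    moreover have "norm (\<xi> + s k *\<^sub>R axis i 1 - \<xi>\<^sub>0) < r"
    proof -
      have "norm (\<xi> + s k *\<^sub>R axis i 1 - \<xi>\<^sub>0) \<le> norm (\<xi> - \<xi>\<^sub>0) + norm (s k *\<^sub>R (axis i 1 :: real^'n))"
        using norm_triangle_ineq[of "\<xi> - \<xi>\<^sub>0" "s k *\<^sub>R axis i 1"] by (simp add: algebra_simps)
      then show ?thesis using s[of k] by (simp add: \<delta>_def)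
    qed
    ultimately show ?thesis using sp \<xi> by (simp add: spectrum_avoids_def)
  qed
  moreover have "(\<lambda>k. \<integral>x. q k x \<partial>lborel) \<longlonglongrightarrow> (\<integral>x. plane_wave \<xi> x * h x * (- \<i> * of_real (x $ i)) \<partial>lborel)"
  proof (rule integral_dominated_convergence)
    show "integrable lborel (\<lambda>x. norm (of_real (x $ i) * h x))"
      using rapidly_decaying_integrable[OF rapidly_decaying_mult_coordinate[OF h]] by (rule integrable_norm)
    show "AE x in lborel. (\<lambda>k. q k x) \<longlonglongrightarrow> plane_wave \<xi> x * h x * (- \<i> * of_real (x $ i))"
    proof (rule AE_I2)
      fix x :: "real^'n"
      have "((\<lambda>z. exp (- \<i> * of_real (x $ i) * z)) has_field_derivative (- \<i> * of_real (x $ i))) (at 0)"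
        by (auto intro!: derivative_eq_intros)
      then have "((\<lambda>z. (exp (- \<i> * of_real (x $ i) * z) - 1) / z) \<longlongrightarrow> (- \<i> * of_real (x $ i))) (at 0)"
        by (simp add: has_field_derivative_iff)
      moreover have "filterlim (\<lambda>k. complex_of_real (s k)) (at 0) sequentially"
        unfolding filterlim_at using s tendsto_of_real[OF s0, where 'a=complex] by (auto simp: less_imp_neq[THEN not_sym])
      ultimately have "(\<lambda>k. (exp (- \<i> * of_real (x $ i) * of_real (s k)) - 1) / of_real (s k)) \<longlonglongrightarrow> - \<i> * of_real (x $ i)"
        by (rule filterlim_compose)
      then have "(\<lambda>k. (exp (- \<i> * of_real (s k * x $ i)) - 1) / of_real (s k)) \<longlonglongrightarrow> - \<i> * of_real (x $ i)"
        by (simp add: mult_ac)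
      then show "(\<lambda>k. q k x) \<longlonglongrightarrow> plane_wave \<xi> x * h x * (- \<i> * of_real (x $ i))"
        unfolding q_def by (intro tendsto_mult tendsto_const)
    qed
    show "AE x in lborel. norm (q k x) \<le> norm (of_real (x $ i) * h x)" for k
    proof (rule AE_I2)
      fix x :: "real^'n"
      have "norm ((exp (- \<i> * of_real (s k * x $ i)) - 1) / of_real (s k)) \<le> \<bar>s k * x $ i\<bar> / s k"
        using norm_exp_minus_one_le[of "s k * x $ i"] s[of k] by (simp add: norm_divide divide_right_mono)
      also have "\<dots> = \<bar>x $ i\<bar>" using s[of k] by (simp add: abs_mult)
      finally have "norm (h x) * norm ((exp (- \<i> * of_real (s k * x $ i)) - 1) / of_real (s k)) \<le> norm (h x) * \<bar>x $ i\<bar>"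
        by (intro mult_left_mono) auto
      then show "norm (q k x) \<le> norm (of_real (x $ i) * h x)"
        unfolding q_def norm_mult by (simp add: mult.commute)
    qed
  qed (auto simp: q_def)
  ultimately have "(\<lambda>k. 0) \<longlonglongrightarrow> (\<integral>x. plane_wave \<xi> x * h x * (- \<i> * of_real (x $ i)) \<partial>lborel)" by simp
  then have "(\<integral>x. plane_wave \<xi> x * h x * (- \<i> * of_real (x $ i)) \<partial>lborel) = 0"
    using LIMSEQ_unique tendsto_const by blast
  moreover have "plane_wave \<xi> x * h x * (- \<i> * of_real (x $ i)) = (- \<i>) * (plane_wave \<xi> x * (of_real (x $ i) * h x))" for x
    by (simp add: mult_ac)
  ultimately have "(- \<i>) * (\<integral>x. plane_wave \<xi> x * (of_real (x $ i) * h x) \<partial>lborel) = 0"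
    by (simp only: integral_mult_right_zero)
  then show "(\<integral>x. plane_wave \<xi> x * (of_real (x $ i) * h x) \<partial>lborel) = 0"
    by simp
qed

lemma spectrum_avoids_monomial:
  fixes f :: "real^'n::finite \<Rightarrow> complex"
  assumes "rapidly_decaying f" "spectrum_avoids f \<xi>\<^sub>0 r" "finite S"
  shows "spectrum_avoids (\<lambda>x. of_real (\<Prod>i\<in>S. (x $ i) ^ \<beta> i) * f x) \<xi>\<^sub>0 r"
  using assms(3)
proof induction
  case empty
  then show ?case using assms by simp
next
  case (insert i S)
  have "rapidly_decaying (\<lambda>x. of_real ((x $ i) ^ k) * (of_real (\<Prod>i\<in>S. (x $ i) ^ \<beta> i) * f x)) \<and>
    spectrum_avoids (\<lambda>x. of_real ((x $ i) ^ k) * (of_real (\<Prod>i\<in>S. (x $ i) ^ \<beta> i) * f x)) \<xi>\<^sub>0 r" for k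
  proof (induction k)
    case (Suc k)
    from rapidly_decaying_mult_coordinate[OF conjunct1[OF this], of i]
      spectrum_avoids_mult_coordinate[OF conjunct1[OF this] conjunct2[OF this], of i]
    show ?case by (simp add: mult.assoc)
  qed (use insert rapidly_decaying_monomial[OF assms(1) insert.hyps(1)] in simp)
  from conjunct2[OF this[of "\<beta> i"]] show ?case using insert by (simp add: mult.assoc)
qed

text \<open>Moments are values at the origin of derivatives of the Fourier transform.\<close>

lemma moments_vanish:
  assumes "rapidly_decaying f" "spectrum_avoids f 0 r" "0 < r"
  shows "(\<integral>x. of_real (\<Prod>i\<in>UNIV. (x $ i) ^ \<beta> i) * f x \<partial>lborel) = 0"
proof -
  have "(\<integral>x. plane_wave 0 x * (of_real (\<Prod>i\<in>UNIV. (x $ i) ^ \<beta> i) * f x) \<partial>lborel) = 0"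
    using spectrum_avoids_monomial[OF assms(1,2) finite, where S=UNIV and \<beta>=\<beta>] assms(3)
    unfolding spectrum_avoids_def by simp
  moreover have "plane_wave 0 x = 1" for x :: "real^'a" by (simp add: plane_wave_def)
  ultimately show ?thesis by (simp only: mult_1_left)
qed

lemma dilate_reflect:
  "dilate \<phi> k (x - y) = of_real (2 powi (k * int CARD('n))) * \<phi> ((2 powi k) *\<^sub>R x + (- (2 powi k)) *\<^sub>R y)"
  for x y :: "real^'n::finite"
  by (simp add: dilate_def scaleR_right_diff_distrib)

lemma admissible_schwartz: "admissible \<phi> \<Longrightarrow> \<phi> \<in> schwartz"
  by (simp add: admissible_def)

lemma admissible_fourier_zero:
  assumes "admissible \<phi>" "norm \<xi> < 1/2 \<or> 2 < norm \<xi>"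
  shows "(\<integral>x. plane_wave \<xi> x * \<phi> x \<partial>lborel) = 0"
proof (rule ccontr)
  assume "\<not> ?thesis"
  then have "\<xi> \<in> {\<xi>. fourier \<phi> \<xi> \<noteq> 0}" by (simp add: fourier_zero_iff)
  then have "\<xi> \<in> closure {\<xi>. fourier \<phi> \<xi> \<noteq> 0}" by (rule subsetD[OF closure_subset])
  moreover have "closure {\<xi>. fourier \<phi> \<xi> \<noteq> 0} \<subseteq> {\<xi>. 1/2 \<le> norm \<xi> \<and> norm \<xi> \<le> 2}"
    using assms(1) by (simp add: admissible_def)
  ultimately have "\<xi> \<in> {\<xi>. 1/2 \<le> norm \<xi> \<and> norm \<xi> \<le> 2}" by (rule subsetD[rotated])
  then show False using assms(2) by auto
qed

lemma dilate_reflect_schwartz: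
  assumes "admissible \<phi>"
  shows "(\<lambda>y. dilate \<phi> k (x - y)) \<in> schwartz"
  unfolding dilate_reflect by (rule schwartz_affine[OF admissible_schwartz[OF assms]]) simp

text \<open>The Fourier transform of \<open>y \<mapsto> \<phi>\<^sub>k (x - y)\<close> at \<open>\<xi>\<close> is that of \<open>\<phi>\<close> at \<open>- 2\<^bsup>-k\<^esup> \<xi>\<close>, up to a nonzero factor. Only the
zeros matter later, so the factor is left unspecified.\<close>

lemma plane_wave_dilate_reflect:
  fixes \<phi> :: "real^'n::finite \<Rightarrow> complex"
  assumes \<phi>: "admissible \<phi>"
  shows "\<exists>c. c \<noteq> 0 \<and> (\<integral>y. plane_wave \<xi> y * dilate \<phi> k (x - y) \<partial>lborel)
    = c * (\<integral>u. plane_wave (- (2 powi (- k)) *\<^sub>R \<xi>) u * \<phi> u \<partial>lborel)"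
proof -
  have [measurable]: "\<phi> \<in> borel_measurable borel" by (intro schwartz_measurable admissible_schwartz \<phi>)
  define a where "a = (2::real) powi (- k)"
  have a: "a \<noteq> 0" "2 powi k * a = 1" by (auto simp: a_def power_int_minus)
  have wave: "plane_wave \<xi> (x + (- a) *\<^sub>R u) = plane_wave \<xi> x * plane_wave (- a *\<^sub>R \<xi>) u" for u
    unfolding plane_wave_add_arg by (simp add: plane_wave_def)
  have arg: "2 powi k *\<^sub>R x + - (2 powi k) *\<^sub>R (x + (- a) *\<^sub>R u) = u" for u
    using a(2) by (simp add: scaleR_right_distrib scaleR_right_diff_distrib)
  have "(\<integral>y. plane_wave \<xi> y * dilate \<phi> k (x - y) \<partial>lborel) = of_real (\<bar>- a\<bar> ^ CARD('n)) *
      (\<integral>u. plane_wave \<xi> (x + (- a) *\<^sub>R u) * dilate \<phi> k (x - (x + (- a) *\<^sub>R u)) \<partial>lborel)"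
    by (rule integral_affine) (use a in \<open>auto simp: dilate_def\<close>)
  also have "(\<lambda>u. plane_wave \<xi> (x + (- a) *\<^sub>R u) * dilate \<phi> k (x - (x + (- a) *\<^sub>R u)))
      = (\<lambda>u. of_real (2 powi (k * int CARD('n))) * plane_wave \<xi> x * (plane_wave (- a *\<^sub>R \<xi>) u * \<phi> u))"
    unfolding dilate_reflect arg wave by (simp add: mult_ac)
  finally show ?thesis unfolding a_def[symmetric]
    by (intro exI[of _ "of_real (\<bar>- a\<bar> ^ CARD('n)) * (of_real (2 powi (k * int CARD('n))) * plane_wave \<xi> x)"] conjI)
      (use a in \<open>simp add: plane_wave_def\<close>, simp only: integral_mult_right_zero mult.assoc)
qed

lemma dilate_reflect_spectrum:
  assumes "admissible \<phi>" "\<And>\<xi>. norm (\<xi> - \<xi>\<^sub>0) < r \<Longrightarrow> norm \<xi> < 2 powi k / 2 \<or> 2 * 2 powi k < norm \<xi>"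
  shows "spectrum_avoids (\<lambda>y. dilate \<phi> k (x - y)) \<xi>\<^sub>0 r"
  unfolding spectrum_avoids_def
proof (intro allI impI)
  fix \<xi> assume "norm (\<xi> - \<xi>\<^sub>0) < r"
  then have "norm \<xi> < 2 powi k / 2 \<or> 2 * 2 powi k < norm \<xi>" by (rule assms(2))
  then have "norm (- (2 powi (- k)) *\<^sub>R \<xi>) < 1/2 \<or> 2 < norm (- (2 powi (- k)) *\<^sub>R \<xi>)"
    by (auto simp: power_int_minus field_simps)
  then have "(\<integral>u. plane_wave (- (2 powi (- k)) *\<^sub>R \<xi>) u * \<phi> u \<partial>lborel) = 0"
    by (rule admissible_fourier_zero[OF assms(1)])
  then show "(\<integral>y. plane_wave \<xi> y * dilate \<phi> k (x - y) \<partial>lborel) = 0"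
    using plane_wave_dilate_reflect[OF assms(1), of \<xi> k x] by auto
qed

text \<open>Elements of the dual are \<open>undefined\<close> outside \<^const>\<open>schwartz_infty\<close>, so convolutions with \<open>\<phi>\<^sub>k\<close> can be computed only
because \<open>\<phi>\<^sub>k (x - \<cdot>)\<close> has vanishing moments.\<close>

lemma dilate_reflect_schwartz_infty:
  assumes "admissible \<phi>"
  shows "(\<lambda>y. dilate \<phi> k (x - y)) \<in> schwartz_infty"
proof -
  have "spectrum_avoids (\<lambda>y. dilate \<phi> k (x - y)) 0 (2 powi k / 2)"
    using assms by (rule dilate_reflect_spectrum) simp
  then have "(\<integral>y. of_real (\<Prod>i\<in>UNIV. (y $ i) ^ \<beta> i) * dilate \<phi> k (x - y) \<partial>lborel) = 0" for \<beta>
    by (rule moments_vanish[OF schwartz_rapidly_decaying[OF dilate_reflect_schwartz[OF assms]]]) simp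
  then show ?thesis using dilate_reflect_schwartz[OF assms, of k x]
    unfolding schwartz_infty_def by blast
qed

section \<open>Functionals given by bounded functions\<close>

definition regular_functional :: "(real^'n::finite \<Rightarrow> complex) \<Rightarrow> (real^'n \<Rightarrow> complex) \<Rightarrow> complex" where
  "regular_functional g = restrict (\<lambda>\<psi>. \<integral>y. g y * \<psi> y \<partial>lborel) schwartz_infty"

lemma topspace_schwartz_infty: "topspace schwartz_infty_topology = schwartz_infty"
proof -
  have mem: "f \<in> {g \<in> schwartz_infty. schwartz_seminorm 0 [] (\<lambda>x. g x - f x) < 1}" if "f \<in> schwartz_infty"
    for f :: "real^'n::finite \<Rightarrow> complex" using that by (simp add: schwartz_seminorm_def)
  show ?thesis unfolding schwartz_infty_topology_def topology_generated_by_topspace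
  proof (intro equalityI subsetI)
    fix f :: "real^'n::finite \<Rightarrow> complex" assume f: "f \<in> schwartz_infty"
    show "f \<in> \<Union> {{g \<in> schwartz_infty. schwartz_seminorm N is (\<lambda>x. g x - f x) < \<epsilon>} | f N is \<epsilon>.
        f \<in> schwartz_infty \<and> 0 < \<epsilon>}"
      by (rule UnionI[OF _ mem[OF f]]) (use f zero_less_one in blast)
  qed blast
qed

text \<open>Continuity comes from the single seminorm of order \<open>n + 1\<close> without derivatives, which controls the \<open>L\<^sub>1\<close> norm.\<close>

lemma regular_functional_dual:
  fixes g :: "real^'n::finite \<Rightarrow> complex"
  assumes g: "g \<in> borel_measurable borel" "\<And>x. norm (g x) \<le> B"
  shows "regular_functional g \<in> schwartz_infty_dual"
proof -
  have rd: "rapidly_decaying \<psi>" if "\<psi> \<in> schwartz_infty" for \<psi> :: "real^'n \<Rightarrow> complex"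
    using that by (simp add: schwartz_infty_def schwartz_rapidly_decaying)
  have int: "integrable lborel (\<lambda>y. g y * \<psi> y)" if "\<psi> \<in> schwartz_infty" for \<psi>
    by (rule rapidly_decaying_integrable[OF rapidly_decaying_mult_bounded[OF rd[OF that] g]])
  have B: "0 \<le> B" using g(2) norm_ge_zero order_trans by blast
  define N where "N = CARD('n) + 1"
  define I where "I = (\<integral>(x::real^'n). inverse ((1 + norm x) ^ N) \<partial>lborel)"
  have I: "0 \<le> I" unfolding I_def by (rule integral_nonneg_AE) (auto simp: add_nonneg_nonneg)
  have add: "regular_functional g (\<lambda>x. \<psi> x + \<eta> x) = regular_functional g \<psi> + regular_functional g \<eta>"
    if "\<psi> \<in> schwartz_infty" "\<eta> \<in> schwartz_infty" for \<psi> \<eta>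
    using that int by (simp add: regular_functional_def schwartz_infty_add distrib_left)
  have cm: "regular_functional g (\<lambda>x. c * \<psi> x) = c * regular_functional g \<psi>" if "\<psi> \<in> schwartz_infty" for c \<psi>
    using that by (simp add: regular_functional_def schwartz_infty_cmult mult.left_commute[of _ c])
  have diff: "(\<lambda>x. \<psi> x - \<eta> x) \<in> schwartz_infty" if "\<psi> \<in> schwartz_infty" "\<eta> \<in> schwartz_infty" for \<psi> \<eta> :: "real^'n \<Rightarrow> complex"
    using schwartz_infty_add[OF that(1) schwartz_infty_cmult[OF that(2), of "-1"]] by simp
  have bound: "norm (regular_functional g \<psi>) \<le> B * I * schwartz_seminorm N [] \<psi>" if \<psi>: "\<psi> \<in> schwartz_infty" for \<psi>
  proof -
    let ?S = "schwartz_seminorm N [] \<psi>"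
    have "bounded (range (\<lambda>x. (1 + norm x) ^ N * norm (iter_partial [] \<psi> x)))"
      using \<psi> unfolding schwartz_infty_def schwartz_def by blast
    then have "bdd_above (range (\<lambda>x. (1 + norm x) ^ N * norm (iter_partial [] \<psi> x)))"
      by (rule bounded_imp_bdd_above)
    then have S: "(1 + norm x) ^ N * norm (\<psi> x) \<le> ?S" for x
      using cSUP_upper[of x UNIV "\<lambda>x. (1 + norm x) ^ N * norm (iter_partial [] \<psi> x)"]
      by (simp add: schwartz_seminorm_def)
    have le: "norm (g x * \<psi> x) \<le> B * ?S * inverse ((1 + norm x) ^ N)" for x
    proof -
      have p: "0 < (1 + norm x) ^ N" by (intro zero_less_power) (simp add: add_pos_nonneg)
      have "norm (\<psi> x) \<le> ?S * inverse ((1 + norm x) ^ N)"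
        using S[of x] p by (simp add: divide_inverse[symmetric] pos_le_divide_eq mult.commute)
      then have "norm (g x) * norm (\<psi> x) \<le> B * (?S * inverse ((1 + norm x) ^ N))"
        using g(2) B by (intro mult_mono) auto
      then show ?thesis by (simp add: norm_mult mult.assoc)
    qed
    have "norm (regular_functional g \<psi>) = norm (\<integral>y. g y * \<psi> y \<partial>lborel)"
      using \<psi> by (simp add: regular_functional_def)
    also have "\<dots> \<le> (\<integral>(x::real^'n). B * ?S * inverse ((1 + norm x) ^ N) \<partial>lborel)"
      by (rule Bochner_Integration.integral_norm_bound_integral[OF int[OF \<psi>]])
        (use le integrable_decay[where 'n='n] in \<open>auto simp: N_def simp del: power_Suc\<close>)
    also have "\<dots> = B * I * ?S" by (simp add: I_def)
    finally show ?thesis .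
  qed
  have "continuous_map schwartz_infty_topology euclidean (regular_functional g)"
    unfolding continuous_map_def topspace_schwartz_infty
  proof (intro conjI allI impI)
    fix U :: "complex set" assume "openin euclidean U"
    then have U: "open U" using open_openin by blast
    show "openin schwartz_infty_topology {\<psi> \<in> schwartz_infty. regular_functional g \<psi> \<in> U}"
    proof (subst openin_subopen, intro ballI)
      fix \<psi> assume "\<psi> \<in> {\<psi> \<in> schwartz_infty. regular_functional g \<psi> \<in> U}"
      then have \<psi>: "\<psi> \<in> schwartz_infty" "regular_functional g \<psi> \<in> U" by auto
      obtain e where e: "0 < e" "ball (regular_functional g \<psi>) e \<subseteq> U"
        using U \<psi>(2) open_contains_ball by blast
      define \<delta> where "\<delta> = e / (B * I + 1)"
      have BI: "0 < B * I + 1" using B I by (simp add: add_nonneg_pos)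
      have \<delta>: "0 < \<delta>" using e BI by (simp add: \<delta>_def)
      define T where "T = {\<eta> \<in> schwartz_infty. schwartz_seminorm N [] (\<lambda>x. \<eta> x - \<psi> x) < \<delta>}"
      have "openin schwartz_infty_topology T"
        unfolding schwartz_infty_topology_def T_def
        by (rule topology_generated_by_Basis) (use \<psi> \<delta> in blast)
      moreover have "\<psi> \<in> T"
      proof -
        have "schwartz_seminorm N [] (\<lambda>x. \<psi> x - \<psi> x) = 0" by (simp add: schwartz_seminorm_def)
        then show ?thesis using \<psi> \<delta> by (simp add: T_def)
      qed
      moreover have "T \<subseteq> {\<psi> \<in> schwartz_infty. regular_functional g \<psi> \<in> U}"
      proof
        fix \<eta> assume \<eta>: "\<eta> \<in> T"
        then have \<eta>S: "\<eta> \<in> schwartz_infty" and \<eta>\<delta>: "schwartz_seminorm N [] (\<lambda>x. \<eta> x - \<psi> x) < \<delta>"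
          by (auto simp: T_def)
        have "regular_functional g \<eta> - regular_functional g \<psi> = regular_functional g (\<lambda>x. \<eta> x - \<psi> x)"
          using add[OF diff[OF \<eta>S \<psi>(1)] \<psi>(1)] by simp
        then have "norm (regular_functional g \<eta> - regular_functional g \<psi>) \<le> B * I * schwartz_seminorm N [] (\<lambda>x. \<eta> x - \<psi> x)"
          using bound[OF diff[OF \<eta>S \<psi>(1)]] by simp
        also have "\<dots> \<le> B * I * \<delta>" using \<eta>\<delta> B I by (intro mult_left_mono) auto
        also have "\<dots> < e" using e(1)
          by (simp only: \<delta>_def times_divide_eq_right pos_divide_less_eq[OF BI]) (simp add: algebra_simps)
        finally show "\<eta> \<in> {\<psi> \<in> schwartz_infty. regular_functional g \<psi> \<in> U}"
          using e(2) \<eta>S by (auto simp: dist_norm norm_minus_commute)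
      qed
      ultimately show "\<exists>T. openin schwartz_infty_topology T \<and> \<psi> \<in> T \<and> T \<subseteq> {\<psi> \<in> schwartz_infty. regular_functional g \<psi> \<in> U}"
        by blast
    qed
  qed auto
  then show ?thesis using add cm unfolding schwartz_infty_dual_def
    by (auto simp: regular_functional_def)
qed

lemma conv_regular_functional:
  assumes "admissible \<phi>"
  shows "conv (dilate \<phi> k) (regular_functional g) x = (\<integral>y. g y * dilate \<phi> k (x - y) \<partial>lborel)"
  using dilate_reflect_schwartz_infty[OF assms] by (simp add: conv_def regular_functional_def)

text \<open>Dilating and translating the test function shifts the frequency index by \<open>v\<close> and rescales space, so one set of
estimates serves all cubes.\<close>

lemma conv_dilated_test_function:
  fixes \<phi> f :: "real^'n::finite \<Rightarrow> complex"
  assumes \<phi>: "admissible \<phi>" and [measurable]: "f \<in> borel_measurable borel"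
  shows "conv (dilate \<phi> k) (regular_functional (\<lambda>y. f ((2 powi v) *\<^sub>R (y - z)))) x
    = (\<integral>u. f u * dilate \<phi> (k - v) ((2 powi v) *\<^sub>R (x - z) - u) \<partial>lborel)"
proof -
  have [measurable]: "\<phi> \<in> borel_measurable borel" by (intro schwartz_measurable admissible_schwartz \<phi>)
  define a where "a = (2::real) powi (- v)"
  have a: "0 < a" "2 powi v * a = 1" "a ^ CARD('n) = 2 powi (- v * int CARD('n))"
    unfolding a_def power_int_mult power_int_of_nat by (simp_all add: power_int_minus)
  have arg: "2 powi v *\<^sub>R ((z + a *\<^sub>R u) - z) = u" for u
    using a(2) by simp
  have step: "of_real (a ^ CARD('n)) * (f u * dilate \<phi> k (x - (z + a *\<^sub>R u)))
      = f u * dilate \<phi> (k - v) ((2 powi v) *\<^sub>R (x - z) - u)" for u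
  proof -
    have kv: "(2::real) powi (k - v) = 2 powi k * a" by (simp add: a_def power_int_diff power_int_minus divide_inverse)
    have "(2 powi (k - v)) *\<^sub>R ((2 powi v) *\<^sub>R (x - z) - u) = (2 powi k) *\<^sub>R (x - (z + a *\<^sub>R u))"
    proof -
      have p: "2 powi k * a * 2 powi v = 2 powi k" using a(2) by (simp only: mult.assoc mult.commute[of a] mult_1_right)
      show ?thesis unfolding kv
        by (simp only: scaleR_right_diff_distrib scaleR_right_distrib scaleR_scaleR p) simp
    qed
    moreover have "(2::real) powi ((k - v) * int CARD('n)) = a ^ CARD('n) * 2 powi (k * int CARD('n))"
      unfolding a(3) by (simp add: power_int_add[symmetric] left_diff_distrib)
    ultimately show ?thesis by (simp add: dilate_def)
  qed
  have "(\<integral>y. f ((2 powi v) *\<^sub>R (y - z)) * dilate \<phi> k (x - y) \<partial>lborel) = of_real (\<bar>a\<bar> ^ CARD('n)) *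
     (\<integral>u. f ((2 powi v) *\<^sub>R ((z + a *\<^sub>R u) - z)) * dilate \<phi> k (x - (z + a *\<^sub>R u)) \<partial>lborel)"
    by (rule integral_affine) (use a in \<open>auto simp: dilate_def\<close>)
  also have "\<dots> = (\<integral>u. of_real (a ^ CARD('n)) * (f u * dilate \<phi> k (x - (z + a *\<^sub>R u))) \<partial>lborel)"
    using a(1) by (simp only: arg abs_of_pos integral_mult_right_zero)
  also have "\<dots> = (\<integral>u. f u * dilate \<phi> (k - v) ((2 powi v) *\<^sub>R (x - z) - u) \<partial>lborel)"
    unfolding step ..
  finally show ?thesis by (simp add: conv_regular_functional[OF \<phi>])
qed

section \<open>A decaying function with localised spectrum\<close>

text \<open>Repetitions in \<open>L\<close> count as powers of the corresponding factor, so that each step of a list induction adds a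
single average over one direction.\<close>

definition taper :: "real \<Rightarrow> 'n::finite list \<Rightarrow> real^'n \<Rightarrow> real" where
  "taper \<epsilon> L y = prod_list (map (\<lambda>i. sinc (\<epsilon> * y $ i)) L)"

lemma taper_simps [simp]:
  "taper \<epsilon> [] y = 1" "taper \<epsilon> (i # L) y = sinc (\<epsilon> * y $ i) * taper \<epsilon> L y"
  "taper \<epsilon> (L @ L') y = taper \<epsilon> L y * taper \<epsilon> L' y"
  by (simp_all add: taper_def)

lemma taper_measurable [measurable]: "taper \<epsilon> L \<in> borel_measurable borel"
proof (induction L)
  case (Cons i L)
  have "(\<lambda>y. sinc (\<epsilon> * y $ i)) \<in> borel_measurable borel"
    by (rule measurable_compose[OF _ borel_measurable_sinc]) measurable
  then have "(\<lambda>y. sinc (\<epsilon> * y $ i) * taper \<epsilon> L y) \<in> borel_measurable borel"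
    using Cons.IH by (rule borel_measurable_times)
  then show ?case by (simp only: taper_simps(2)[abs_def] fun_eq_iff cong: measurable_cong)
qed (simp add: taper_def[abs_def])

lemma abs_sinc_le_1: "\<bar>sinc t\<bar> \<le> 1"
  using abs_sin_x_le_abs_x[of t] by (simp add: abs_divide divide_le_eq_1)

lemma abs_sinc_decay: "\<bar>sinc t\<bar> * (1 + \<bar>t\<bar>) \<le> 2"
proof (cases "t = 0")
  case False
  have "\<bar>sinc t\<bar> * \<bar>t\<bar> \<le> 1" using False by (simp add: abs_divide)
  then show ?thesis using abs_sinc_le_1[of t] by (simp add: distrib_left)
qed simp

lemma abs_taper_le_1: "\<bar>taper \<epsilon> L y\<bar> \<le> 1"
proof (induction L)
  case (Cons i L)
  then show ?case using mult_mono[OF abs_sinc_le_1[of "\<epsilon> * y $ i"] Cons.IH]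
    by (simp only: taper_simps abs_mult mult_1_left)
qed simp

lemma abs_taper_le_sinc: "i \<in> set L \<Longrightarrow> \<bar>taper \<epsilon> L y\<bar> \<le> \<bar>sinc (\<epsilon> * y $ i)\<bar>"
proof (induction L)
  case (Cons j L)
  show ?case
  proof (cases "i = j")
    case True
    have "\<bar>sinc (\<epsilon> * y $ i)\<bar> * \<bar>taper \<epsilon> L y\<bar> \<le> \<bar>sinc (\<epsilon> * y $ i)\<bar> * 1"
      by (rule mult_left_mono[OF abs_taper_le_1]) simp
    then show ?thesis using True by (simp only: taper_simps abs_mult mult_1_right)
  next
    case False
    then have "\<bar>sinc (\<epsilon> * y $ j)\<bar> * \<bar>taper \<epsilon> L y\<bar> \<le> 1 * \<bar>sinc (\<epsilon> * y $ i)\<bar>"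
      using Cons by (intro mult_mono abs_sinc_le_1) auto
    then show ?thesis by (simp only: taper_simps abs_mult mult_1_left)
  qed
qed simp

text \<open>Some coordinate carries at least the fraction \<open>1/n\<close> of the norm; its factor decays and the others are at most 1.\<close>

lemma taper_decay:
  fixes y :: "real^'n::finite"
  assumes \<epsilon>: "0 < \<epsilon>" "\<epsilon> \<le> 1" and L: "set L = UNIV"
  shows "\<bar>taper \<epsilon> L y\<bar> * (1 + norm y) \<le> 2 * CARD('n) / \<epsilon>"
proof -
  obtain i where i: "norm y \<le> CARD('n) * \<bar>y $ i\<bar>"
  proof (rule ccontr)
    assume "\<not> thesis"
    then have "\<not> norm y \<le> CARD('n) * \<bar>y $ i\<bar>" for i using that by blast
    then have "\<bar>y $ i\<bar> < norm y / CARD('n)" for i by (simp add: field_simps not_le)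
    then have "(\<Sum>i\<in>UNIV. \<bar>y $ i\<bar>) < (\<Sum>i\<in>(UNIV::'n set). norm y / CARD('n))"
      by (intro sum_strict_mono) auto
    then show False using norm_le_l1_cart[of y] by simp
  qed
  have n: "1 \<le> real CARD('n)" by (simp add: Suc_le_eq)
  have "\<epsilon> * (1 + norm y) \<le> CARD('n) * (1 + \<bar>\<epsilon> * y $ i\<bar>)"
  proof -
    have "\<epsilon> * 1 \<le> real CARD('n) * 1" using \<epsilon> n by linarith
    moreover have "\<epsilon> * norm y \<le> \<epsilon> * (CARD('n) * \<bar>y $ i\<bar>)" using \<epsilon> i by (intro mult_left_mono) auto
    ultimately have "\<epsilon> * (1 + norm y) \<le> real CARD('n) * 1 + \<epsilon> * (CARD('n) * \<bar>y $ i\<bar>)"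
      unfolding distrib_left by linarith
    also have "\<dots> = CARD('n) * (1 + \<bar>\<epsilon> * y $ i\<bar>)" using \<epsilon> by (simp add: abs_mult distrib_left)
    finally show ?thesis .
  qed
  then have "\<bar>taper \<epsilon> L y\<bar> * (\<epsilon> * (1 + norm y)) \<le> \<bar>sinc (\<epsilon> * y $ i)\<bar> * (CARD('n) * (1 + \<bar>\<epsilon> * y $ i\<bar>))"
    using \<epsilon> by (intro mult_mono[OF abs_taper_le_sinc]) (auto simp: L)
  also have "\<dots> = CARD('n) * (\<bar>sinc (\<epsilon> * y $ i)\<bar> * (1 + \<bar>\<epsilon> * y $ i\<bar>))" by (simp only: mult_ac)
  also have "\<dots> \<le> real CARD('n) * 2" by (intro mult_left_mono abs_sinc_decay) auto
  finally show ?thesis using \<epsilon> by (simp add: pos_le_divide_eq mult_ac)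
qed

lemma taper_power: "taper \<epsilon> (concat (replicate M L)) y = taper \<epsilon> L y ^ M"
  by (induction M) auto

lemma taper_tendsto:
  assumes "e \<longlonglongrightarrow> 0"
  shows "(\<lambda>k. taper (e k) L y) \<longlonglongrightarrow> 1"
proof (induction L)
  case (Cons i L)
  have "(\<lambda>k. e k * y $ i) \<longlonglongrightarrow> 0" using assms by (rule tendsto_mult_left_zero)
  then have "(\<lambda>k. sinc (e k * y $ i)) \<longlonglongrightarrow> sinc 0"
    by (rule isCont_tendsto_compose[OF isCont_sinc])
  from tendsto_mult[OF this Cons.IH] show ?case by (simp only: taper_simps) simp
qed simp

text \<open>By this identity, multiplication by a taper factor averages the Fourier transform over a segment.\<close>

lemma sinc_eq_integral:
  "(\<integral>s. indicator {-1..1} s *\<^sub>R exp (- \<i> * of_real (s * a)) \<partial>lborel) = 2 * of_real (sinc a)"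
proof (cases "a = 0")
  case True
  then show ?thesis using integral_FTC_atLeastAtMost[of "-1" 1 "\<lambda>s. complex_of_real s" "\<lambda>s. 1"]
    by (simp add: has_vector_derivative_def scaleR_conv_of_real)
next
  case False
  define F where "F s = exp (- \<i> * of_real (s * a)) / (- \<i> * of_real a)" for s :: real
  have "(F has_vector_derivative exp (- \<i> * of_real (s * a))) (at s within {-1..1})" for s
  proof -
    have "((\<lambda>z. exp (- \<i> * of_real a * z) / (- \<i> * of_real a)) has_field_derivative exp (- \<i> * of_real a * of_real s)) (at (of_real s))"
      using False by (auto intro!: derivative_eq_intros)
    then have "((\<lambda>s. exp (- \<i> * of_real a * of_real s) / (- \<i> * of_real a)) has_vector_derivative exp (- \<i> * of_real a * of_real s)) (at s within {-1..1})"
      by (rule has_vector_derivative_real_field)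
    then show ?thesis unfolding F_def by (simp add: mult_ac)
  qed
  then have "(\<integral>s. indicator {-1..1} s *\<^sub>R exp (- \<i> * of_real (s * a)) \<partial>lborel) = F 1 - F (-1)"
    by (intro integral_FTC_atLeastAtMost) (auto intro!: continuous_intros)
  also have "\<dots> = 2 * of_real (sin a / a)"
  proof -
    have s: "complex_of_real (sin a) = (exp (\<i> * of_real a) - exp (- (\<i> * of_real a))) / (2 * \<i>)"
      by (simp add: sin_of_real[symmetric] sin_exp_eq)
    have "F 1 - F (-1) = (exp (\<i> * of_real a) - exp (- (\<i> * of_real a))) / (\<i> * of_real a)"
      by (simp add: F_def diff_divide_distrib)
    also have "\<dots> = 2 * of_real (sin a / a)"
    proof -
      have gen: "2 * (D / (2 * \<i>) / z) = D / (\<i> * z)" for D z :: complex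
        using mult_divide_mult_cancel_left[of "2::complex" D "\<i> * z"]
        by (simp only: divide_divide_eq_left times_divide_eq_right mult.assoc) simp
      show ?thesis unfolding of_real_divide s by (rule gen[symmetric])
    qed
    finally show ?thesis .
  qed
  finally show ?thesis using False by simp
qed

text \<open>The Fourier transform of the product is the average of the Fourier transform of \<open>h\<close> over a segment of half-length
\<open>\<epsilon>\<close> in direction \<open>i\<close>. If the centre has distance less than \<open>r - \<epsilon>\<close> from \<open>\<xi>\<^sub>0\<close>, the segment stays in the
ball of radius \<open>r\<close>.\<close>

lemma spectrum_avoids_mult_sinc:
  fixes h :: "real^'n::finite \<Rightarrow> complex"
  assumes h: "integrable lborel h" and sp: "spectrum_avoids h \<xi>\<^sub>0 r" and \<epsilon>: "0 < \<epsilon>"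
  shows "spectrum_avoids (\<lambda>y. of_real (sinc (\<epsilon> * y $ i)) * h y) \<xi>\<^sub>0 (r - \<epsilon>)"
  unfolding spectrum_avoids_def
proof (intro allI impI)
  fix \<xi> assume \<xi>: "norm (\<xi> - \<xi>\<^sub>0) < r - \<epsilon>"
  have [measurable]: "h \<in> borel_measurable borel" using borel_measurable_integrable[OF h] by simp
  define f where "f s y = indicator {-1..1::real} s *\<^sub>R (plane_wave (\<xi> + (s * \<epsilon>) *\<^sub>R axis i 1) y * h y)" for s y
  have f_eq: "f s y = plane_wave \<xi> y * h y * (indicator {-1..1} s *\<^sub>R exp (- \<i> * of_real (s * (\<epsilon> * y $ i))))" for s y
    by (simp only: f_def plane_wave_add plane_wave_axis mult_ac scaleR_conv_of_real[where 'a=complex])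
  have [measurable]: "(\<lambda>y::real^'n. y $ i) \<in> borel_measurable borel"
    by (intro borel_measurable_continuous_onI continuous_intros)
  have fm: "case_prod f \<in> borel_measurable (lborel \<Otimes>\<^sub>M lborel)"
    unfolding f_eq plane_wave_def by measurable
  have nf: "norm (f s y) = indicator {-1..1} s * norm (h y)" for s y
    by (simp add: f_def norm_mult)
  have int: "integrable (lborel \<Otimes>\<^sub>M lborel) (case_prod f)"
  proof (rule lborel_pair.Fubini_integrable[OF fm])
    have "integrable lborel (\<lambda>s. (\<integral>y. norm (h y) \<partial>lborel) * indicator {-1..1::real} s)"
      by (intro integrable_mult_right) (auto simp: integrable_indicator_iff)
    then show "integrable lborel (\<lambda>s. \<integral>y. norm (case_prod f (s, y)) \<partial>lborel)"
      by (simp add: nf mult.commute)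
    have "integrable lborel (f s)" for s
    proof (rule Bochner_Integration.integrable_bound[OF integrable_norm[OF h]])
      show "f s \<in> borel_measurable lborel" unfolding f_def by measurable
      show "AE y in lborel. norm (f s y) \<le> norm (norm (h y))"
        by (auto simp: nf indicator_def)
    qed
    then show "AE s in lborel. integrable lborel (\<lambda>y. case_prod f (s, y))" by simp
  qed
  have "2 * (\<integral>y. plane_wave \<xi> y * (of_real (sinc (\<epsilon> * y $ i)) * h y) \<partial>lborel)
      = (\<integral>y. plane_wave \<xi> y * h y * (2 * of_real (sinc (\<epsilon> * y $ i))) \<partial>lborel)"
    unfolding integral_mult_right_zero[symmetric] by (intro Bochner_Integration.integral_cong refl) (simp only: mult_ac)
  also have "\<dots> = (\<integral>y. (\<integral>s. f s y \<partial>lborel) \<partial>lborel)"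
    unfolding f_eq integral_mult_right_zero sinc_eq_integral ..
  also have "\<dots> = (\<integral>s. (\<integral>y. f s y \<partial>lborel) \<partial>lborel)"
    by (rule lborel_pair.Fubini_integral[OF int])
  also have "\<dots> = 0"
  proof -
    have "(\<integral>y. f s y \<partial>lborel) = 0" for s
    proof (cases "s \<in> {-1..1}")
      case True
      have "norm (\<xi> + (s * \<epsilon>) *\<^sub>R axis i 1 - \<xi>\<^sub>0) \<le> norm (\<xi> - \<xi>\<^sub>0) + norm ((s * \<epsilon>) *\<^sub>R (axis i 1 :: real^'n))"
        using norm_triangle_ineq[of "\<xi> - \<xi>\<^sub>0" "(s * \<epsilon>) *\<^sub>R axis i 1"] by (simp add: algebra_simps)
      moreover have "norm ((s * \<epsilon>) *\<^sub>R (axis i 1 :: real^'n)) \<le> \<epsilon>"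
        using True \<epsilon> by (simp add: abs_mult abs_le_iff)
      ultimately have "norm (\<xi> + (s * \<epsilon>) *\<^sub>R axis i 1 - \<xi>\<^sub>0) < r" using \<xi> by linarith
      then show ?thesis using sp by (simp add: f_def spectrum_avoids_def)
    qed (simp add: f_def)
    then show ?thesis by simp
  qed
  finally show "(\<integral>y. plane_wave \<xi> y * (of_real (sinc (\<epsilon> * y $ i)) * h y) \<partial>lborel) = 0" by simp
qed

lemma spectrum_avoids_taper:
  fixes h :: "real^'n::finite \<Rightarrow> complex"
  assumes h: "integrable lborel h" and sp: "spectrum_avoids h \<xi>\<^sub>0 r" and \<epsilon>: "0 < \<epsilon>"
  shows "spectrum_avoids (\<lambda>y. of_real (taper \<epsilon> L y) * h y) \<xi>\<^sub>0 (r - \<epsilon> * length L)"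
proof (induction L)
  case Nil
  then show ?case using sp by simp
next
  case (Cons i L)
  have [measurable]: "h \<in> borel_measurable borel" using borel_measurable_integrable[OF h] by simp
  have "integrable lborel (\<lambda>y. of_real (taper \<epsilon> L y) * h y)"
  proof (rule Bochner_Integration.integrable_bound[OF integrable_norm[OF h]])
    show "(\<lambda>y. of_real (taper \<epsilon> L y) * h y) \<in> borel_measurable lborel" by measurable
    show "AE y in lborel. norm (of_real (taper \<epsilon> L y) * h y) \<le> norm (norm (h y))"
      by (intro AE_I2) (simp add: norm_mult mult_left_le_one_le abs_taper_le_1)
  qed
  from spectrum_avoids_mult_sinc[OF this Cons.IH \<epsilon>, of i]
  show ?case by (simp only: taper_simps of_real_mult mult.assoc) (simp add: algebra_simps)
qed

lemma one_add_norm_power_le: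
  fixes x y :: "'a::real_normed_vector"
  shows "(1 + norm x) ^ M \<le> (1 + norm (x - y)) ^ M * (1 + norm y) ^ M"
proof -
  have "norm x \<le> norm (x - y) + norm y" using norm_triangle_ineq[of "x - y" y] by simp
  also have "\<dots> \<le> norm (x - y) + norm y + norm (x - y) * norm y" by simp
  finally have "1 + norm x \<le> (1 + norm (x - y)) * (1 + norm y)" by (simp add: algebra_simps)
  then show ?thesis unfolding power_mult_distrib[symmetric] by (rule power_mono) simp
qed

text \<open>Take a plane wave of frequency \<open>\<omega>\<close> with \<open>|\<omega>| = 1\<close> and taper it at least \<open>M + n + 1\<close> times in every direction. The first part of this
order of decay survives the convolution, the remaining \<open>n + 1\<close> make the convolution integral converge. As the
tapering parameter tends to 0, the value at 0 of the convolution with \<open>\<phi>\<close> tends to that of the pure plane wave,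
a nonzero multiple of the Fourier transform of \<open>\<phi>\<close> at \<open>-\<omega>\<close>; so it is nonzero for some small parameter.\<close>

lemma test_function_exists:
  fixes \<phi> :: "real^'n::finite \<Rightarrow> complex" and M :: nat
  assumes \<phi>: "admissible \<phi>"
  obtains f B c \<delta> C where "f \<in> borel_measurable borel" "\<And>x. norm (f x) \<le> B" "0 < c" "0 < \<delta>" "0 < C"
    "\<And>l x. 2 \<le> \<bar>l\<bar> \<Longrightarrow> (\<integral>u. f u * dilate \<phi> l (x - u) \<partial>lborel) = 0"
    "\<And>l x. norm (\<integral>u. f u * dilate \<phi> l (x - u) \<partial>lborel) \<le> C * (1 + norm x) powr (- real M)"
    "\<And>x. norm x < \<delta> \<Longrightarrow> c \<le> norm (\<integral>u. f u * dilate \<phi> 0 (x - u) \<partial>lborel)"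
proof -
  have [measurable]: "\<phi> \<in> borel_measurable borel" by (intro schwartz_measurable admissible_schwartz \<phi>)
  have rd: "rapidly_decaying (\<lambda>u. dilate \<phi> l (x - u))" for l x
    by (rule schwartz_rapidly_decaying[OF dilate_reflect_schwartz[OF \<phi>]])
  note hint = rapidly_decaying_integrable[OF rd]
  obtain L0 :: "'n list" where L0: "set L0 = UNIV" using finite_list[OF finite] by blast
  define N where "N = CARD('n) + 1"
  define L where "L = concat (replicate (M + N) L0)"
  obtain i0 :: 'n where True by blast
  define \<omega> :: "real^'n" where "\<omega> = axis i0 1"
  have \<omega>: "norm \<omega> = 1" by (simp add: \<omega>_def)
  \<comment> \<open>Small enough for all averages together to move frequencies by less than \<open>1/10\<close>.\<close>
  define e where "e k = 1 / (10 * (real (length L) + 1)) * inverse (real (Suc k))" for k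
  have e0: "e \<longlonglongrightarrow> 0" unfolding e_def
    by (intro tendsto_mult_right_zero LIMSEQ_inverse_real_of_nat)
  have e: "0 < e k" "e k \<le> 1" "e k * length L < 1/10" for k
  proof -
    show "0 < e k" by (simp add: e_def)
    have i: "inverse (real (Suc k)) \<le> 1" by (simp add: inverse_le_1_iff)
    have le: "e k \<le> 1 / (10 * (real (length L) + 1)) * 1"
      unfolding e_def by (rule mult_left_mono[OF i]) simp
    then show "e k \<le> 1" by (rule order_trans) (simp add: field_simps)
    have "e k * length L \<le> 1 / (10 * (real (length L) + 1)) * 1 * length L"
      by (rule mult_right_mono[OF le]) simp
    also have "\<dots> < 1/10" by (simp add: field_simps)
    finally show "e k * length L < 1/10" .
  qed
  define F where "F k y = plane_wave \<omega> y * of_real (taper (e k) L y)" for k y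
  have Fm: "F k \<in> borel_measurable borel" for k unfolding F_def by measurable
  have F1: "norm (F k y) \<le> 1" for k y by (simp add: F_def norm_mult abs_taper_le_1)
  have lim: "(\<lambda>k. \<integral>u. F k u * dilate \<phi> 0 (0 - u) \<partial>lborel) \<longlonglongrightarrow> (\<integral>u. plane_wave \<omega> u * dilate \<phi> 0 (0 - u) \<partial>lborel)"
  proof (rule integral_dominated_convergence)
    show "integrable lborel (\<lambda>u. norm (dilate \<phi> 0 (0 - u)))" by (rule integrable_norm[OF hint])
    show "(\<lambda>u. F k u * dilate \<phi> 0 (0 - u)) \<in> borel_measurable lborel" for k
      using Fm by (simp add: dilate_def)
    show "(\<lambda>u. plane_wave \<omega> u * dilate \<phi> 0 (0 - u)) \<in> borel_measurable lborel"
      by (simp add: dilate_def)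
    show "AE u in lborel. norm (F k u * dilate \<phi> 0 (0 - u)) \<le> norm (dilate \<phi> 0 (0 - u))" for k
      by (intro AE_I2) (simp only: norm_mult mult_left_le_one_le F1 norm_ge_zero)
    show "AE u in lborel. (\<lambda>k. F k u * dilate \<phi> 0 (0 - u)) \<longlonglongrightarrow> plane_wave \<omega> u * dilate \<phi> 0 (0 - u)"
    proof (rule AE_I2)
      fix u
      have "(\<lambda>k. plane_wave \<omega> u * of_real (taper (e k) L u) * dilate \<phi> 0 (0 - u))
          \<longlonglongrightarrow> plane_wave \<omega> u * of_real 1 * dilate \<phi> 0 (0 - u)"
        by (intro tendsto_mult tendsto_const tendsto_of_real taper_tendsto e0)
      then show "(\<lambda>k. F k u * dilate \<phi> 0 (0 - u)) \<longlonglongrightarrow> plane_wave \<omega> u * dilate \<phi> 0 (0 - u)"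
        by (simp add: F_def)
    qed
  qed
  have "(\<integral>u. plane_wave \<omega> u * dilate \<phi> 0 (0 - u) \<partial>lborel) \<noteq> 0"
  proof -
    obtain c where c: "c \<noteq> 0" "(\<integral>u. plane_wave \<omega> u * dilate \<phi> 0 (0 - u) \<partial>lborel)
        = c * (\<integral>u. plane_wave (- (2 powi (- 0)) *\<^sub>R \<omega>) u * \<phi> u \<partial>lborel)"
      using plane_wave_dilate_reflect[OF \<phi>, of \<omega> 0 0] by blast
    obtain d where d: "0 < d" "\<And>\<xi>. 3/5 \<le> norm \<xi> \<Longrightarrow> norm \<xi> \<le> 5/3 \<Longrightarrow> d \<le> norm (fourier \<phi> \<xi>)"
      using \<phi> unfolding admissible_def by blast
    have "d \<le> norm (fourier \<phi> (- (2 powi (- 0)) *\<^sub>R \<omega>))" by (rule d(2)) (simp_all add: \<omega>)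
    then have "fourier \<phi> (- (2 powi (- 0)) *\<^sub>R \<omega>) \<noteq> 0" using d(1) by auto
    then show ?thesis using c by (simp add: fourier_zero_iff)
  qed
  from tendsto_imp_eventually_ne[OF lim this]
  obtain k where k: "(\<integral>u. F k u * dilate \<phi> 0 (0 - u) \<partial>lborel) \<noteq> 0"
    unfolding eventually_sequentially by blast
  define \<epsilon> where "\<epsilon> = e k"
  note \<epsilon> = e[of k, folded \<epsilon>_def]
  define f where "f = F k"
  have f: "f y = plane_wave \<omega> y * of_real (taper \<epsilon> L y)" for y by (simp add: f_def F_def \<epsilon>_def)
  have fm[measurable]: "f \<in> borel_measurable borel" and f1: "norm (f y) \<le> 1" for y
    using Fm F1 by (auto simp: f_def)
  define G where "G l x = (\<integral>u. f u * dilate \<phi> l (x - u) \<partial>lborel)" for l x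
  have zero: "G l x = 0" if l: "2 \<le> \<bar>l\<bar>" for l x
  proof -
    \<comment> \<open>The annulus \<open>9/10 < |\<xi>| < 11/10\<close> misses the spectrum of \<open>\<phi>\<^sub>l\<close> when \<open>|l| \<ge> 2\<close>.\<close>
    have "spectrum_avoids (\<lambda>u. dilate \<phi> l (x - u)) \<omega> (1/10)"
    proof (rule dilate_reflect_spectrum[OF \<phi>])
      fix \<xi> assume "norm (\<xi> - \<omega>) < 1/10"
      then have \<xi>: "9/10 < norm \<xi>" "norm \<xi> < 11/10"
        using norm_triangle_ineq2[of \<omega> \<xi>] norm_triangle_ineq2[of \<xi> \<omega>] \<omega> by (auto simp: norm_minus_commute)
      show "norm \<xi> < 2 powi l / 2 \<or> 2 * 2 powi l < norm \<xi>"
      proof (cases "2 \<le> l")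
        case True
        have "(2::real) powi 2 \<le> 2 powi l" by (rule power_int_increasing[OF True]) simp
        then show ?thesis using \<xi> by simp
      next
        case False
        then have "l \<le> -2" using l by simp
        then have "(2::real) powi l \<le> 2 powi (-2)" by (rule power_int_increasing) simp
        then show ?thesis using \<xi> by (simp add: power_int_minus)
      qed
    qed
    from spectrum_avoids_taper[OF hint this \<epsilon>(1), of L]
    have "(\<integral>u. plane_wave \<omega> u * (of_real (taper \<epsilon> L u) * dilate \<phi> l (x - u)) \<partial>lborel) = 0"
      using \<epsilon>(3) by (simp add: spectrum_avoids_def)
    then show ?thesis by (simp add: G_def f mult.assoc)
  qed
  define K where "K = (2 * CARD('n) / \<epsilon>) ^ (M + N)"
  have K: "0 < K" using \<epsilon>(1) by (simp add: K_def)
  have fdec: "norm (f y) * (1 + norm y) ^ (M + N) \<le> K" for y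
  proof -
    have "norm (f y) * (1 + norm y) ^ (M + N) = (\<bar>taper \<epsilon> L0 y\<bar> * (1 + norm y)) ^ (M + N)"
      by (simp add: f norm_mult L_def taper_power norm_power power_abs power_mult_distrib)
    also have "\<dots> \<le> K" unfolding K_def
      by (rule power_mono[OF taper_decay[OF \<epsilon>(1,2) L0]]) simp
    finally show ?thesis .
  qed
  define I where "I = (\<integral>(x::real^'n). inverse ((1 + norm x) ^ N) \<partial>lborel)"
  have I: "0 \<le> I" unfolding I_def by (rule integral_nonneg_AE) (auto simp: add_nonneg_nonneg)
  have "\<exists>D\<ge>0. \<forall>u. (1 + norm u) ^ M * norm (dilate \<phi> l u) \<le> D" for l
  proof -
    obtain D where D: "0 \<le> D" "\<And>u. (1 + norm u) ^ M * norm (dilate \<phi> l (0 - u)) \<le> D"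
      using rapidly_decayingE[OF rd[of l 0], of M] by blast
    have "(1 + norm u) ^ M * norm (dilate \<phi> l u) \<le> D" for u
      using D(2)[of "- u"] by simp
    then show ?thesis using D(1) by blast
  qed
  then obtain D where D: "\<And>l. 0 \<le> D l" "\<And>l u. (1 + norm u) ^ M * norm (dilate \<phi> l u) \<le> D l" by metis
  have fhint: "integrable lborel (\<lambda>u. f u * dilate \<phi> l (x - u))" for l x
    by (rule rapidly_decaying_integrable[OF rapidly_decaying_mult_bounded[OF rd fm f1]])
  have Gdec: "norm (G l x) \<le> K * D l * I * inverse ((1 + norm x) ^ M)" for l x
  proof -
    have px: "0 < (1 + norm z) ^ m" for z :: "real^'n" and m by (intro zero_less_power) (simp add: add_pos_nonneg)
    have "norm (G l x) \<le> (\<integral>(y::real^'n). K * D l * inverse ((1 + norm x) ^ M) * inverse ((1 + norm y) ^ N) \<partial>lborel)"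
      unfolding G_def
    proof (rule Bochner_Integration.integral_norm_bound_integral[OF fhint])
      show "integrable lborel (\<lambda>y::real^'n. K * D l * inverse ((1 + norm x) ^ M) * inverse ((1 + norm y) ^ N))"
        unfolding N_def by (intro integrable_mult_right integrable_decay)
      fix y :: "real^'n"
      have "(1 + norm x) ^ M * norm (f y * dilate \<phi> l (x - y)) * (1 + norm y) ^ N
          \<le> ((1 + norm (x - y)) ^ M * (1 + norm y) ^ M) * norm (f y * dilate \<phi> l (x - y)) * (1 + norm y) ^ N"
        by (intro mult_right_mono one_add_norm_power_le) auto
      also have "\<dots> = (norm (f y) * (1 + norm y) ^ (M + N)) * ((1 + norm (x - y)) ^ M * norm (dilate \<phi> l (x - y)))"
        by (simp add: norm_mult power_add mult_ac)
      also have "\<dots> \<le> K * D l"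
        using fdec D K by (intro mult_mono) auto
      finally have "norm (f y * dilate \<phi> l (x - y)) * ((1 + norm x) ^ M * (1 + norm y) ^ N) \<le> K * D l"
        by (simp only: mult_ac)
      then have "norm (f y * dilate \<phi> l (x - y)) \<le> K * D l / ((1 + norm x) ^ M * (1 + norm y) ^ N)"
        using px by (subst pos_le_divide_eq) auto
      then show "norm (f y * dilate \<phi> l (x - y)) \<le> K * D l * inverse ((1 + norm x) ^ M) * inverse ((1 + norm y) ^ N)"
        by (simp add: divide_inverse mult.assoc)
    qed
    also have "\<dots> = K * D l * I * inverse ((1 + norm x) ^ M)"
      unfolding I_def by (subst integral_mult_right_zero) (simp only: mult_ac)
    finally show ?thesis .
  qed
  define C where "C = K * (D (-1) + D 0 + D 1) * I + 1"
  have C: "0 < C" using K D(1) I by (simp add: C_def add_nonneg_pos)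
  have bound: "norm (G l x) \<le> C * (1 + norm x) powr (- real M)" for l x
  proof -
    have pw: "(1 + norm x) powr (- real M) = inverse ((1 + norm x) ^ M)"
      by (subst powr_minus, subst powr_realpow) (auto simp: add_pos_nonneg)
    show ?thesis
    proof (cases "2 \<le> \<bar>l\<bar>")
      case True
      then show ?thesis using C by (simp add: zero)
    next
      case False
      then have "l = -1 \<or> l = 0 \<or> l = 1" by auto
      then have "D l \<le> D (-1) + D 0 + D 1" using D(1)[of "-1"] D(1)[of 0] D(1)[of 1] by auto
      then have "K * D l * I \<le> K * (D (-1) + D 0 + D 1) * I"
        using K I by (intro mult_right_mono mult_left_mono) auto
      then have "K * D l * I * inverse ((1 + norm x) ^ M) \<le> C * inverse ((1 + norm x) ^ M)"
        unfolding C_def by (intro mult_right_mono) (auto simp: add_nonneg_nonneg)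
      then show ?thesis using Gdec[of l x] unfolding pw by linarith
    qed
  qed
  have fint: "integrable lborel f"
  proof (rule integrable_of_decay[OF fm])
    fix y :: "real^'n"
    have "norm (f y) * (1 + norm y) ^ N \<le> norm (f y) * (1 + norm y) ^ (M + N)"
      by (intro mult_left_mono power_increasing) auto
    then show "(1 + norm y) ^ (CARD('n) + 1) * norm (f y) \<le> K"
      using fdec[of y] unfolding N_def by (simp add: mult.commute del: power_Suc)
  qed
  obtain E where E: "\<And>u. norm (dilate \<phi> 0 (0 - u)) \<le> E"
    using rapidly_decayingE[OF rd[of 0 0], of 0] by auto
  have E': "norm (dilate \<phi> 0 u) \<le> E" for u using E[of "- u"] by simp
  have "continuous (at 0) (G 0)"
    unfolding continuous_at_sequentially
  proof (intro allI impI)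
    fix X :: "nat \<Rightarrow> real^'n" assume X: "X \<longlonglongrightarrow> 0"
    show "(G 0 \<circ> X) \<longlonglongrightarrow> G 0 0"
      unfolding comp_def G_def
    proof (rule integral_dominated_convergence)
      show "integrable lborel (\<lambda>u. norm (f u) * E)" using fint by (intro integrable_mult_left integrable_norm)
      show "(\<lambda>u. f u * dilate \<phi> 0 (X k - u)) \<in> borel_measurable lborel" for k by (simp add: dilate_def)
      show "(\<lambda>u. f u * dilate \<phi> 0 (0 - u)) \<in> borel_measurable lborel" by (simp add: dilate_def)
      show "AE u in lborel. norm (f u * dilate \<phi> 0 (X k - u)) \<le> norm (f u) * E" for k
        by (intro AE_I2) (simp only: norm_mult mult_left_mono[OF E'] norm_ge_zero)
      show "AE u in lborel. (\<lambda>k. f u * dilate \<phi> 0 (X k - u)) \<longlonglongrightarrow> f u * dilate \<phi> 0 (0 - u)"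
      proof (rule AE_I2)
        fix u :: "real^'n"
        have "isCont \<phi> (2 powi 0 *\<^sub>R (0 - u))"
          using schwartz_continuous[OF admissible_schwartz[OF \<phi>]] by (simp add: continuous_on_eq_continuous_at)
        moreover have "(\<lambda>k. 2 powi 0 *\<^sub>R (X k - u)) \<longlonglongrightarrow> 2 powi 0 *\<^sub>R (0 - u)"
          by (intro tendsto_intros X)
        ultimately have "(\<lambda>k. \<phi> (2 powi 0 *\<^sub>R (X k - u))) \<longlonglongrightarrow> \<phi> (2 powi 0 *\<^sub>R (0 - u))"
          by (rule isCont_tendsto_compose)
        then show "(\<lambda>k. f u * dilate \<phi> 0 (X k - u)) \<longlonglongrightarrow> f u * dilate \<phi> 0 (0 - u)"
          unfolding dilate_def by (intro tendsto_mult tendsto_const)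
      qed
    qed
  qed
  moreover have G0: "G 0 0 \<noteq> 0" using k by (simp add: G_def f_def)
  ultimately obtain \<delta> where \<delta>: "0 < \<delta>" "\<And>x. dist x 0 < \<delta> \<Longrightarrow> dist (G 0 x) (G 0 0) < norm (G 0 0) / 2"
    unfolding continuous_at_eps_delta by (metis half_gt_zero zero_less_norm_iff)
  have low: "norm (G 0 0) / 2 \<le> norm (G 0 x)" if "norm x < \<delta>" for x
    using \<delta>(2)[of x] that norm_triangle_ineq2[of "G 0 0" "G 0 x"] by (simp add: dist_norm norm_minus_commute)
  show thesis
    by (rule that[of f 1 "norm (G 0 0) / 2" \<delta> C])
      (use fm f1 \<delta>(1) C zero bound low G0 in \<open>auto simp: G_def\<close>)
qed

section \<open>Quasi-norms of the test functionals\<close>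

text \<open>Pointwise, each of the three nonzero terms is at most \<open>C t(x) (1 + |x - z|/l)\<^bsup>-M\<^esup>\<close>. By doubling, \<open>t\<^sup>p\<close> has growth
exponent \<open>n r\<close> over the dilates of a cube, so \<open>nn_integral_tail_le\<close> applies as soon as \<open>M p \<ge> n r + 1\<close>.\<close>

lemma test_functional_qnorm_upper:
  fixes \<phi> f :: "real^'n::finite \<Rightarrow> complex" and C r :: real and M :: nat
  assumes \<phi>: "admissible \<phi>" and p: "0 < p" and q: "0 < q"
    and f: "f \<in> borel_measurable borel" and C: "0 < C"
    and zero: "\<And>l x. 2 \<le> \<bar>l\<bar> \<Longrightarrow> (\<integral>u. f u * dilate \<phi> l (x - u) \<partial>lborel) = 0"
    and bound: "\<And>l x. norm (\<integral>u. f u * dilate \<phi> l (x - u) \<partial>lborel) \<le> C * (1 + norm x) powr (- real M)"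
    and t: "weight t" and A: "(\<lambda>x. t x powr p) \<in> muckenhoupt r" and r: "1 < r" and M: "CARD('n) * r + 1 \<le> real M * p"
  shows "\<exists>c>0. \<forall>v z. qnorm A \<phi> p q t (regular_functional (\<lambda>y. f ((2 powi v) *\<^sub>R (y - z))))
      \<le> ennreal c * ennpowr (\<integral>\<^sup>+x\<in>cube z (2 powi (- v)). ennreal (t x powr p) \<partial>lebesgue) (1 / p)"
proof -
  obtain K where K: "0 < K" and dbl: "\<And>a b l1 l2. 0 < l1 \<Longrightarrow> 0 < l2 \<Longrightarrow> cube b l1 \<subseteq> cube a l2 \<Longrightarrow>
      (\<integral>\<^sup>+x\<in>cube a l2. ennreal (t x powr p) \<partial>lebesgue)
        \<le> ennreal (K * (l2 / l1) powr (CARD('n) * r)) * (\<integral>\<^sup>+x\<in>cube b l1. ennreal (t x powr p) \<partial>lebesgue)"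
    using muckenhoupt_doubling[OF A r] by blast
  have nn: "0 \<le> t x" for x using t by (simp add: weight_def)
  have [measurable]: "t \<in> borel_measurable lebesgue" using t by (rule weight_measurable)
  define d where "d = real CARD('n) * r"
  define K1 where "K1 = 2 powr (real M * p + 1) * (K * 2 powr d)"
  have K1: "0 < K1" using K by (simp add: K1_def)
  have "qnorm A \<phi> p q t (regular_functional (\<lambda>y. f ((2 powi v) *\<^sub>R (y - z))))
      \<le> ennreal (lq3 q * (C * K1 powr (1 / p))) * ennpowr (\<integral>\<^sup>+x\<in>cube z (2 powi (- v)). ennreal (t x powr p) \<partial>lebesgue) (1 / p)"
    for v z
  proof -
    define l where "l = (2::real) powi (- v)"
    have l: "0 < l" by (simp add: l_def)
    define W where "W = (\<integral>\<^sup>+x\<in>cube z l. ennreal (t x powr p) \<partial>lebesgue)"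
    define T where "T = regular_functional (\<lambda>y. f ((2 powi v) *\<^sub>R (y - z)))"
    define b where "b x = (1 + norm (x - z) / l) powr (- real M)" for x
    have nv: "norm ((2 powi v) *\<^sub>R (x - z)) = norm (x - z) / l" for x
      by (simp add: l_def power_int_minus divide_inverse mult.commute)
    have cz: "conv (dilate \<phi> k) T x = 0" if "2 \<le> \<bar>k - v\<bar>" for k x
      unfolding T_def conv_dilated_test_function[OF \<phi> f] using that by (rule zero)
    have cb: "norm (conv (dilate \<phi> k) T x) \<le> C * b x" for k x
      unfolding T_def conv_dilated_test_function[OF \<phi> f] b_def using bound[of "k - v" "(2 powi v) *\<^sub>R (x - z)"] unfolding nv .
    define g where "g x = ennreal C * ennreal (t x * b x)" for x
    have cg: "ennreal (t x * norm (conv (dilate \<phi> k) T x)) \<le> g x" for k x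
    proof -
      have "t x * norm (conv (dilate \<phi> k) T x) \<le> C * (t x * b x)"
        using mult_left_mono[OF cb nn] by (simp add: mult.left_commute)
      then show ?thesis unfolding g_def using C nn
        by (subst ennreal_mult[symmetric]) (auto simp: b_def intro: ennreal_leI)
    qed
    have "qnorm A \<phi> p q t T \<le> ennreal (lq3 q) * Lp_qnorm p g"
    proof (cases A)
      case Besov
      have "lq_qnorm q (\<lambda>k. Lp_qnorm p (\<lambda>x. ennreal (t x * norm (conv (dilate \<phi> k) T x)))) \<le> ennreal (lq3 q) * Lp_qnorm p g"
      proof (rule lq_qnorm_three_terms[OF q])
        show "Lp_qnorm p (\<lambda>x. ennreal (t x * norm (conv (dilate \<phi> k) T x))) \<le> Lp_qnorm p g" for k
          using cg by (intro Lp_qnorm_mono_AE p AE_I2)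
        show "Lp_qnorm p (\<lambda>x. ennreal (t x * norm (conv (dilate \<phi> k) T x))) = 0" if "2 \<le> \<bar>k - v\<bar>" for k
          using that by (simp add: cz Lp_qnorm_def ennpowr_zero)
      qed
      then show ?thesis using Besov by simp
    next
      case Triebel_Lizorkin
      have "lq_qnorm q (\<lambda>k. ennreal (t x * norm (conv (dilate \<phi> k) T x))) \<le> ennreal (lq3 q) * g x" for x
        by (rule lq_qnorm_three_terms[OF q, of v]) (use cg cz in auto)
      then have "Lp_qnorm p (\<lambda>x. lq_qnorm q (\<lambda>k. ennreal (t x * norm (conv (dilate \<phi> k) T x)))) \<le> Lp_qnorm p (\<lambda>x. ennreal (lq3 q) * g x)"
        by (intro Lp_qnorm_mono_AE p AE_I2)
      also have "\<dots> \<le> ennreal (lq3 q) * Lp_qnorm p g" by (rule Lp_qnorm_cmult_le[OF p lq3_pos])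
      finally show ?thesis using Triebel_Lizorkin by simp
    qed
    also have "Lp_qnorm p g \<le> ennreal C * Lp_qnorm p (\<lambda>x. ennreal (t x * b x))"
      unfolding g_def by (rule Lp_qnorm_cmult_le[OF p C])
    also have "Lp_qnorm p (\<lambda>x. ennreal (t x * b x)) \<le> ennpowr (ennreal K1 * W) (1 / p)"
    proof -
      have eq: "ennpowr (ennreal (t x * b x)) p = ennreal (t x powr p) * ennreal ((1 + norm (x - z) / l) powr (- (real M * p)))" for x
      proof -
        have b: "0 \<le> b x" by (simp add: b_def)
        have "ennpowr (ennreal (t x * b x)) p = ennreal ((t x * b x) powr p)"
          using nn[of x] b by (intro ennpowr_ennreal) simp
        also have "(t x * b x) powr p = t x powr p * (1 + norm (x - z) / l) powr (- (real M * p))"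
          using nn[of x] b unfolding b_def by (simp only: powr_mult powr_powr mult_minus_left)
        finally show ?thesis by (simp only: ennreal_mult powr_ge_zero)
      qed
      have "(\<integral>\<^sup>+x. ennpowr (ennreal (t x * b x)) p \<partial>lebesgue) \<le> ennreal K1 * W"
        unfolding eq K1_def
      proof (rule nn_integral_tail_le)
        show "d + 1 \<le> real M * p" using M by (simp add: d_def)
        show "0 \<le> d" using r by (simp add: d_def)
        show "0 \<le> K * 2 powr d" using K by simp
        fix k :: nat
        have "cube z l \<subseteq> cube (z - (\<chi> i. l * 2 ^ k)) (2 * (l * 2 ^ k))"
        proof
          fix x assume x: "x \<in> cube z l"
          define m where "m = l * 2 ^ k"
          have "l * 1 \<le> m" unfolding m_def using l by (intro mult_left_mono) auto
          then have "z $ i - m \<le> x $ i \<and> x $ i \<le> z $ i - m + 2 * m" for i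
            using x[unfolded mem_cube, rule_format, of i] l by linarith
          then show "x \<in> cube (z - (\<chi> i. l * 2 ^ k)) (2 * (l * 2 ^ k))"
            unfolding mem_cube m_def[symmetric] by simp
        qed
        then have "(\<integral>\<^sup>+x\<in>cube (z - (\<chi> i. l * 2 ^ k)) (2 * (l * 2 ^ k)). ennreal (t x powr p) \<partial>lebesgue)
            \<le> ennreal (K * (2 * (l * 2 ^ k) / l) powr (CARD('n) * r)) * W"
          unfolding W_def using l by (intro dbl) auto
        also have "(2 * (l * 2 ^ k) / l) powr (CARD('n) * r) = 2 powr d * 2 powr (d * k)"
          using l by (simp add: d_def powr_mult powr_powr mult.commute flip: powr_realpow)
        finally show "(\<integral>\<^sup>+x\<in>cube (z - (\<chi> i. l * 2 ^ k)) (2 * (l * 2 ^ k)). ennreal (t x powr p) \<partial>lebesgue)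
            \<le> ennreal (K * 2 powr d * 2 powr (d * k)) * W" by (simp add: mult.assoc)
      qed (use l in measurable)
      then show ?thesis unfolding Lp_qnorm_def using p by (intro ennpowr_mono) auto
    qed
    also have "ennpowr (ennreal K1 * W) (1 / p) = ennreal (K1 powr (1 / p)) * ennpowr W (1 / p)"
      using K1 p by (simp add: ennpowr_cmult)
    finally have "qnorm A \<phi> p q t T \<le> ennreal (lq3 q) * (ennreal C * (ennreal (K1 powr (1 / p)) * ennpowr W (1 / p)))"
      by (simp add: mult_left_mono)
    also have "\<dots> = ennreal (lq3 q * (C * K1 powr (1 / p))) * ennpowr W (1 / p)"
      using C lq3_pos[of q] by (simp add: ennreal_mult mult.assoc)
    finally show ?thesis unfolding T_def W_def l_def .
  qed
  moreover have "0 < lq3 q * (C * K1 powr (1 / p))" using lq3_pos C K1 by simp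
  ultimately show ?thesis by blast
qed

text \<open>The term with index \<open>v\<close> is at least \<open>c t(x)\<close> on a cube with the same corner and a fixed fraction of the side;
by doubling this small cube carries a fixed fraction of the mass.\<close>

lemma test_functional_qnorm_lower:
  fixes \<phi> f :: "real^'n::finite \<Rightarrow> complex" and r :: real
  assumes \<phi>: "admissible \<phi>" and p: "0 < p" and q: "0 < q"
    and f: "f \<in> borel_measurable borel" and c: "0 < c" and \<delta>: "0 < \<delta>"
    and low: "\<And>x. norm x < \<delta> \<Longrightarrow> c \<le> norm (\<integral>u. f u * dilate \<phi> 0 (x - u) \<partial>lborel)"
    and t: "weight t" and A: "(\<lambda>x. t x powr p) \<in> muckenhoupt r" and r: "1 < r"
  shows "\<exists>c>0. \<forall>v z. ennpowr (\<integral>\<^sup>+x\<in>cube z (2 powi (- v)). ennreal (t x powr p) \<partial>lebesgue) (1 / p)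
      \<le> ennreal c * qnorm A \<phi> p q t (regular_functional (\<lambda>y. f ((2 powi v) *\<^sub>R (y - z))))"
proof -
  obtain K where K: "0 < K" and dbl: "\<And>a b l1 l2. 0 < l1 \<Longrightarrow> 0 < l2 \<Longrightarrow> cube b l1 \<subseteq> cube a l2 \<Longrightarrow>
      (\<integral>\<^sup>+x\<in>cube a l2. ennreal (t x powr p) \<partial>lebesgue)
        \<le> ennreal (K * (l2 / l1) powr (CARD('n) * r)) * (\<integral>\<^sup>+x\<in>cube b l1. ennreal (t x powr p) \<partial>lebesgue)"
    using muckenhoupt_doubling[OF A r] by blast
  have nn: "0 \<le> t x" for x using t by (simp add: weight_def)
  have [measurable]: "t \<in> borel_measurable lebesgue" using t by (rule weight_measurable)
  \<comment> \<open>With this fraction the rescaled small cube lies in the ball of radius \<open>\<delta>\<close>.\<close>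
  define \<eta> where "\<eta> = min 1 (\<delta> / (2 * CARD('n)))"
  have \<eta>: "0 < \<eta>" "\<eta> \<le> 1" "CARD('n) * \<eta> < \<delta>"
  proof -
    show "0 < \<eta>" "\<eta> \<le> 1" using \<delta> by (auto simp: \<eta>_def)
    have "CARD('n) * \<eta> \<le> CARD('n) * (\<delta> / (2 * CARD('n)))" by (intro mult_left_mono) (auto simp: \<eta>_def)
    also have "\<dots> < \<delta>" using \<delta> by simp
    finally show "CARD('n) * \<eta> < \<delta>" .
  qed
  define K1 where "K1 = K * (1 / \<eta>) powr (CARD('n) * r) / c powr p"
  have K1: "0 < K1" using K \<eta> c by (simp add: K1_def)
  have "ennpowr (\<integral>\<^sup>+x\<in>cube z (2 powi (- v)). ennreal (t x powr p) \<partial>lebesgue) (1 / p)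
      \<le> ennreal (K1 powr (1 / p)) * qnorm A \<phi> p q t (regular_functional (\<lambda>y. f ((2 powi v) *\<^sub>R (y - z))))" for v z
  proof -
    define l where "l = (2::real) powi (- v)"
    have l: "0 < l" "2 powi v * l = 1" by (auto simp: l_def power_int_minus)
    define W where "W = (\<integral>\<^sup>+x\<in>cube z l. ennreal (t x powr p) \<partial>lebesgue)"
    define E where "E = cube z (\<eta> * l)"
    define T where "T = regular_functional (\<lambda>y. f ((2 powi v) *\<^sub>R (y - z)))"
    define I where "I = (\<integral>\<^sup>+x. ennpowr (ennreal (t x * norm (conv (dilate \<phi> v) T x))) p \<partial>lebesgue)"
    have conv: "c \<le> norm (conv (dilate \<phi> v) T x)" if x: "x \<in> E" for x
    proof -
      have "\<bar>((2 powi v) *\<^sub>R (x - z)) $ i\<bar> \<le> \<eta>" for i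
      proof -
        have "0 < \<eta> * l" using \<eta> l by simp
        then have "\<bar>(x - z) $ i\<bar> \<le> \<eta> * l"
          using x[unfolded E_def mem_cube, rule_format, of i] by (simp add: abs_le_iff)
        then have "2 powi v * \<bar>(x - z) $ i\<bar> \<le> 2 powi v * (\<eta> * l)" by (intro mult_left_mono) auto
        also have "\<dots> = \<eta>" using l(2) by (simp add: mult.left_commute)
        finally show ?thesis by (simp add: abs_mult)
      qed
      then have "(\<Sum>i\<in>UNIV. \<bar>((2 powi v) *\<^sub>R (x - z)) $ i\<bar>) \<le> (\<Sum>i\<in>(UNIV::'n set). \<eta>)"
        by (intro sum_mono)
      then have "norm ((2 powi v) *\<^sub>R (x - z)) \<le> CARD('n) * \<eta>"
        using norm_le_l1_cart[of "(2 powi v) *\<^sub>R (x - z)"] by simp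
      then have "norm ((2 powi v) *\<^sub>R (x - z)) < \<delta>" using \<eta>(3) by simp
      from low[OF this] show ?thesis
        unfolding T_def conv_dilated_test_function[OF \<phi> f] by simp
    qed
    have "E \<subseteq> cube z l"
    proof
      fix x assume "x \<in> E"
      moreover have "\<eta> * l \<le> l" using \<eta> l by (intro mult_left_le_one_le) auto
      ultimately show "x \<in> cube z l" unfolding E_def mem_cube by (meson add_left_mono order_trans)
    qed
    then have "W \<le> ennreal (K * (l / (\<eta> * l)) powr (CARD('n) * r)) * (\<integral>\<^sup>+x\<in>E. ennreal (t x powr p) \<partial>lebesgue)"
      unfolding W_def E_def using l \<eta> by (intro dbl) auto
    also have "ennreal (K * (l / (\<eta> * l)) powr (CARD('n) * r)) = ennreal K1 * ennreal (c powr p)"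
      using l K \<eta> c by (simp add: K1_def flip: ennreal_mult)
    also have "ennreal K1 * ennreal (c powr p) * (\<integral>\<^sup>+x\<in>E. ennreal (t x powr p) \<partial>lebesgue) \<le> ennreal K1 * I"
      unfolding mult.assoc
    proof (intro mult_left_mono)
      have "ennreal (c powr p) * (\<integral>\<^sup>+x\<in>E. ennreal (t x powr p) \<partial>lebesgue)
          = (\<integral>\<^sup>+x. ennreal (c powr p) * (ennreal (t x powr p) * indicator E x) \<partial>lebesgue)"
        by (rule nn_integral_cmult[symmetric]) (simp add: E_def)
      also have "\<dots> \<le> I"
        unfolding I_def
      proof (rule nn_integral_mono)
        fix x
        show "ennreal (c powr p) * (ennreal (t x powr p) * indicator E x) \<le> ennpowr (ennreal (t x * norm (conv (dilate \<phi> v) T x))) p"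
        proof (cases "x \<in> E")
          case True
          have "c powr p * t x powr p \<le> (t x * norm (conv (dilate \<phi> v) T x)) powr p"
          proof -
            have "c * t x \<le> t x * norm (conv (dilate \<phi> v) T x)"
              using mult_left_mono[OF conv[OF True] nn[of x]] by (simp only: mult.commute)
            then have "(c * t x) powr p \<le> (t x * norm (conv (dilate \<phi> v) T x)) powr p"
              using c p nn[of x] by (intro powr_mono2) auto
            then show ?thesis using c nn[of x] by (simp add: powr_mult)
          qed
          then show ?thesis using True nn by (simp add: ennpowr_ennreal flip: ennreal_mult)
        qed simp
      qed
      finally show "ennreal (c powr p) * (\<integral>\<^sup>+x\<in>E. ennreal (t x powr p) \<partial>lebesgue) \<le> I" .
    qed simp
    finally have "ennpowr W (1 / p) \<le> ennpowr (ennreal K1 * I) (1 / p)" using p by (intro ennpowr_mono) auto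
    also have "\<dots> = ennreal (K1 powr (1 / p)) * Lp_qnorm p (\<lambda>x. ennreal (t x * norm (conv (dilate \<phi> v) T x)))"
      using K1 p by (simp add: ennpowr_cmult Lp_qnorm_def I_def)
    also have "\<dots> \<le> ennreal (K1 powr (1 / p)) * qnorm A \<phi> p q t T"
    proof (intro mult_left_mono)
      show "Lp_qnorm p (\<lambda>x. ennreal (t x * norm (conv (dilate \<phi> v) T x))) \<le> qnorm A \<phi> p q t T"
      proof (cases A)
        case Besov
        then show ?thesis
          using lq_qnorm_ge[OF q, of "\<lambda>k. Lp_qnorm p (\<lambda>x. ennreal (t x * norm (conv (dilate \<phi> k) T x)))" v] by simp
      next
        case Triebel_Lizorkin
        then show ?thesis
          using lq_qnorm_ge[OF q, of "\<lambda>k. ennreal (t x * norm (conv (dilate \<phi> k) T x))" v for x]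
          by simp (intro Lp_qnorm_mono_AE p AE_I2)
      qed
    qed simp
    finally show ?thesis unfolding T_def W_def l_def .
  qed
  moreover have "0 < K1 powr (1 / p)" using K1 by simp
  ultimately show ?thesis by blast
qed

text \<open>The same family of test functionals serves both weights, so the equivalence of the quasi-norms on it compares
\<open>\<integral>\<^sub>Q t1\<^sup>p\<close> and \<open>\<integral>\<^sub>Q t2\<^sup>p\<close>.\<close>

lemma dyadic_equiv_of_same_space:
  fixes \<phi> :: "real^'n::finite \<Rightarrow> complex" and t1 t2 :: "real^'n \<Rightarrow> real" and r :: real
  assumes \<phi>: "admissible \<phi>" and p: "0 < p" and q: "0 < q" and t: "weight t1" "weight t2"
    and A: "(\<lambda>x. t1 x powr p) \<in> muckenhoupt r" "(\<lambda>x. t2 x powr p) \<in> muckenhoupt r" and r: "1 < r"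
    and same: "same_space A \<phi> p q t1 t2"
  shows "dyadic_equiv (\<lambda>Q. cube_mean Q p t1) (\<lambda>Q. cube_mean Q p t2)"
proof -
  obtain M :: nat where "(CARD('n) * r + 1) / p \<le> real M" using real_arch_simple by blast
  then have M: "CARD('n) * r + 1 \<le> real M * p" using p by (simp add: pos_divide_le_eq)
  obtain f B c0 \<delta> C0 where f: "f \<in> borel_measurable borel" "\<And>x. norm (f x) \<le> B" "0 < c0" "0 < \<delta>" "0 < C0"
    "\<And>l x. 2 \<le> \<bar>l\<bar> \<Longrightarrow> (\<integral>u. f u * dilate \<phi> l (x - u) \<partial>lborel) = 0"
    "\<And>l x. norm (\<integral>u. f u * dilate \<phi> l (x - u) \<partial>lborel) \<le> C0 * (1 + norm x) powr (- real M)"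
    "\<And>x. norm x < \<delta> \<Longrightarrow> c0 \<le> norm (\<integral>u. f u * dilate \<phi> 0 (x - u) \<partial>lborel)"
    using test_function_exists[OF \<phi>, of M] by blast
  define T where "T v z = regular_functional (\<lambda>y. f ((2 powi v) *\<^sub>R (y - z)))" for v z
  define X where "X t v z = ennpowr (\<integral>\<^sup>+x\<in>cube z (2 powi (- v)). ennreal (t x powr p) \<partial>lebesgue) (1 / p)"
    for t :: "real^'n \<Rightarrow> real" and v z
  have up: "\<exists>c>0. \<forall>v z. qnorm A \<phi> p q t (T v z) \<le> ennreal c * X t v z"
    if "weight t" "(\<lambda>x. t x powr p) \<in> muckenhoupt r" for t
    unfolding T_def X_def
    by (rule test_functional_qnorm_upper[OF \<phi> p q f(1) f(5) _ _ that r M]) (use f(6,7) in blast)+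
  have low: "\<exists>c>0. \<forall>v z. X t v z \<le> ennreal c * qnorm A \<phi> p q t (T v z)"
    if "weight t" "(\<lambda>x. t x powr p) \<in> muckenhoupt r" for t
    unfolding T_def X_def
    by (rule test_functional_qnorm_lower[OF \<phi> p q f(1) f(3) f(4) _ that r]) (use f(8) in blast)
  obtain b1 b2 where b: "0 < b1" "0 < b2" "\<And>v z. qnorm A \<phi> p q t1 (T v z) \<le> ennreal b1 * X t1 v z"
      "\<And>v z. qnorm A \<phi> p q t2 (T v z) \<le> ennreal b2 * X t2 v z"
    using up[OF t(1) A(1)] up[OF t(2) A(2)] by blast
  obtain a1 a2 where a: "0 < a1" "0 < a2" "\<And>v z. X t1 v z \<le> ennreal a1 * qnorm A \<phi> p q t1 (T v z)"
      "\<And>v z. X t2 v z \<le> ennreal a2 * qnorm A \<phi> p q t2 (T v z)"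
    using low[OF t(1) A(1)] low[OF t(2) A(2)] by blast
  obtain c C where c: "0 < c" "0 < C" "\<And>g. g \<in> space_A A \<phi> p q t1 \<Longrightarrow>
      ennreal c * qnorm A \<phi> p q t1 g \<le> qnorm A \<phi> p q t2 g \<and> qnorm A \<phi> p q t2 g \<le> ennreal C * qnorm A \<phi> p q t1 g"
    using same unfolding same_space_def by blast
  have mem: "T v z \<in> space_A A \<phi> p q t1" for v z
  proof -
    have [measurable]: "f \<in> borel_measurable borel" by (rule f(1))
    have "T v z \<in> schwartz_infty_dual" unfolding T_def
      by (rule regular_functional_dual[of _ B]) (use f(2) in auto)
    moreover have "weight (\<lambda>x. t1 x powr p)" using A(1) by (simp add: muckenhoupt_def)
    then have "X t1 v z < \<infinity>" unfolding X_def
      by (intro ennpowr_lt_top weight_nn_integral_finite) (auto simp: cube_def)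
    then have "qnorm A \<phi> p q t1 (T v z) < \<infinity>"
      using le_less_trans[OF b(3)[of v z]] by (simp add: ennreal_mult_less_top)
    ultimately show ?thesis by (simp add: space_A_def)
  qed
  have X2: "X t2 v z \<le> ennreal (a2 * (C * b1)) * X t1 v z" for v z
  proof -
    have "X t2 v z \<le> ennreal a2 * qnorm A \<phi> p q t2 (T v z)" by (rule a(4))
    also have "\<dots> \<le> ennreal a2 * (ennreal C * qnorm A \<phi> p q t1 (T v z))"
      using c(3)[OF mem] by (intro mult_left_mono) auto
    also have "\<dots> \<le> ennreal a2 * (ennreal C * (ennreal b1 * X t1 v z))"
      using b(3) by (intro mult_left_mono) auto
    also have "\<dots> = ennreal (a2 * (C * b1)) * X t1 v z"
      using a b c by (simp add: ennreal_mult mult.assoc)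
    finally show ?thesis .
  qed
  have X1: "ennreal (c / (a1 * b2)) * X t1 v z \<le> X t2 v z" for v z
  proof -
    have "ennreal (c / (a1 * b2)) * X t1 v z \<le> ennreal (c / (a1 * b2)) * (ennreal a1 * qnorm A \<phi> p q t1 (T v z))"
      by (intro mult_left_mono a) auto
    also have "\<dots> = ennreal (1 / b2) * (ennreal c * qnorm A \<phi> p q t1 (T v z))"
      using a b c by (simp add: mult.assoc[symmetric] flip: ennreal_mult)
    also have "\<dots> \<le> ennreal (1 / b2) * (ennreal b2 * X t2 v z)"
      using order_trans[OF conjunct1[OF c(3)[OF mem]] b(4)] by (intro mult_left_mono) auto
    also have "\<dots> = X t2 v z" using b(2) by (simp add: mult.assoc[symmetric] flip: ennreal_mult)
    finally show ?thesis .
  qed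
  have mean: "cube_mean (half_open_cube z (2 powi (- v))) p t = ennreal ((1 / (2 powi (- v)) ^ CARD('n)) powr (1 / p)) * X t v z"
    if "weight t" for t :: "real^'n \<Rightarrow> real" and v z
  proof -
    define l where "l = (2::real) powi (- v)"
    have l: "0 < l" by (simp add: l_def)
    define W where "W = (\<integral>\<^sup>+x\<in>cube z l. ennreal (t x powr p) \<partial>lebesgue)"
    have "W / ennreal (l ^ CARD('n)) = ennreal (1 / l ^ CARD('n)) * W"
      using l by (simp add: divide_ennreal_def inverse_ennreal inverse_eq_divide mult.commute)
    then have "ennpowr (W / ennreal (l ^ CARD('n))) (1 / p) = ennreal ((1 / l ^ CARD('n)) powr (1 / p)) * ennpowr W (1 / p)"
      using l p by (simp add: ennpowr_cmult)
    moreover have "0 \<le> t x" for x using that by (simp add: weight_def)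
    ultimately show ?thesis
      unfolding cube_mean_def nn_integral_half_open_cube emeasure_half_open_cube l_def[symmetric] emeasure_cube[OF l]
        X_def W_def by simp
  qed
  have "ennreal (c / (a1 * b2)) * cube_mean Q p t1 \<le> cube_mean Q p t2 \<and>
      cube_mean Q p t2 \<le> ennreal (a2 * (C * b1)) * cube_mean Q p t1" if Q: "Q \<in> dyadic_cubes" for Q
  proof -
    obtain z v where Qz: "Q = half_open_cube z (2 powi (- v))" using Q by (rule dyadic_cubeE)
    define s where "s = ennreal ((1 / (2 powi (- v)) ^ CARD('n)) powr (1 / p))"
    have m: "cube_mean Q p t1 = s * X t1 v z" "cube_mean Q p t2 = s * X t2 v z"
      using mean t by (auto simp: Qz s_def)
    show ?thesis
      using mult_left_mono[OF X1[of v z], of s] mult_left_mono[OF X2[of v z], of s]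
      by (simp add: m mult.left_commute)
  qed
  moreover have "0 < c / (a1 * b2)" "0 < a2 * (C * b1)" using a b c by auto
  ultimately show ?thesis unfolding dyadic_equiv_def by blast
qed

section \<open>Equivalence of the spaces\<close>

lemma dyadic_equiv_cong:
  assumes "\<And>Q. Q \<in> dyadic_cubes \<Longrightarrow> F Q = F' Q" "\<And>Q. Q \<in> dyadic_cubes \<Longrightarrow> G Q = G' Q"
  shows "dyadic_equiv F G \<longleftrightarrow> dyadic_equiv F' G'"
  using assms by (simp add: dyadic_equiv_def)

lemma ennreal_mult_le_swap:
  assumes "0 < c" "ennreal c * x \<le> y"
  shows "x \<le> ennreal (1 / c) * y"
proof -
  have "ennreal (1 / c) * (ennreal c * x) \<le> ennreal (1 / c) * y" by (rule mult_left_mono[OF assms(2)]) simp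
  then show ?thesis using assms(1) by (simp add: mult.assoc[symmetric] flip: ennreal_mult)
qed

lemma dyadic_equiv_sym:
  assumes "dyadic_equiv F G" shows "dyadic_equiv G F"
proof -
  obtain c C where c: "0 < c" "0 < C" "\<And>Q. Q \<in> dyadic_cubes \<Longrightarrow> ennreal c * F Q \<le> G Q \<and> G Q \<le> ennreal C * F Q"
    using assms unfolding dyadic_equiv_def by blast
  have "ennreal (1 / C) * G Q \<le> F Q \<and> F Q \<le> ennreal (1 / c) * G Q" if "Q \<in> dyadic_cubes" for Q
  proof
    show "F Q \<le> ennreal (1 / c) * G Q" using ennreal_mult_le_swap c(1) c(3)[OF that] by blast
    have "ennreal (1 / C) * G Q \<le> ennreal (1 / C) * (ennreal C * F Q)"
      using c(3)[OF that] by (intro mult_left_mono) auto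
    then show "ennreal (1 / C) * G Q \<le> F Q" using c(2) by (simp add: mult.assoc[symmetric] flip: ennreal_mult)
  qed
  then show ?thesis unfolding dyadic_equiv_def using c(1,2)
    by (intro exI[of _ "1 / C"] exI[of _ "1 / c"] conjI) auto
qed

lemma dyadic_equiv_trans:
  assumes "dyadic_equiv F G" "dyadic_equiv G H" shows "dyadic_equiv F H"
proof -
  obtain c C where c: "0 < c" "0 < C" "\<And>Q. Q \<in> dyadic_cubes \<Longrightarrow> ennreal c * F Q \<le> G Q \<and> G Q \<le> ennreal C * F Q"
    using assms(1) unfolding dyadic_equiv_def by blast
  obtain d D where d: "0 < d" "0 < D" "\<And>Q. Q \<in> dyadic_cubes \<Longrightarrow> ennreal d * G Q \<le> H Q \<and> H Q \<le> ennreal D * G Q"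
    using assms(2) unfolding dyadic_equiv_def by blast
  have "ennreal (d * c) * F Q \<le> H Q \<and> H Q \<le> ennreal (D * C) * F Q" if Q: "Q \<in> dyadic_cubes" for Q
  proof
    have "ennreal d * (ennreal c * F Q) \<le> H Q"
      using order_trans[OF mult_left_mono[OF conjunct1[OF c(3)[OF Q]]] conjunct1[OF d(3)[OF Q]]] by simp
    then show "ennreal (d * c) * F Q \<le> H Q" using c d by (simp add: ennreal_mult mult.assoc)
    have "H Q \<le> ennreal D * (ennreal C * F Q)"
      using order_trans[OF conjunct2[OF d(3)[OF Q]] mult_left_mono[OF conjunct2[OF c(3)[OF Q]]]] by simp
    then show "H Q \<le> ennreal (D * C) * F Q" using c d by (simp add: ennreal_mult mult.assoc)
  qed
  then show ?thesis unfolding dyadic_equiv_def using c(1,2) d(1,2)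
    by (intro exI[of _ "d * c"] exI[of _ "D * C"] conjI) auto
qed

lemma cube_mean_one:
  assumes "Q \<in> sets lebesgue" "emeasure lebesgue Q = ennreal L" "0 < L"
  shows "cube_mean Q s (\<lambda>_. 1) = 1"
  using assms by (simp add: cube_mean_def divide_ennreal ennpowr_def)

lemma cube_mean_one_dyadic:
  assumes "Q \<in> dyadic_cubes"
  shows "cube_mean Q s (\<lambda>_. 1) = 1"
proof -
  obtain z v where Qz: "Q = half_open_cube z (2 powi (- v))" using assms by (rule dyadic_cubeE)
  show ?thesis
  proof (rule cube_mean_one)
    show "Q \<in> sets lebesgue" using assms by (rule dyadic_lebesgue)
    show "emeasure lebesgue Q = ennreal ((2 powi (- v)) ^ CARD('a))"
      unfolding Qz emeasure_half_open_cube by (rule emeasure_cube) simp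
  qed simp
qed

lemma weight_one: "weight (\<lambda>_::real^'n::finite. 1)"
  unfolding weight_def set_integrable_def
proof (intro conjI allI impI)
  fix K :: "(real^'n) set" assume "compact K"
  then have "K \<in> lmeasurable" by (rule lmeasurable_compact)
  then show "integrable lebesgue (\<lambda>x. indicator K x *\<^sub>R (1::real))"
    by (auto simp: fmeasurable_def simp del: emeasure_completion intro!: integrable_real_indicator)
qed auto

text \<open>The constant weight belongs to every class, so the unweighted space is an instance of the weighted equivalence.\<close>

lemma muckenhoupt_one: "(\<lambda>_::real^'n::finite. 1) \<in> muckenhoupt r"
proof -
  have "cube_mean Q s (\<lambda>_. 1) = 1" if "Q \<in> cubes" for Q :: "(real^'n) set" and s
  proof -
    obtain a l where "Q = cube a l" "0 < l" using \<open>Q \<in> cubes\<close> unfolding cubes_def cube_def by blast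
    then show ?thesis using cube_mean_one[OF cube_lebesgue emeasure_cube] by simp
  qed
  then have "(SUP Q\<in>cubes. cube_mean Q 1 (\<lambda>_::real^'n. 1) * cube_mean Q (conj_exp r / r) (\<lambda>x. inverse 1)) \<le> 1"
    by (intro SUP_least) simp
  then have "(SUP Q\<in>cubes. cube_mean Q 1 (\<lambda>_::real^'n. 1) * cube_mean Q (conj_exp r / r) (\<lambda>x. inverse 1)) < \<infinity>"
    by (rule le_less_trans) simp
  then show ?thesis using weight_one by (simp add: muckenhoupt_def)
qed

theorem theorem3p34:
  fixes \<phi> :: "real^'n::finite \<Rightarrow> complex"
    and \<theta> p \<sigma>\<^sub>1 :: real and q :: ennreal
    and t\<^sub>1 t\<^sub>2 :: "real^'n \<Rightarrow> real"
    and A :: scale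
  assumes "admissible \<phi>"
    and "0 < \<theta>" and "\<theta> < p" and "0 < q"
    and "\<sigma>\<^sub>1 = \<theta> * conj_exp (p / \<theta>)"
    and "weight t\<^sub>1" and "weight t\<^sub>2"
    and "(\<lambda>x. t\<^sub>1 x powr p) \<in> muckenhoupt (p / \<theta>)"
    and "(\<lambda>x. t\<^sub>2 x powr p) \<in> muckenhoupt (p / \<theta>)"
  shows "(same_space A \<phi> p q t\<^sub>1 t\<^sub>2 \<longleftrightarrow>
           dyadic_equiv (\<lambda>Q. cube_mean Q \<sigma>\<^sub>1 (\<lambda>x. inverse (t\<^sub>1 x)))
                        (\<lambda>Q. cube_mean Q \<sigma>\<^sub>1 (\<lambda>x. inverse (t\<^sub>2 x))) \<and>
           dyadic_equiv (\<lambda>Q. cube_mean Q p t\<^sub>1) (\<lambda>Q. cube_mean Q p t\<^sub>2)) \<and>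
         (same_space A \<phi> p q (\<lambda>_. 1) t\<^sub>1 \<longleftrightarrow>
           dyadic_equiv (\<lambda>Q. cube_mean Q \<sigma>\<^sub>1 (\<lambda>x. inverse (t\<^sub>1 x))) (\<lambda>Q. cube_mean Q p t\<^sub>1) \<and>
           dyadic_equiv (\<lambda>Q. cube_mean Q p t\<^sub>1) (\<lambda>_. 1))"
proof -
  have p: "0 < p" and r: "1 < p / \<theta>" using assms(2,3) by auto
  have part: "same_space A \<phi> p q s t \<longleftrightarrow>
      dyadic_equiv (\<lambda>Q. cube_mean Q \<sigma>\<^sub>1 (\<lambda>x. inverse (s x))) (\<lambda>Q. cube_mean Q \<sigma>\<^sub>1 (\<lambda>x. inverse (t x))) \<and>
      dyadic_equiv (\<lambda>Q. cube_mean Q p s) (\<lambda>Q. cube_mean Q p t)"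
    if w: "weight s" "weight t" and A: "(\<lambda>x. s x powr p) \<in> muckenhoupt (p / \<theta>)" "(\<lambda>x. t x powr p) \<in> muckenhoupt (p / \<theta>)"
    for s t :: "real^'n \<Rightarrow> real"
  proof
    assume "same_space A \<phi> p q s t"
    then have "dyadic_equiv (\<lambda>Q. cube_mean Q p s) (\<lambda>Q. cube_mean Q p t)"
      by (rule dyadic_equiv_of_same_space[OF assms(1) p assms(4) w A r])
    then show "dyadic_equiv (\<lambda>Q. cube_mean Q \<sigma>\<^sub>1 (\<lambda>x. inverse (s x))) (\<lambda>Q. cube_mean Q \<sigma>\<^sub>1 (\<lambda>x. inverse (t x))) \<and>
        dyadic_equiv (\<lambda>Q. cube_mean Q p s) (\<lambda>Q. cube_mean Q p t)"
      using dyadic_equiv_sigma_of_dyadic_equiv_p[OF assms(2,3,5) w A] by blast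
  next
    assume "dyadic_equiv (\<lambda>Q. cube_mean Q \<sigma>\<^sub>1 (\<lambda>x. inverse (s x))) (\<lambda>Q. cube_mean Q \<sigma>\<^sub>1 (\<lambda>x. inverse (t x))) \<and>
        dyadic_equiv (\<lambda>Q. cube_mean Q p s) (\<lambda>Q. cube_mean Q p t)"
    moreover have "weight (\<lambda>x. s x powr p)" "weight (\<lambda>x. t x powr p)" using A by (auto simp: muckenhoupt_def)
    ultimately show "same_space A \<phi> p q s t"
      using same_space_of_dyadic_equiv[OF p assms(4) w] by blast
  qed
  let ?U = "\<lambda>Q. cube_mean Q \<sigma>\<^sub>1 (\<lambda>x. inverse (t\<^sub>1 x))" and ?P = "\<lambda>Q. cube_mean Q p t\<^sub>1"
  have "same_space A \<phi> p q (\<lambda>_. 1) t\<^sub>1 \<longleftrightarrow> dyadic_equiv (\<lambda>_. 1) ?U \<and> dyadic_equiv (\<lambda>_. 1) ?P"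
  proof -
    have "(\<lambda>x::real^'n. (1::real) powr p) \<in> muckenhoupt (p / \<theta>)" using muckenhoupt_one by simp
    from part[OF weight_one assms(6) this assms(8)]
    have "same_space A \<phi> p q (\<lambda>_. 1) t\<^sub>1 \<longleftrightarrow>
        dyadic_equiv (\<lambda>Q. cube_mean Q \<sigma>\<^sub>1 (\<lambda>_. 1)) ?U \<and> dyadic_equiv (\<lambda>Q. cube_mean Q p (\<lambda>_. 1)) ?P"
      by simp
    also have "\<dots> \<longleftrightarrow> dyadic_equiv (\<lambda>_. 1) ?U \<and> dyadic_equiv (\<lambda>_. 1) ?P"
      by (intro arg_cong2[where f="(\<and>)"] dyadic_equiv_cong cube_mean_one_dyadic refl)
    finally show ?thesis .
  qed
  also have "\<dots> \<longleftrightarrow> dyadic_equiv ?U ?P \<and> dyadic_equiv ?P (\<lambda>_. 1)"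
    by (meson dyadic_equiv_sym dyadic_equiv_trans)
  finally show ?thesis using part[OF assms(6-9)] by blast
qed

end
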